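(* For every fixed integer $d\ge 1$, the problem $d$-\textsc{Contraction Blocker}$(\alpha)$ restricted to connected bipartite input graphs is solvable in polynomial time. Here $d$-\textsc{Contraction Blocker}$(\alpha)$ is the problem: given a graph $G$ and an integer $k$, decide whether there is a set $S\subseteq E(G)$ with $|S|\le k$ such that $\alpha(G/S)\le \alpha(G)-d$.
   Context: All graphs are finite and simple. $\alpha$ denotes the independence number. For $S\subseteq E(G)$, let $G|_S$ be the graph with vertex set $V(G)$ and edge set $S$; the contraction $G/S$ is the graph whose vertices correspond to the connected components of $G|_S$, two vertices being adjacent iff the corresponding components $A,B$ satisfy $\mathrm{dist}_G(V(A),V(B))=1$. *)

theory Defs
  imports
    Main
    "HOL-Library.Extended_Nat"
    "HOL-Computational_Algebra.Polynomial"
begin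

record 'a ugraph =
  gverts :: "'a set"
  gedges :: "'a set set"

definition simple_graph :: "'a ugraph \<Rightarrow> bool" where
  "simple_graph G \<longleftrightarrow>
     finite (gverts G) \<and> (\<forall>e\<in>gedges G. e \<subseteq> gverts G \<and> card e = 2)"

definition gwalk :: "'a ugraph \<Rightarrow> 'a list \<Rightarrow> bool" where
  "gwalk G p \<longleftrightarrow>
     p \<noteq> [] \<and> set p \<subseteq> gverts G \<and> successively (\<lambda>u v. {u, v} \<in> gedges G) p"

definition greachable :: "'a ugraph \<Rightarrow> 'a \<Rightarrow> 'a \<Rightarrow> bool" where
  "greachable G u v \<longleftrightarrow> (\<exists>p. gwalk G p \<and> hd p = u \<and> last p = v)"

text \<open>The graph without vertices does not count as connected.\<close>

definition connected_graph :: "'a ugraph \<Rightarrow> bool" where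
  "connected_graph G \<longleftrightarrow>
     gverts G \<noteq> {} \<and> (\<forall>u\<in>gverts G. \<forall>v\<in>gverts G. greachable G u v)"

definition bipartite_graph :: "'a ugraph \<Rightarrow> bool" where
  "bipartite_graph G \<longleftrightarrow>
     (\<exists>A B. A \<union> B = gverts G \<and> A \<inter> B = {} \<and>
        (\<forall>e\<in>gedges G. e \<inter> A \<noteq> {} \<and> e \<inter> B \<noteq> {}))"

definition independent_set :: "'a ugraph \<Rightarrow> 'a set \<Rightarrow> bool" where
  "independent_set G I \<longleftrightarrow>
     I \<subseteq> gverts G \<and> (\<forall>u\<in>I. \<forall>v\<in>I. {u, v} \<notin> gedges G)"

definition independence_number :: "'a ugraph \<Rightarrow> nat" where
  "independence_number G = Max (card ` {I. independent_set G I})"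

text \<open>The distance of two vertex sets is \<open>\<infinity>\<close> if no walk joins them.\<close>

definition set_dist :: "'a ugraph \<Rightarrow> 'a set \<Rightarrow> 'a set \<Rightarrow> enat" where
  "set_dist G A B =
     (INF p \<in> {p. gwalk G p \<and> hd p \<in> A \<and> last p \<in> B}. enat (length p - 1))"

definition edge_restriction :: "'a ugraph \<Rightarrow> 'a set set \<Rightarrow> 'a ugraph" where
  "edge_restriction G S = \<lparr>gverts = gverts G, gedges = S\<rparr>"

text \<open>A connected component is represented by its vertex set.\<close>

definition graph_components :: "'a ugraph \<Rightarrow> 'a set set" where
  "graph_components G = (\<lambda>u. {v. greachable G u v}) ` gverts G"

definition contraction :: "'a ugraph \<Rightarrow> 'a set set \<Rightarrow> 'a set ugraph" where
  "contraction G S =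
     (let \<C> = graph_components (edge_restriction G S)
      in \<lparr>gverts = \<C>,
          gedges = {{A, B} | A B. A \<in> \<C> \<and> B \<in> \<C> \<and> set_dist G A B = 1}\<rparr>)"

definition contraction_blocker_alpha :: "nat \<Rightarrow> 'a ugraph \<times> int \<Rightarrow> bool" where
  "contraction_blocker_alpha d = (\<lambda>(G, k).
     \<exists>S \<subseteq> gedges G. int (card S) \<le> k \<and>
       int (independence_number (contraction G S))
         \<le> int (independence_number G) - int d)"

text \<open>
  Structured programs for a random access machine whose memory consists of
  registers and of arrays of natural numbers, both named by natural numbers.
  A program mentions only finitely many registers and arrays, so they can be
  interleaved into a single memory at the price of a constant factor.

  Every operation has unit cost. As the only arithmetic is addition and
  truncated subtraction, the bit length of the numbers occurring in a run grows
  by at most a constant (depending on the program) per step; hence running time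
  is polynomially related to that of Turing machines. A multiplication
  instruction would destroy this.
\<close>

datatype ram_exp =
    Const nat
  | Reg nat
  | Cell nat ram_exp
  | Add ram_exp ram_exp
  | Monus ram_exp ram_exp

datatype ram_prog =
    Skip
  | SetReg nat ram_exp
  | SetCell nat ram_exp ram_exp
  | Seq ram_prog ram_prog
  | IfNZ ram_exp ram_prog ram_prog
  | WhileNZ ram_exp ram_prog

type_synonym ram_state = "(nat \<Rightarrow> nat) \<times> (nat \<Rightarrow> nat \<Rightarrow> nat)"

fun ram_val :: "ram_exp \<Rightarrow> ram_state \<Rightarrow> nat" where
  "ram_val (Const n) s = n"
| "ram_val (Reg r) s = fst s r"
| "ram_val (Cell a e) s = snd s a (ram_val e s)"
| "ram_val (Add e f) s = ram_val e s + ram_val f s"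
| "ram_val (Monus e f) s = ram_val e s - ram_val f s"

fun ram_cost :: "ram_exp \<Rightarrow> nat" where
  "ram_cost (Const n) = 1"
| "ram_cost (Reg r) = 1"
| "ram_cost (Cell a e) = Suc (ram_cost e)"
| "ram_cost (Add e f) = Suc (ram_cost e + ram_cost f)"
| "ram_cost (Monus e f) = Suc (ram_cost e + ram_cost f)"

text \<open>\<open>ram_exec c s t s'\<close>: started in \<open>s\<close>, the program \<open>c\<close> halts
  in \<open>s'\<close> after exactly \<open>t\<close> steps.\<close>

inductive ram_exec :: "ram_prog \<Rightarrow> ram_state \<Rightarrow> nat \<Rightarrow> ram_state \<Rightarrow> bool" where
  Skip: "ram_exec Skip s 1 s"
| SetReg: "ram_exec (SetReg r e) s (Suc (ram_cost e))
     ((fst s)(r := ram_val e s), snd s)"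
| SetCell: "ram_exec (SetCell a e f) s (Suc (ram_cost e + ram_cost f))
     (fst s, (snd s)(a := (snd s a)(ram_val e s := ram_val f s)))"
| Seq: "ram_exec c s t s' \<Longrightarrow> ram_exec c' s' t' s'' \<Longrightarrow>
     ram_exec (Seq c c') s (t + t') s''"
| IfTrue: "ram_val e s \<noteq> 0 \<Longrightarrow> ram_exec c s t s' \<Longrightarrow>
     ram_exec (IfNZ e c c') s (Suc (ram_cost e + t)) s'"
| IfFalse: "ram_val e s = 0 \<Longrightarrow> ram_exec c' s t s' \<Longrightarrow>
     ram_exec (IfNZ e c c') s (Suc (ram_cost e + t)) s'"
| WhileTrue: "ram_val e s \<noteq> 0 \<Longrightarrow> ram_exec c s t s' \<Longrightarrow>
     ram_exec (WhileNZ e c) s' t' s'' \<Longrightarrow>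
     ram_exec (WhileNZ e c) s (Suc (ram_cost e + t + t')) s''"
| WhileFalse: "ram_val e s = 0 \<Longrightarrow>
     ram_exec (WhileNZ e c) s (Suc (ram_cost e)) s"

text \<open>The input word is stored in array \<open>0\<close> and its length in register
  \<open>0\<close>; everything else is initially \<open>0\<close>.\<close>

definition ram_init :: "bool list \<Rightarrow> ram_state" where
  "ram_init w =
     ((\<lambda>r. if r = 0 then length w else 0),
      (\<lambda>a i. if a = 0 \<and> i < length w then of_bool (w ! i) else 0))"

text \<open>
  A decision problem is given by its set \<open>X\<close> of admissible inputs, the
  predicate \<open>Q\<close> of yes-instances, and an encoding of inputs as words.
  The machine answers ``yes'' by halting with a nonzero value in register
  \<open>0\<close>; nothing is required of its behaviour outside \<open>X\<close>.
\<close>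

definition poly_time_solvable ::
    "('i \<Rightarrow> bool list) \<Rightarrow> 'i set \<Rightarrow> ('i \<Rightarrow> bool) \<Rightarrow> bool" where
  "poly_time_solvable enc X Q \<longleftrightarrow>
     (\<exists>(c :: ram_prog) (p :: nat poly). \<forall>x\<in>X. \<exists>t s.
        ram_exec c (ram_init (enc x)) t s \<and>
        t \<le> poly p (length (enc x)) \<and>
        (fst s 0 \<noteq> 0 \<longleftrightarrow> Q x))"

text \<open>Least significant digit first.\<close>

fun binary :: "nat \<Rightarrow> bool list" where
  "binary n = (if n = 0 then [] else odd n # binary (n div 2))"

declare binary.simps [simp del]

text \<open>
  A graph with vertices \<open>0, \<dots>, n - 1\<close> is encoded by \<open>n\<close> in unary, a
  separator, and the rows of its adjacency matrix; then follow the sign and the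
  binary digits of the integer \<open>k\<close>.
\<close>

definition encode_instance :: "nat ugraph \<times> int \<Rightarrow> bool list" where
  "encode_instance = (\<lambda>(G, k).
     let n = card (gverts G)
     in replicate n True @ [False] @
        concat (map (\<lambda>i. map (\<lambda>j. {i, j} \<in> gedges G) [0..<n]) [0..<n]) @
        [k < 0] @ binary (nat \<bar>k\<bar>))"

definition standard_vertices :: "nat ugraph \<Rightarrow> bool" where
  "standard_vertices G \<longleftrightarrow> gverts G = {..<card (gverts G)}"

end

theory Submission imports Defs begin

text \<open>
  By Konig's theorem a bipartite graph \<open>G\<close> is partitioned into \<open>\<alpha>(G)\<close> cliques, each
  a vertex or an edge. If \<open>G\<close> is connected and \<open>\<alpha>(G) > d\<close>, then \<open>d + 1\<close> suitable cliques
  can be contracted to one vertex by at most \<open>2 * d + 1\<close> edges, and the remaining cliques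
  witness that this lowers \<open>\<alpha>\<close> by \<open>d\<close>; if \<open>\<alpha>(G) \<le> d\<close>, there is no solution as \<open>\<alpha>\<close> stays
  positive. So only the polynomially many edge sets \<open>S\<close> with \<open>|S| \<le> 2 * d + 1\<close> matter.

  An independent set of \<open>G / S\<close> is split into at most \<open>2 * d + 1\<close> guessed vertices, among
  them all contracted ones, and an independent set of an induced subgraph of \<open>G\<close>. The
  independence number of the latter comes from a maximum matching, computed by an
  auction, which also yields Konig's theorem.
\<close>

section \<open>Loop programs\<close>

text \<open>The constant \<open>2 * d + 1\<close> counts at most \<open>d + 1\<close> edges inside
  the merged cliques and \<open>d\<close> edges joining them. The obstacle is that
  \<open>G / S\<close> is in general not bipartite, so its independence number cannot be read off a
  matching. However, every component with two or more vertices contains an edge of \<open>S\<close>,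
  so at most \<open>|S|\<close> vertices of \<open>G / S\<close> are contracted ones. Once their
  part of an independent set is guessed, what remains lies in an induced subgraph of
  \<open>G\<close>, which is bipartite again. As only an upper bound on the independence number of
  \<open>G / S\<close> has to be tested, the test is a universal statement over guesses inside an
  existential one over edge sets, and both quantifiers become loops nested to a depth that depends
  on \<open>d\<close> alone. An auction, unlike a search for augmenting paths, needs only two arrays
  and a current bidder, each of its moves is one scan for a minimum, and a potential bounds the
  number of moves; so it fits into counting loops without early exit.\<close>

datatype lprog =
    LSkip
  | LReg nat ram_exp
  | LCell nat ram_exp ram_exp
  | LSeq lprog lprog (infixr \<open>;;;\<close> 55)
  | LIf ram_exp lprog lprog
  | LFor nat nat lprog

fun compile :: "lprog \<Rightarrow> ram_prog" where
  "compile LSkip = Skip"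
| "compile (LReg r e) = SetReg r e"
| "compile (LCell a e f) = SetCell a e f"
| "compile (LSeq c d) = Seq (compile c) (compile d)"
| "compile (LIf e c d) = IfNZ e (compile c) (compile d)"
| "compile (LFor r b c) =
     Seq (SetReg r (Const 0))
       (WhileNZ (Monus (Reg b) (Reg r)) (Seq (compile c) (SetReg r (Add (Reg r) (Const 1)))))"

section \<open>Semantics, footprints and running times of loop programs\<close>

definition rset :: "nat \<Rightarrow> nat \<Rightarrow> ram_state \<Rightarrow> ram_state" where
  "rset r x s = ((fst s)(r := x), snd s)"

definition cset :: "nat \<Rightarrow> nat \<Rightarrow> nat \<Rightarrow> ram_state \<Rightarrow> ram_state" where
  "cset a i x s = (fst s, (snd s)(a := (snd s a)(i := x)))"

lemma rset_simps [simp]: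
  "fst (rset r x s) y = (if y = r then x else fst s y)"
  "snd (rset r x s) = snd s"
  by (simp_all add: rset_def)

lemma cset_simps [simp]:
  "fst (cset a i x s) = fst s"
  "snd (cset a i x s) b = (if b = a then (snd s a)(i := x) else snd s b)"
  by (simp_all add: cset_def)

text \<open>A loop is a function power whose exponent is read on entry, so the semantics is a total
  function. It agrees with the compiled while loop as soon as the body writes neither the bound nor
  the counter; \<open>counters_safe\<close> and the disjointness of \<open>lbounds\<close> and
  \<open>rwrites\<close> express this.\<close>

fun lrun :: "lprog \<Rightarrow> ram_state \<Rightarrow> ram_state" where
  "lrun LSkip s = s"
| "lrun (LReg r e) s = rset r (ram_val e s) s"
| "lrun (LCell a e f) s = cset a (ram_val e s) (ram_val f s) s"
| "lrun (LSeq c d) s = lrun d (lrun c s)"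
| "lrun (LIf e c d) s = (if ram_val e s \<noteq> 0 then lrun c s else lrun d s)"
| "lrun (LFor r b c) s =
     ((\<lambda>t. rset r (Suc (fst t r)) (lrun c t)) ^^ (fst s b)) (rset r 0 s)"

fun rwrites :: "lprog \<Rightarrow> nat set" where
  "rwrites LSkip = {}"
| "rwrites (LReg r e) = {r}"
| "rwrites (LCell a e f) = {}"
| "rwrites (LSeq c d) = rwrites c \<union> rwrites d"
| "rwrites (LIf e c d) = rwrites c \<union> rwrites d"
| "rwrites (LFor r b c) = insert r (rwrites c)"

fun awrites :: "lprog \<Rightarrow> nat set" where
  "awrites LSkip = {}"
| "awrites (LReg r e) = {}"
| "awrites (LCell a e f) = {a}"
| "awrites (LSeq c d) = awrites c \<union> awrites d"
| "awrites (LIf e c d) = awrites c \<union> awrites d"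
| "awrites (LFor r b c) = awrites c"

fun lbounds :: "lprog \<Rightarrow> nat set" where
  "lbounds LSkip = {}"
| "lbounds (LReg r e) = {}"
| "lbounds (LCell a e f) = {}"
| "lbounds (LSeq c d) = lbounds c \<union> lbounds d"
| "lbounds (LIf e c d) = lbounds c \<union> lbounds d"
| "lbounds (LFor r b c) = insert b (lbounds c)"

fun counters_safe :: "lprog \<Rightarrow> bool" where
  "counters_safe LSkip = True"
| "counters_safe (LReg r e) = True"
| "counters_safe (LCell a e f) = True"
| "counters_safe (LSeq c d) = (counters_safe c \<and> counters_safe d)"
| "counters_safe (LIf e c d) = (counters_safe c \<and> counters_safe d)"
| "counters_safe (LFor r b c) = (r \<notin> rwrites c \<and> counters_safe c)"

text \<open>The argument is a common bound on all loop-bound registers. A loop pays \<open>6\<close>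
  for initialising the counter (\<open>2\<close>) and for the final test (\<open>4\<close>), and
  \<open>8\<close> per round for a test and an increment of \<open>4\<close> each. Branches are
  added, which bounds their maximum by a polynomial.\<close>

fun ltime :: "lprog \<Rightarrow> nat poly" where
  "ltime LSkip = [:1:]"
| "ltime (LReg r e) = [:Suc (ram_cost e):]"
| "ltime (LCell a e f) = [:Suc (ram_cost e + ram_cost f):]"
| "ltime (LSeq c d) = ltime c + ltime d"
| "ltime (LIf e c d) = [:Suc (ram_cost e):] + ltime c + ltime d"
| "ltime (LFor r b c) = [:6:] + [:0, 1:] * ([:8:] + ltime c)"

lemma lrun_frame_reg: "r \<notin> rwrites c \<Longrightarrow> fst (lrun c s) r = fst s r"
proof (induction c arbitrary: s)
  case (LFor q b c)
  have "fst (((\<lambda>t. rset q (Suc (fst t q)) (lrun c t)) ^^ k) (rset q 0 s)) r = fst s r" for k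
    using LFor by (induction k) auto
  then show ?case by simp
qed auto

lemma lrun_frame_array: "a \<notin> awrites c \<Longrightarrow> snd (lrun c s) a = snd s a"
proof (induction c arbitrary: s)
  case (LFor q b c)
  have "snd (((\<lambda>t. rset q (Suc (fst t q)) (lrun c t)) ^^ k) (rset q 0 s)) a = snd s a" for k
    using LFor by (induction k) auto
  then show ?case by simp
qed auto

lemma lrun_for_counter:
  assumes "r \<notin> rwrites c"
  shows "fst (((\<lambda>t. rset r (Suc (fst t r)) (lrun c t)) ^^ k) (rset r 0 s)) r = k"
  by (induction k) (auto simp: lrun_frame_reg[OF assms])

text \<open>The proof rule for all loops. Having the counter value and the frame as premises keeps
  the invariants down to what the body really changes.\<close>

lemma lrun_for:
  assumes "counters_safe (LFor r b c)"
    and "I 0 (rset r 0 s)"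
    and "\<And>i t. \<lbrakk> i < fst s b; fst t r = i; \<And>x. x \<notin> insert r (rwrites c) \<Longrightarrow> fst t x = fst s x;
           \<And>a. a \<notin> awrites c \<Longrightarrow> snd t a = snd s a; I i t \<rbrakk> \<Longrightarrow>
           I (Suc i) (rset r (Suc i) (lrun c t))"
  shows "I (fst s b) (lrun (LFor r b c) s)"
proof -
  define T where "T k = ((\<lambda>t. rset r (Suc (fst t r)) (lrun c t)) ^^ k) (rset r 0 s)" for k
  have cnt: "fst (T k) r = k" for k
    unfolding T_def using assms(1) by (intro lrun_for_counter) auto
  have fr: "fst (T k) x = fst s x" if "x \<notin> insert r (rwrites c)" for k x
    using that by (induction k) (auto simp: T_def lrun_frame_reg)
  have fa: "snd (T k) a = snd s a" if "a \<notin> awrites c" for k a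
    using that by (induction k) (auto simp: T_def lrun_frame_array)
  have "k \<le> fst s b \<Longrightarrow> I k (T k)" for k
  proof (induction k)
    case 0
    then show ?case using assms(2) by (simp add: T_def)
  next
    case (Suc k)
    have "I (Suc k) (rset r (Suc k) (lrun c (T k)))"
      using Suc by (intro assms(3)) (auto simp: cnt fr fa)
    moreover have "T (Suc k) = rset r (Suc (fst (T k) r)) (lrun c (T k))"
      by (simp add: T_def)
    ultimately show ?case by (simp add: cnt)
  qed
  then show ?thesis by (simp add: T_def)
qed

text \<open>Loop bounds are never written, so their initial bound \<open>B\<close> limits every loop
  at every nesting depth, and the time is a polynomial in \<open>B\<close> read off the
  syntax.\<close>

lemma lprog_terminates_in_ltime:
  assumes "counters_safe c" "lbounds c \<inter> rwrites c = {}" "\<And>b. b \<in> lbounds c \<Longrightarrow> fst s b \<le> B"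
  shows "\<exists>t. ram_exec (compile c) s t (lrun c s) \<and> t \<le> poly (ltime c) B"
  using assms
proof (induction c arbitrary: s)
  case LSkip
  then show ?case by (auto intro!: ram_exec.intros exI[of _ "1::nat"])
next
  case (LReg r e)
  then show ?case unfolding compile.simps lrun.simps rset_def
    by (auto intro!: ram_exec.intros exI)
next
  case (LCell a e f)
  then show ?case unfolding compile.simps lrun.simps cset_def
    by (auto intro!: ram_exec.intros exI)
next
  case (LSeq c d)
  obtain t where t: "ram_exec (compile c) s t (lrun c s)" "t \<le> poly (ltime c) B"
    using LSeq.IH(1)[of s] LSeq.prems by auto
  have "fst (lrun c s) b \<le> B" if "b \<in> lbounds d" for b
    using that LSeq.prems lrun_frame_reg[of b c s] by fastforce
  then obtain u where u: "ram_exec (compile d) (lrun c s) u (lrun d (lrun c s))"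
      "u \<le> poly (ltime d) B"
    using LSeq.IH(2)[of "lrun c s"] LSeq.prems by auto
  show ?case
    using ram_exec.Seq[OF t(1) u(1)] t(2) u(2) by (auto intro!: exI)
next
  case (LIf e c d)
  show ?case
  proof (cases "ram_val e s = 0")
    case True
    obtain t where t: "ram_exec (compile d) s t (lrun d s)" "t \<le> poly (ltime d) B"
      using LIf.IH(2)[of s] LIf.prems by auto
    show ?thesis
      using ram_exec.IfFalse[OF True t(1), of "compile c"] t(2) True by (auto intro!: exI)
  next
    case False
    obtain t where t: "ram_exec (compile c) s t (lrun c s)" "t \<le> poly (ltime c) B"
      using LIf.IH(1)[of s] LIf.prems by auto
    show ?thesis
      using ram_exec.IfTrue[OF False t(1), of "compile d"] t(2) False by (auto intro!: exI)
  qed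
next
  case (LFor r b c)
  define T where "T k = ((\<lambda>t. rset r (Suc (fst t r)) (lrun c t)) ^^ k) (rset r 0 s)" for k
  define W where "W = WhileNZ (Monus (Reg b) (Reg r))
    (Seq (compile c) (SetReg r (Add (Reg r) (Const 1))))"
  have cnt: "fst (T k) r = k" for k
    unfolding T_def using LFor.prems by (intro lrun_for_counter) auto
  have fr: "fst (T k) x = fst s x" if "x \<notin> insert r (rwrites c)" for k x
    using that by (induction k) (auto simp: T_def lrun_frame_reg)
  have br: "b \<noteq> r" using LFor.prems by auto
  have fb: "fst (T k) b = fst s b" for k
    using LFor.prems by (intro fr) auto
  define N where "N = fst s b"
  \<comment> \<open>The execution is built from its end: \<open>k\<close> is the number of rounds
    still to go, so the induction prepends one round to a run that is known to halt.\<close>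
  have "k \<le> N \<Longrightarrow> \<exists>t. ram_exec W (T (N - k)) t (T N) \<and> t \<le> 4 + k * (8 + poly (ltime c) B)" for k
  proof (induction k)
    case 0
    have "ram_exec W (T N) (Suc (ram_cost (Monus (Reg b) (Reg r)))) (T N)"
      unfolding W_def by (intro ram_exec.WhileFalse) (simp add: fb cnt N_def)
    then show ?case by (auto intro!: exI)
  next
    case (Suc k)
    define j where "j = N - Suc k"
    have j: "j < N" "N - k = Suc j" using Suc.prems by (auto simp: j_def)
    have nz: "ram_val (Monus (Reg b) (Reg r)) (T j) \<noteq> 0"
      using j by (simp add: fb cnt N_def)
    have "\<exists>t. ram_exec (compile c) (T j) t (lrun c (T j)) \<and> t \<le> poly (ltime c) B"
    proof (rule LFor.IH)
      fix x assume x: "x \<in> lbounds c"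
      then have "x \<notin> insert r (rwrites c)" using LFor.prems by auto
      then show "fst (T j) x \<le> B" using x fr LFor.prems(3)[of x] by simp
    qed (use LFor.prems in auto)
    then obtain t1 where t1: "ram_exec (compile c) (T j) t1 (lrun c (T j))" "t1 \<le> poly (ltime c) B"
      by blast
    have r: "fst (lrun c (T j)) r = j"
      using LFor.prems cnt[of j] by (simp add: lrun_frame_reg)
    have st: "T (Suc j) = rset r (Suc j) (lrun c (T j))"
      using cnt[of j] by (simp add: T_def)
    have e2: "ram_exec (SetReg r (Add (Reg r) (Const 1))) (lrun c (T j)) 4 (T (Suc j))"
      using ram_exec.SetReg[of r "Add (Reg r) (Const 1)" "lrun c (T j)"] r
      by (simp add: st rset_def eval_nat_numeral)
    obtain t3 where t3: "ram_exec W (T (Suc j)) t3 (T N)" "t3 \<le> 4 + k * (8 + poly (ltime c) B)"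
      using Suc j by auto
    have "ram_exec W (T j) (Suc (ram_cost (Monus (Reg b) (Reg r)) + (t1 + 4) + t3)) (T N)"
      unfolding W_def
      by (rule ram_exec.WhileTrue[OF nz ram_exec.Seq[OF t1(1) e2]])
        (use t3(1) in \<open>simp add: W_def\<close>)
    moreover have "Suc (ram_cost (Monus (Reg b) (Reg r)) + (t1 + 4) + t3)
        \<le> 4 + Suc k * (8 + poly (ltime c) B)"
      using t1(2) t3(2) by simp
    ultimately show ?case by (auto simp: j_def)
  qed
  from this[of N] obtain t where t: "ram_exec W (T 0) t (T N)" "t \<le> 4 + N * (8 + poly (ltime c) B)"
    by auto
  have i: "ram_exec (SetReg r (Const 0)) s 2 (T 0)"
    using ram_exec.SetReg[of r "Const 0" s] by (simp add: T_def rset_def eval_nat_numeral)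
  have "N * (8 + poly (ltime c) B) \<le> B * (8 + poly (ltime c) B)"
    using LFor.prems by (intro mult_right_mono) (auto simp: N_def)
  then have "2 + t \<le> 6 + B * (8 + poly (ltime c) B)"
    using t(2) by linarith
  then have "2 + t \<le> poly (ltime (LFor r b c)) B"
    by (simp add: algebra_simps)
  moreover have "lrun (LFor r b c) s = T N" by (simp add: T_def N_def)
  ultimately show ?case
    using ram_exec.Seq[OF i t(1)] unfolding W_def compile.simps by metis
qed

section \<open>Bipartite matching by auction\<close>

text \<open>Left vertices are introduced one after the other and bid for a cheapest neighbour \<open>r\<close>
  of price \<open>p r < n\<close>, raising the price by one and evicting the previous mate. Left vertices
  are shifted by one in \<open>mt r\<close> (the mate of \<open>r\<close>) and in \<open>cu\<close> (the current bidder),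
  where \<open>0\<close> means that there is none; the left vertices \<open>0, \<dots>, nx - 1\<close> have been
  introduced.\<close>

definition auction_inv ::
    "nat \<Rightarrow> (nat \<Rightarrow> nat \<Rightarrow> bool) \<Rightarrow> (nat \<Rightarrow> nat) \<Rightarrow> (nat \<Rightarrow> nat) \<Rightarrow> nat \<Rightarrow> nat \<Rightarrow> bool" where
  "auction_inv n E p mt nx cu \<longleftrightarrow>
     nx \<le> n \<and> cu \<le> nx \<and>
     (\<forall>r<n. p r \<le> n \<and> (0 < p r \<longrightarrow> 0 < mt r) \<and>
        (0 < mt r \<longrightarrow> mt r \<le> nx \<and> mt r \<noteq> cu \<and> E (mt r - 1) r \<and>
           (\<forall>r'<n. E (mt r - 1) r' \<longrightarrow> p r \<le> Suc (p r')))) \<and>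
     inj_on mt {r. r < n \<and> 0 < mt r} \<and>
     (\<forall>l. 0 < l \<and> l \<le> nx \<and> l \<noteq> cu \<and> l \<notin> mt ` {..<n} \<longrightarrow> (\<forall>r<n. E (l - 1) r \<longrightarrow> n \<le> p r))"

text \<open>Each of the three moves raises it: a bid raises a price, giving up sets
  \<open>cu\<close> to \<open>0\<close>, and introducing a vertex gains \<open>2\<close> while
  losing the last summand, whence the factor \<open>2\<close>.\<close>

definition auction_pot :: "nat \<Rightarrow> (nat \<Rightarrow> nat) \<Rightarrow> nat \<Rightarrow> nat \<Rightarrow> nat" where
  "auction_pot n p nx cu = 2 * nx + (\<Sum>r<n. p r) + of_bool (cu = 0)"

lemma auction_invD:
  assumes "auction_inv n E p mt nx cu"
  shows "nx \<le> n" "cu \<le> nx"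
    and "\<And>r. r < n \<Longrightarrow> p r \<le> n"
    and "\<And>r. \<lbrakk> r < n; 0 < p r \<rbrakk> \<Longrightarrow> 0 < mt r"
    and "\<And>r. \<lbrakk> r < n; 0 < mt r \<rbrakk> \<Longrightarrow> mt r \<le> nx"
    and "\<And>r. \<lbrakk> r < n; 0 < mt r \<rbrakk> \<Longrightarrow> mt r \<noteq> cu"
    and "\<And>r. \<lbrakk> r < n; 0 < mt r \<rbrakk> \<Longrightarrow> E (mt r - 1) r"
    and "\<And>r r'. \<lbrakk> r < n; 0 < mt r; r' < n; E (mt r - 1) r' \<rbrakk> \<Longrightarrow> p r \<le> Suc (p r')"
    and "inj_on mt {r. r < n \<and> 0 < mt r}"
    and "\<And>l r. \<lbrakk> 0 < l; l \<le> nx; l \<noteq> cu; l \<notin> mt ` {..<n}; r < n; E (l - 1) r \<rbrakk> \<Longrightarrow> n \<le> p r"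
  using assms unfolding auction_inv_def by blast+

lemma auction_inv_init: "auction_inv n E (\<lambda>_. 0) (\<lambda>_. 0) 0 0"
  by (auto simp: auction_inv_def inj_on_def)

lemma auction_inv_cong:
  assumes "\<And>r. r < n \<Longrightarrow> p r = p' r" "\<And>r. r < n \<Longrightarrow> mt r = mt' r"
  shows "auction_inv n E p mt nx cu = auction_inv n E p' mt' nx cu"
proof -
  have "mt ` {..<n} = mt' ` {..<n}" using assms by (intro image_cong) auto
  moreover have "{r. r < n \<and> 0 < mt r} = {r. r < n \<and> 0 < mt' r}" using assms by auto
  moreover have "inj_on mt {r. r < n \<and> 0 < mt r} = inj_on mt' {r. r < n \<and> 0 < mt r}"
    using assms by (intro inj_on_cong) auto
  ultimately show ?thesis
    using assms unfolding auction_inv_def by (simp cong: conj_cong)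
qed

lemma auction_inv_advance:
  assumes "auction_inv n E p mt nx 0" "nx < n"
  shows "auction_inv n E p mt (Suc nx) (Suc nx)"
  using assms unfolding auction_inv_def
  by (auto simp: le_Suc_eq)

lemma auction_inv_drop:
  assumes "auction_inv n E p mt nx cu" "\<And>r. r < n \<Longrightarrow> E (cu - 1) r \<Longrightarrow> n \<le> p r"
  shows "auction_inv n E p mt nx 0"
  using assms unfolding auction_inv_def by auto

text \<open>A matched left vertex owns a neighbour that is at most one dearer than its cheapest. The
  new owner takes a cheapest neighbour whose price rises by one, so its slack is at most one; the
  other owners only see foreign prices rise. The evicted mate \<open>mt r\<close>, or
  \<open>0\<close>, becomes the bidder.\<close>

lemma auction_inv_bid:
  assumes inv: "auction_inv n E p mt nx cu" and cu: "cu \<noteq> 0"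
    and r: "r < n" "E (cu - 1) r" "p r < n"
    and mn: "\<And>r'. r' < n \<Longrightarrow> E (cu - 1) r' \<Longrightarrow> p r \<le> p r'"
  shows "auction_inv n E (p(r := Suc (p r))) (mt(r := cu)) nx (mt r)"
proof -
  let ?p = "p(r := Suc (p r))" and ?m = "mt(r := cu)"
  note D = auction_invD[OF inv]
  note i1 = D(1,2) and i2 = D(3-7) and i3 = D(8)
  have i4: "x = y" if "x < n" "y < n" "0 < mt x" "mt x = mt y" for x y
    using inj_onD[OF D(9), of x y] that by simp
  have i5: "n \<le> p x" if "0 < l" "l \<le> nx" "l \<noteq> cu" "\<And>y. y < n \<Longrightarrow> mt y \<noteq> l" "x < n" "E (l - 1) x" for l x
    using D(10)[of l x] that by blast
  have mono: "p x \<le> ?p x" for x by auto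
  have mr: "mt r \<le> nx" using i2[OF r(1)] by (cases "mt r") auto
  have a: "?p x \<le> n \<and> (0 < ?p x \<longrightarrow> 0 < ?m x) \<and>
        (0 < ?m x \<longrightarrow> ?m x \<le> nx \<and> ?m x \<noteq> mt r \<and> E (?m x - 1) x \<and>
           (\<forall>r'<n. E (?m x - 1) r' \<longrightarrow> ?p x \<le> Suc (?p r')))" if x: "x < n" for x
  proof (cases "x = r")
    case True
    have "cu \<noteq> mt r" using i2(4)[OF r(1)] cu by auto
    then show ?thesis using True r mn i1 cu by auto
  next
    case False
    have "?p x \<le> Suc (?p r')" if "0 < mt x" "r' < n" "E (mt x - 1) r'" for r'
      using i3[OF x that] mono[of r'] False by simp
    moreover have "mt x \<noteq> mt r" if "0 < mt x"
      using i4[OF x r(1) that] False by auto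
    ultimately show ?thesis using False i2[OF x] by simp
  qed
  have b: "inj_on ?m {x. x < n \<and> 0 < ?m x}"
    using i4 i2(4) by (auto simp: inj_on_def)
  have c: "n \<le> ?p x" if l: "0 < l" "l \<le> nx" "l \<noteq> mt r" "l \<notin> ?m ` {..<n}" "x < n" "E (l - 1) x" for l x
  proof -
    have "l \<noteq> cu" using l(4) r(1) by (auto simp: image_iff)
    moreover have "mt y \<noteq> l" if "y < n" for y
      using l(3,4) that by (cases "y = r") (auto simp: image_iff)
    ultimately have "n \<le> p x" using i5 l by blast
    then show ?thesis using mono[of x] by simp
  qed
  show ?thesis unfolding auction_inv_def using a b c i1 mr by blast
qed

lemma auction_pot_bid:
  assumes "r < n" "cu \<noteq> 0"
  shows "auction_pot n p nx cu < auction_pot n (p(r := Suc (p r))) nx cu'"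
proof -
  have "(\<Sum>x<n. (p(r := Suc (p r))) x) = Suc (\<Sum>x<n. p x)"
    using assms(1) by (simp add: sum.remove[of "{..<n}" r])
  then show ?thesis using assms by (simp add: auction_pot_def)
qed

lemma auction_pot_bound:
  assumes "auction_inv n E p mt nx cu"
  shows "auction_pot n p nx cu < (n + 2) * (n + 2)"
proof -
  have "(\<Sum>r<n. p r) \<le> (\<Sum>r<n. n)"
    using assms by (intro sum_mono) (auto simp: auction_inv_def)
  moreover have "nx \<le> n" using assms by (auto simp: auction_inv_def)
  ultimately show ?thesis by (auto simp: auction_pot_def)
qed

text \<open>A value in \<open>{0..n}\<close> that is no label separates high from low labels; the right
  vertices with high label and the left vertices with a neighbour of low label form a vertex
  cover that meets every matching edge exactly once.\<close>

lemma auction_final_independent: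
  assumes inv: "auction_inv n E p mt n 0"
  shows "\<exists>I J. I \<subseteq> {..<n} \<and> J \<subseteq> {..<n} \<and> (\<forall>l\<in>I. \<forall>r\<in>J. \<not> E l r) \<and>
    2 * n \<le> card I + card J + card {r. r < n \<and> 0 < mt r}"
proof -
  \<comment> \<open>Pigeonhole: \<open>n\<close> prices cannot take all \<open>n + 1\<close> values
    from \<open>0\<close> to \<open>n\<close>.\<close>
  have "\<exists>t\<le>n. t \<notin> p ` {..<n}"
  proof (rule ccontr)
    assume "\<not> ?thesis"
    then have "{..n} \<subseteq> p ` {..<n}" by auto
    then have "card {..n} \<le> card (p ` {..<n})" by (intro card_mono) auto
    also have "\<dots> \<le> n" using card_image_le[of "{..<n}" p] by simp
    finally show False by simp
  qed
  then obtain t where t: "t \<le> n" "\<And>r. r < n \<Longrightarrow> p r \<noteq> t" by auto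
  note D = auction_invD[OF inv]
  note i2 = D(4,5,7) and i3 = D(8)
  have i5: "n \<le> p x" if "0 < l" "l \<le> n" "\<And>y. y < n \<Longrightarrow> mt y \<noteq> l" "x < n" "E (l - 1) x" for l x
    using D(10)[of l x] that by blast
  define M where "M = {r. r < n \<and> 0 < mt r}"
  define H where "H = {r. r < n \<and> t < p r}"
  define L where "L = {l. l < n \<and> (\<exists>r<n. E l r \<and> p r < t)}"
  have fin: "finite M" "finite H" "finite L" by (auto simp: M_def H_def L_def)
  have HM: "H \<subseteq> M" using i2(1) by (auto simp: H_def M_def)
  have "Suc ` L \<subseteq> mt ` (M - H)"
  proof
    fix l assume "l \<in> Suc ` L"
    then obtain k r where k: "l = Suc k" "k < n" "r < n" "E k r" "p r < t"
      by (auto simp: L_def)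
    \<comment> \<open>An unmatched vertex would see only prices of at least
      \<open>n \<ge> t\<close>, but \<open>r\<close> is cheaper than \<open>t\<close>.\<close>
    have "\<exists>y<n. mt y = l"
    proof (rule ccontr)
      assume "\<not> ?thesis"
      then have "n \<le> p r" using k by (intro i5[of l]) auto
      then show False using k t by simp
    qed
    then obtain y where y: "y < n" "mt y = l" by blast
    \<comment> \<open>\<open>p y \<le> Suc (p r) \<le> t\<close>, and no price equals
      \<open>t\<close>; the gap at \<open>t\<close> absorbs the slack of one, and \<open>y\<close>
      has a low label.\<close>
    have "p y \<le> Suc (p r)" using y k by (intro i3) auto
    then have "p y < t" using k t(2)[OF y(1)] by simp
    then have "y \<in> M - H" using y k by (simp add: M_def H_def)
    then show "l \<in> mt ` (M - H)" using y by blast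
  qed
  then have "card (Suc ` L) \<le> card (mt ` (M - H))" using fin by (intro card_mono) auto
  also have "\<dots> \<le> card (M - H)" using fin by (intro card_image_le) auto
  also have "\<dots> = card M - card H" using HM fin by (simp add: card_Diff_subset)
  finally have "card L + card H \<le> card M"
    using card_mono[OF fin(1) HM] by (simp add: card_image)
  moreover have "card ({..<n} - L) = n - card L" "card ({..<n} - H) = n - card H"
    by (subst card_Diff_subset; auto simp: L_def H_def)+
  moreover have "\<not> E l r" if "l \<in> {..<n} - L" "r \<in> {..<n} - H" for l r
    using that t(2)[of r] by (auto simp: L_def H_def)
  moreover have "card L \<le> n" "card H \<le> n"
    using card_mono[of "{..<n}" L] card_mono[of "{..<n}" H] by (auto simp: L_def H_def)
  ultimately show ?thesis
    by (intro exI[of _ "{..<n} - L"] exI[of _ "{..<n} - H"]) (auto simp: M_def)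
qed

text \<open>Weak duality, valid for every intermediate matching: a matching edge with right end in
  \<open>J\<close> has its left end outside \<open>I\<close>, which leaves at most
  \<open>n - card I\<close> of them; the others have their right ends outside
  \<open>J\<close>.\<close>

lemma auction_independent_bound:
  assumes inv: "auction_inv n E p mt nx cu"
    and "I \<subseteq> {..<n}" "J \<subseteq> {..<n}" "\<And>l r. l \<in> I \<Longrightarrow> r \<in> J \<Longrightarrow> \<not> E l r"
  shows "card I + card J + card {r. r < n \<and> 0 < mt r} \<le> 2 * n"
proof -
  define M where "M = {r. r < n \<and> 0 < mt r}"
  note D = auction_invD[OF inv]
  note i2 = D(1,5,7)
  have inj: "inj_on mt M" using D(9) by (simp add: M_def)
  have fin: "finite M" "finite I" "finite J"
    using assms by (auto simp: M_def intro: finite_subset)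
  have "mt ` (M \<inter> J) \<subseteq> {1..n} - Suc ` I"
  proof
    fix l assume "l \<in> mt ` (M \<inter> J)"
    then obtain r where r: "l = mt r" "r < n" "0 < mt r" "r \<in> J" by (auto simp: M_def)
    then have "mt r - 1 \<notin> I" using assms(4) i2(3) by blast
    then have "l \<notin> Suc ` I" using r by auto
    then show "l \<in> {1..n} - Suc ` I" using r i2 by (auto intro: order_trans)
  qed
  then have "card (mt ` (M \<inter> J)) \<le> card ({1..n} - Suc ` I)" by (intro card_mono) auto
  also have "card ({1..n} - Suc ` I) = n - card I"
    using assms(2) fin by (subst card_Diff_subset) (auto simp: card_image)
  also have "card (mt ` (M \<inter> J)) = card (M \<inter> J)"
    using inj by (intro card_image) (auto simp: inj_on_def)
  finally have 1: "card (M \<inter> J) \<le> n - card I" .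
  have "card (M - J) \<le> card ({..<n} - J)" by (intro card_mono) (auto simp: M_def)
  also have "\<dots> = n - card J" using assms(3) fin by (subst card_Diff_subset) auto
  finally have 2: "card (M - J) \<le> n - card J" .
  have "card M = card (M \<inter> J) + card (M - J)"
    using fin by (subst card_Un_disjoint[symmetric]) (auto intro: arg_cong[where f = card])
  moreover have "card I \<le> n" "card J \<le> n"
    using card_mono[OF _ assms(2)] card_mono[OF _ assms(3)] by auto
  ultimately show ?thesis using 1 2 unfolding M_def by linarith
qed

text \<open>An unfinished auction always has a move, and every move raises the potential. So for
  every \<open>k\<close> some state is finished or has potential at least \<open>k\<close>, and the
  bound on the potential rules out the latter for large \<open>k\<close>.\<close>

lemma auction_final_exists: "\<exists>p mt. auction_inv n E p mt n 0"
proof -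
  have "\<exists>p mt nx cu. auction_inv n E p mt nx cu \<and> (nx = n \<and> cu = 0 \<or> k \<le> auction_pot n p nx cu)" for k
  proof (induction k)
    case 0
    then show ?case using auction_inv_init by blast
  next
    case (Suc k)
    then obtain p mt nx cu where inv: "auction_inv n E p mt nx cu"
      and k: "nx = n \<and> cu = 0 \<or> k \<le> auction_pot n p nx cu" by blast
    consider "nx = n" "cu = 0" | "cu = 0" "nx < n" "k \<le> auction_pot n p nx cu"
      | "cu \<noteq> 0" "\<exists>r<n. E (cu - 1) r \<and> p r < n" "k \<le> auction_pot n p nx cu"
      | "cu \<noteq> 0" "\<forall>r<n. E (cu - 1) r \<longrightarrow> n \<le> p r" "k \<le> auction_pot n p nx cu"
      using k auction_invD(1)[OF inv] by (metis le_neq_implies_less not_less)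
    then show ?case
    proof cases
      case 1
      then show ?thesis using inv by blast
    next
      case 2
      then have "auction_inv n E p mt (Suc nx) (Suc nx)"
        using inv by (intro auction_inv_advance) auto
      moreover have "Suc k \<le> auction_pot n p (Suc nx) (Suc nx)"
        using 2 by (auto simp: auction_pot_def)
      ultimately show ?thesis by blast
    next
      case 3
      define R where "R = {r. r < n \<and> E (cu - 1) r}"
      have R: "finite R" "R \<noteq> {}" using 3 by (auto simp: R_def)
      define r where "r = arg_min_on p R"
      have r: "r \<in> R" "\<And>r'. r' \<in> R \<Longrightarrow> p r \<le> p r'"
        using arg_min_if_finite(1)[OF R, of p] arg_min_least[OF R, of _ p] by (auto simp: r_def)
      obtain r0 where "r0 \<in> R" "p r0 < n" using 3 by (auto simp: R_def)
      then have "p r < n" using r(2)[of r0] by simp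
      then have "auction_inv n E (p(r := Suc (p r))) (mt(r := cu)) nx (mt r)"
        using r inv 3 by (intro auction_inv_bid) (auto simp: R_def)
      moreover have "Suc k \<le> auction_pot n (p(r := Suc (p r))) nx (mt r)"
        using auction_pot_bid[of r n cu p nx "mt r"] r 3 by (simp add: R_def)
      ultimately show ?thesis by blast
    next
      case 4
      then have "auction_inv n E p mt nx 0"
        using inv by (intro auction_inv_drop) auto
      moreover have "Suc k \<le> auction_pot n p nx 0"
        using 4 by (auto simp: auction_pot_def)
      ultimately show ?thesis by blast
    qed
  qed
  from this[of "(n + 2) * (n + 2)"] show ?thesis
    using auction_pot_bound by (meson not_le)
qed

section \<open>Independence number of a contraction\<close>

text \<open>Turns reachability into a reflexive transitive closure, so that the effect of adding one
  edge can be computed algebraically.\<close>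

definition edge_rel :: "'a set set \<Rightarrow> ('a \<times> 'a) set" where
  "edge_rel S = {(u, v). {u, v} \<in> S}"

text \<open>Components may be named by values of any type: the proofs use the component itself as
  label, the program a representative vertex.\<close>

definition component_labelling :: "'a ugraph \<Rightarrow> 'a set set \<Rightarrow> ('a \<Rightarrow> 'b) \<Rightarrow> bool" where
  "component_labelling G S f \<longleftrightarrow>
     (\<forall>u\<in>gverts G. \<forall>v\<in>gverts G. f u = f v \<longleftrightarrow> (u, v) \<in> (edge_rel S)\<^sup>*)"

text \<open>The counterpart of an independent set of \<open>G / S\<close>. Edges inside one
  component disappear in the contraction, hence the conclusion \<open>f u = f v\<close>.\<close>

definition independent_labels :: "'a ugraph \<Rightarrow> ('a \<Rightarrow> 'b) \<Rightarrow> 'b set \<Rightarrow> bool" where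
  "independent_labels G f X \<longleftrightarrow> X \<subseteq> f ` gverts G \<and>
     (\<forall>u\<in>gverts G. \<forall>v\<in>gverts G.
        {u, v} \<in> gedges G \<and> f u \<in> X \<and> f v \<in> X \<longrightarrow> f u = f v)"

definition independence_number_on :: "'a ugraph \<Rightarrow> 'a set \<Rightarrow> nat" where
  "independence_number_on G U = Max (card ` {I. I \<subseteq> U \<and> independent_set G I})"

section \<open>Independence numbers of vertex subsets\<close>

lemma finite_independent_sets:
  assumes "finite (gverts G)"
  shows "finite {I. independent_set G I}"
  by (rule finite_subset[of _ "Pow (gverts G)"]) (auto simp: independent_set_def assms)

lemma independent_set_empty [simp]: "independent_set G {}"
  by (simp add: independent_set_def)

lemma independence_number_on_ge:
  assumes "finite (gverts G)" "I \<subseteq> U" "independent_set G I"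
  shows "card I \<le> independence_number_on G U"
  unfolding independence_number_on_def
  using assms finite_subset[OF _ finite_independent_sets[OF assms(1)], of "{I. I \<subseteq> U \<and> independent_set G I}"]
  by (intro Max_ge) auto

lemma independence_number_on_attained:
  assumes "finite (gverts G)"
  obtains I where "I \<subseteq> U" "independent_set G I" "card I = independence_number_on G U"
proof -
  have "independence_number_on G U \<in> card ` {I. I \<subseteq> U \<and> independent_set G I}"
    unfolding independence_number_on_def
    using finite_subset[OF _ finite_independent_sets[OF assms(1)], of "{I. I \<subseteq> U \<and> independent_set G I}"]
    by (intro Max_in) (auto intro!: exI[of _ "{}"])
  then show ?thesis using that by auto
qed

lemma independence_number_on_gverts: "independence_number_on G (gverts G) = independence_number G"
  unfolding independence_number_on_def independence_number_def
  by (rule arg_cong[where f = "\<lambda>A. Max (card ` A)"]) (auto simp: independent_set_def)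

lemma independence_number_le_iff:
  assumes "finite (gverts G)"
  shows "independence_number G \<le> a \<longleftrightarrow> (\<forall>I. independent_set G I \<longrightarrow> card I \<le> a)"
  unfolding independence_number_def
  using finite_independent_sets[OF assms] by (subst Max_le_iff) (auto intro!: exI[of _ "{}"])

section \<open>Components and distances via edge relations\<close>

lemma gedges_endpoints:
  assumes "simple_graph G" "{u, v} \<in> gedges G"
  shows "u \<in> gverts G" "v \<in> gverts G" "u \<noteq> v"
  using assms by (auto simp: simple_graph_def card_insert_if split: if_splits)

lemma gwalk_rtrancl:
  "successively (\<lambda>u v. {u, v} \<in> S) p \<Longrightarrow> p \<noteq> [] \<Longrightarrow> (hd p, last p) \<in> (edge_rel S)\<^sup>*"
proof (induction p rule: induct_list012)
  case (3 x y zs)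
  then have "(x, y) \<in> edge_rel S" "(y, last (y # zs)) \<in> (edge_rel S)\<^sup>*"
    by (auto simp: edge_rel_def)
  then show ?case by auto
qed auto

lemma greachable_restriction_iff:
  assumes "simple_graph G" "S \<subseteq> gedges G" "u \<in> gverts G"
  shows "greachable (edge_restriction G S) u v \<longleftrightarrow> (u, v) \<in> (edge_rel S)\<^sup>*"
proof
  assume "greachable (edge_restriction G S) u v"
  then show "(u, v) \<in> (edge_rel S)\<^sup>*"
    using gwalk_rtrancl by (fastforce simp: greachable_def gwalk_def edge_restriction_def)
next
  assume "(u, v) \<in> (edge_rel S)\<^sup>*"
  then show "greachable (edge_restriction G S) u v"
  proof (induction rule: rtrancl_induct)
    case base
    then show ?case using assms(3)
      by (auto simp: greachable_def gwalk_def edge_restriction_def intro!: exI[of _ "[u]"])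
  next
    case (step y z)
    then obtain p where p: "gwalk (edge_restriction G S) p" "hd p = u" "last p = y"
      by (auto simp: greachable_def)
    have "z \<in> gverts G" "{y, z} \<in> S"
      using step(2) assms gedges_endpoints[OF assms(1), of y z] by (auto simp: edge_rel_def)
    then have "gwalk (edge_restriction G S) (p @ [z])"
      using p by (auto simp: gwalk_def edge_restriction_def successively_append_iff)
    then show ?case using p
      by (auto simp: greachable_def gwalk_def intro!: exI[of _ "p @ [z]"])
  qed
qed

lemma edge_rel_rtrancl_sym: "(u, v) \<in> (edge_rel S)\<^sup>* \<Longrightarrow> (v, u) \<in> (edge_rel S)\<^sup>*"
proof -
  have "sym (edge_rel S)" by (auto simp: sym_def edge_rel_def insert_commute)
  then show "(u, v) \<in> (edge_rel S)\<^sup>* \<Longrightarrow> (v, u) \<in> (edge_rel S)\<^sup>*"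
    by (meson sym_rtrancl symD)
qed

lemma edge_rel_component_eq_iff:
  "{w. (u, w) \<in> (edge_rel S)\<^sup>*} = {w. (v, w) \<in> (edge_rel S)\<^sup>*} \<longleftrightarrow> (u, v) \<in> (edge_rel S)\<^sup>*"
proof
  assume "{w. (u, w) \<in> (edge_rel S)\<^sup>*} = {w. (v, w) \<in> (edge_rel S)\<^sup>*}"
  moreover have "v \<in> {w. (v, w) \<in> (edge_rel S)\<^sup>*}" by simp
  ultimately show "(u, v) \<in> (edge_rel S)\<^sup>*" by blast
next
  assume "(u, v) \<in> (edge_rel S)\<^sup>*"
  then show "{w. (u, w) \<in> (edge_rel S)\<^sup>*} = {w. (v, w) \<in> (edge_rel S)\<^sup>*}"
    using edge_rel_rtrancl_sym[of u v S] by (auto intro: rtrancl_trans)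
qed

lemma edge_rel_rtrancl_gverts:
  assumes "simple_graph G" "S \<subseteq> gedges G" "(u, v) \<in> (edge_rel S)\<^sup>*" "u \<in> gverts G"
  shows "v \<in> gverts G"
  using assms(3,4)
  by (induction rule: rtrancl_induct)
    (use assms(2) gedges_endpoints(2)[OF assms(1)] in \<open>auto simp: edge_rel_def\<close>)

lemma INF_enat_eq_1_iff:
  "(INF p\<in>P. enat (g p)) = 1 \<longleftrightarrow> (\<exists>p\<in>P. g p = 1) \<and> (\<forall>p\<in>P. 1 \<le> g p)"
proof
  assume l: "(INF p\<in>P. enat (g p)) = 1"
  then have "P \<noteq> {}" by (auto simp: top_enat_def one_enat_def)
  then have "(INF p\<in>P. enat (g p)) \<in> (\<lambda>p. enat (g p)) ` P"
    by (auto simp: Inf_enat_def intro: LeastI)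
  then obtain p where p: "p \<in> P" "(INF p\<in>P. enat (g p)) = enat (g p)" by blast
  have "1 \<le> g p" if "p \<in> P" for p
    using INF_lower[OF that, of "\<lambda>p. enat (g p)"] l by (simp add: one_enat_def)
  then show "(\<exists>p\<in>P. g p = 1) \<and> (\<forall>p\<in>P. 1 \<le> g p)"
    using l p by (auto simp: one_enat_def)
next
  assume r: "(\<exists>p\<in>P. g p = 1) \<and> (\<forall>p\<in>P. 1 \<le> g p)"
  then obtain p where p: "p \<in> P" "g p = 1" by blast
  have "(INF p\<in>P. enat (g p)) \<le> 1"
    using INF_lower[OF p(1), of "\<lambda>p. enat (g p)"] p by (simp add: one_enat_def)
  moreover have "1 \<le> (INF p\<in>P. enat (g p))"
    using r by (intro INF_greatest) (auto simp: one_enat_def)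
  ultimately show "(INF p\<in>P. enat (g p)) = 1" by (rule antisym)
qed

text \<open>A common vertex is a walk of length zero and a walk of length one is an edge. In
  particular, an edge inside a component produces no loop in the contraction.\<close>

lemma set_dist_eq_1_iff:
  assumes "A \<subseteq> gverts G" "B \<subseteq> gverts G"
  shows "set_dist G A B = 1 \<longleftrightarrow> A \<inter> B = {} \<and> (\<exists>u\<in>A. \<exists>v\<in>B. {u, v} \<in> gedges G)"
proof -
  let ?P = "{p. gwalk G p \<and> hd p \<in> A \<and> last p \<in> B}"
  have ex: "(\<exists>p\<in>?P. length p - 1 = 1) \<longleftrightarrow> (\<exists>u\<in>A. \<exists>v\<in>B. {u, v} \<in> gedges G)" (is "?l \<longleftrightarrow> ?r")
  proof
    assume ?l
    then obtain p where p: "gwalk G p" "hd p \<in> A" "last p \<in> B" "length p = 2" by force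
    then obtain u v where "p = [u, v]" by (auto simp: length_Suc_conv numeral_2_eq_2)
    then show ?r using p by (auto simp: gwalk_def)
  next
    assume ?r
    then obtain u v where uv: "u \<in> A" "v \<in> B" "{u, v} \<in> gedges G" by blast
    then have "[u, v] \<in> ?P" using assms by (auto simp: gwalk_def)
    then show ?l by (rule rev_bexI) simp
  qed
  have all: "(\<forall>p\<in>?P. 1 \<le> length p - 1) \<longleftrightarrow> A \<inter> B = {}" (is "?l \<longleftrightarrow> ?r")
  proof
    assume l: ?l
    show ?r
    proof (rule ccontr)
      assume "A \<inter> B \<noteq> {}"
      then obtain u where "u \<in> A" "u \<in> B" by blast
      then have "[u] \<in> ?P" using assms by (auto simp: gwalk_def)
      then show False using l by fastforce
    qed
  next
    assume r: ?r
    show ?l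
    proof
      fix p assume p: "p \<in> ?P"
      then have "p \<noteq> []" "hd p \<noteq> last p" using r by (auto simp: gwalk_def)
      then show "1 \<le> length p - 1" by (cases p; cases "tl p") auto
    qed
  qed
  show ?thesis unfolding set_dist_def INF_enat_eq_1_iff ex all by blast
qed

lemma finite_contraction:
  assumes "simple_graph G"
  shows "finite (gverts (contraction G S))"
  using assms by (simp add: contraction_def Let_def graph_components_def edge_restriction_def simple_graph_def)

text \<open>The fibres of \<open>f\<close> are the components, so \<open>h\<close> maps labels
  bijectively to the vertices of the contraction; two fibres are adjacent there iff they are
  distinct and an edge of \<open>G\<close> joins them.\<close>

lemma independence_number_contraction_le_iff:
  assumes G: "simple_graph G" and S: "S \<subseteq> gedges G" and f: "component_labelling G S f"
  shows "independence_number (contraction G S) \<le> a \<longleftrightarrow>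
    (\<forall>X. independent_labels G f X \<longrightarrow> card X \<le> a)"
proof -
  define h where "h x = {v \<in> gverts G. f v = x}" for x
  have comp: "{v. greachable (edge_restriction G S) u v} = h (f u)" if "u \<in> gverts G" for u
    using f that edge_rel_rtrancl_gverts[OF G S]
    by (auto simp: greachable_restriction_iff[OF G S that] h_def component_labelling_def)
      (blast intro: edge_rel_rtrancl_sym)+
  have V: "gverts (contraction G S) = h ` f ` gverts G"
    using comp by (auto simp: contraction_def Let_def graph_components_def edge_restriction_def image_image)
  have hV: "h x \<subseteq> gverts G" for x by (auto simp: h_def)
  have dist: "set_dist G (h x) (h y) = 1 \<longleftrightarrow>
      x \<noteq> y \<and> (\<exists>u\<in>gverts G. \<exists>v\<in>gverts G. f u = x \<and> f v = y \<and> {u, v} \<in> gedges G)"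
    if "x \<in> f ` gverts G" "y \<in> f ` gverts G" for x y
    unfolding set_dist_eq_1_iff[OF hV hV] using that by (auto simp: h_def)
  have E: "{h x, h y} \<in> gedges (contraction G S) \<longleftrightarrow>
      x \<noteq> y \<and> (\<exists>u\<in>gverts G. \<exists>v\<in>gverts G. f u = x \<and> f v = y \<and> {u, v} \<in> gedges G)"
    if "x \<in> f ` gverts G" "y \<in> f ` gverts G" for x y
  proof -
    have e: "gedges (contraction G S) =
        {{A, B} |A B. A \<in> h ` f ` gverts G \<and> B \<in> h ` f ` gverts G \<and> set_dist G A B = 1}"
      using V by (simp add: contraction_def Let_def)
    have m: "{h x, h y} \<in> {{A, B} |A B. A \<in> h ` f ` gverts G \<and> B \<in> h ` f ` gverts G \<and> set_dist G A B = 1}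
        \<longleftrightarrow> set_dist G (h x) (h y) = 1 \<or> set_dist G (h y) (h x) = 1"
      using that by (auto simp: doubleton_eq_iff)
    have sy: "set_dist G (h y) (h x) = 1 \<longleftrightarrow> set_dist G (h x) (h y) = 1"
      unfolding set_dist_eq_1_iff[OF hV hV]
    proof (intro arg_cong2[where f = "(\<and>)"])
      have c: "{u, v} \<in> gedges G \<longleftrightarrow> {v, u} \<in> gedges G" for u v
        by (simp add: insert_commute)
      show "(\<exists>u\<in>h y. \<exists>v\<in>h x. {u, v} \<in> gedges G) = (\<exists>u\<in>h x. \<exists>v\<in>h y. {u, v} \<in> gedges G)"
        using c by blast
    qed blast
    show ?thesis
      unfolding e m sy dist[OF that] by (rule disj_absorb)
  qed
  have inj: "inj_on h (f ` gverts G)"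
  proof (rule inj_onI)
    fix x y assume "x \<in> f ` gverts G" "h x = h y"
    then show "x = y" by (auto simp: h_def)
  qed
  have ind: "independent_set (contraction G S) (h ` X) \<longleftrightarrow> independent_labels G f X"
    if X: "X \<subseteq> f ` gverts G" for X
  proof -
    have "independent_set (contraction G S) (h ` X) \<longleftrightarrow>
        (\<forall>x\<in>X. \<forall>y\<in>X. {h x, h y} \<notin> gedges (contraction G S))"
      using X V by (auto simp: independent_set_def)
    also have "\<dots> \<longleftrightarrow> (\<forall>x\<in>X. \<forall>y\<in>X. \<not> (x \<noteq> y \<and>
        (\<exists>u\<in>gverts G. \<exists>v\<in>gverts G. f u = x \<and> f v = y \<and> {u, v} \<in> gedges G)))"
    proof (intro ball_cong refl)
      fix x y assume "x \<in> X" "y \<in> X"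
      then have xy: "x \<in> f ` gverts G" "y \<in> f ` gverts G" using X by auto
      show "({h x, h y} \<notin> gedges (contraction G S)) = (\<not> (x \<noteq> y \<and>
        (\<exists>u\<in>gverts G. \<exists>v\<in>gverts G. f u = x \<and> f v = y \<and> {u, v} \<in> gedges G)))"
        unfolding E[OF xy] ..
    qed
    also have "\<dots> \<longleftrightarrow> independent_labels G f X"
    proof (intro iffI ballI)
      assume l: "\<forall>x\<in>X. \<forall>y\<in>X. \<not> (x \<noteq> y \<and>
        (\<exists>u\<in>gverts G. \<exists>v\<in>gverts G. f u = x \<and> f v = y \<and> {u, v} \<in> gedges G))"
      show "independent_labels G f X"
        unfolding independent_labels_def
      proof (intro conjI X ballI impI)
        fix u v assume "u \<in> gverts G" "v \<in> gverts G" "{u, v} \<in> gedges G \<and> f u \<in> X \<and> f v \<in> X"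
        then show "f u = f v" using l[rule_format, of "f u" "f v"] by blast
      qed
    qed (auto simp: independent_labels_def)
    finally show ?thesis .
  qed
  have "(\<forall>I. independent_set (contraction G S) I \<longrightarrow> card I \<le> a) \<longleftrightarrow>
      (\<forall>X \<subseteq> f ` gverts G. independent_set (contraction G S) (h ` X) \<longrightarrow> card (h ` X) \<le> a)"
  proof (intro iffI allI impI)
    fix I assume all: "\<forall>X \<subseteq> f ` gverts G. independent_set (contraction G S) (h ` X) \<longrightarrow> card (h ` X) \<le> a"
      and I: "independent_set (contraction G S) I"
    then have "I \<subseteq> h ` f ` gverts G" unfolding V[symmetric] by (simp add: independent_set_def)
    then obtain X where "X \<subseteq> f ` gverts G" "I = h ` X" by (rule subset_imageE)
    then show "card I \<le> a" using all I by blast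
  qed blast
  also have "\<dots> \<longleftrightarrow> (\<forall>X. independent_labels G f X \<longrightarrow> card X \<le> a)"
  proof (intro iff_allI)
    fix X
    show "(X \<subseteq> f ` gverts G \<longrightarrow> independent_set (contraction G S) (h ` X) \<longrightarrow> card (h ` X) \<le> a) =
        (independent_labels G f X \<longrightarrow> card X \<le> a)"
    proof (cases "X \<subseteq> f ` gverts G")
      case True
      then show ?thesis using ind card_image[OF inj_on_subset[OF inj True]] by simp
    qed (auto simp: independent_labels_def)
  qed
  finally show ?thesis
    by (simp add: independence_number_le_iff[OF finite_contraction[OF G]])
qed

text \<open>The vertices that are components by themselves and can still join \<open>X\<close>.
  Among them the contraction has the same edges as \<open>G\<close>, so what is left to maximise is
  an independent set in an induced subgraph of \<open>G\<close>.\<close>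

definition residual_vertices :: "'a ugraph \<Rightarrow> ('a \<Rightarrow> 'a) \<Rightarrow> 'a set \<Rightarrow> 'a set" where
  "residual_vertices G f X = {v \<in> gverts G. f v \<notin> X \<and>
     (\<forall>u\<in>gverts G. \<not> (u \<noteq> v \<and> f u = f v) \<and> \<not> ({u, v} \<in> gedges G \<and> f u \<in> X))}"

text \<open>Only the labels in \<open>T\<close> can stand for contracted components, so an independent set of
  the contraction consists of at most \<open>card T\<close> guessed labels and uncontracted vertices.\<close>

lemma independent_labels_bound_iff:
  assumes G: "simple_graph G" and f: "f ` gverts G \<subseteq> gverts G" "\<And>v. v \<in> gverts G \<Longrightarrow> f (f v) = f v"
    and T: "\<And>u v. \<lbrakk> u \<in> gverts G; v \<in> gverts G; u \<noteq> v; f u = f v \<rbrakk> \<Longrightarrow> f u \<in> T"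
      "finite T" "card T \<le> q" and q: "1 \<le> q"
  shows "(\<forall>X. independent_labels G f X \<longrightarrow> card X \<le> a) \<longleftrightarrow>
    (\<forall>X. independent_labels G f X \<and> X \<noteq> {} \<and> card X \<le> q \<longrightarrow>
       card X + independence_number_on G (residual_vertices G f X) \<le> a)"
proof (intro iffI allI impI)
  fix X assume all: "\<forall>X. independent_labels G f X \<longrightarrow> card X \<le> a"
    and "independent_labels G f X \<and> X \<noteq> {} \<and> card X \<le> q"
  then have X: "independent_labels G f X" by blast
  have fin: "finite (gverts G)" using G by (simp add: simple_graph_def)
  obtain I where I: "I \<subseteq> residual_vertices G f X" "independent_set G I"
      "card I = independence_number_on G (residual_vertices G f X)"
    using independence_number_on_attained[OF fin] by blast
  have IV: "v \<in> gverts G" if "v \<in> I" for v using I that by (auto simp: residual_vertices_def)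
  have triv: "u = v" if "u \<in> gverts G" "v \<in> I" "f u = f v" for u v
    using I(1) that by (auto simp: residual_vertices_def)
  \<comment> \<open>\<open>v\<close> and \<open>f v\<close> carry the same label and
    \<open>v\<close> is alone in its class. So the vertices of \<open>I\<close> are their own
    labels, and \<open>X \<union> I\<close> is a set of labels.\<close>
  have fI: "f v = v" if "v \<in> I" for v
    using triv[of "f v" v] f IV[OF that] that by auto
  have fib: "u \<in> I" if "u \<in> gverts G" "f u \<in> I" for u
    using triv[OF that] f(2)[OF that(1)] that by simp
  have XI: "f v \<notin> X" if "v \<in> I" for v using I that by (auto simp: residual_vertices_def)
  have adjX: "f u \<notin> X" if "u \<in> gverts G" "v \<in> I" "{u, v} \<in> gedges G" for u v
    using I(1) that by (auto simp: residual_vertices_def)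
  have "independent_labels G f (X \<union> I)"
    unfolding independent_labels_def
  proof (intro conjI ballI impI)
    show "X \<union> I \<subseteq> f ` gverts G"
      using X fI IV by (auto simp: independent_labels_def) (metis imageI)
    fix u v assume u: "u \<in> gverts G" and v: "v \<in> gverts G"
      and e: "{u, v} \<in> gedges G \<and> f u \<in> X \<union> I \<and> f v \<in> X \<union> I"
    have e': "{v, u} \<in> gedges G" using e by (simp add: insert_commute)
    consider "f u \<in> X" "f v \<in> X" | "f u \<in> X" "v \<in> I" | "u \<in> I" "f v \<in> X" | "u \<in> I" "v \<in> I"
      using e fib u v by blast
    then show "f u = f v"
    proof cases
      case 1
      then show ?thesis using X e u v by (auto simp: independent_labels_def)
    next
      case 2
      then show ?thesis using adjX[OF u] e by blast
    next
      case 3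
      then show ?thesis using adjX[OF v] e' by blast
    next
      case 4
      then show ?thesis using I(2) e by (auto simp: independent_set_def)
    qed
  qed
  then have "card (X \<union> I) \<le> a" using all by blast
  moreover have "X \<inter> I = {}" using fI XI by force
  moreover have "finite X" "finite I"
    using X I(2) fin by (auto simp: independent_labels_def independent_set_def intro: finite_subset)
  ultimately show "card X + independence_number_on G (residual_vertices G f X) \<le> a"
    by (simp add: card_Un_disjoint I(3))
next
  fix Y assume all: "\<forall>X. independent_labels G f X \<and> X \<noteq> {} \<and> card X \<le> q \<longrightarrow>
       card X + independence_number_on G (residual_vertices G f X) \<le> a"
    and Y: "independent_labels G f Y"
  have fin: "finite (gverts G)" using G by (simp add: simple_graph_def)
  show "card Y \<le> a"
  proof (cases "Y = {}")
    case False
    then obtain y where y: "y \<in> Y" by blast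
    \<comment> \<open>If \<open>Y\<close> avoids \<open>T\<close>, an arbitrary element is put into
      \<open>X\<close>: the label sets are going to be enumerated as images of tuples of positive
      length, which are nonempty.\<close>
    define X where "X = (if Y \<inter> T = {} then {y} else Y \<inter> T)"
    have YV: "Y \<subseteq> f ` gverts G" using Y by (simp add: independent_labels_def)
    have finY: "finite Y" using YV fin by (auto intro: finite_subset)
    have X: "X \<subseteq> Y" "X \<noteq> {}" "Y \<inter> T \<subseteq> X" using y by (auto simp: X_def)
    have "card (Y \<inter> T) \<le> q" using T card_mono[of T "Y \<inter> T"] by auto
    then have "card X \<le> q" using q by (auto simp: X_def)
    moreover have indX: "independent_labels G f X"
      using Y X(1) unfolding independent_labels_def by blast
    ultimately have le: "card X + independence_number_on G (residual_vertices G f X) \<le> a"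
      using all X(2) by blast
    have fY: "f v = v" "v \<in> gverts G" if "v \<in> Y" for v using YV f that by auto
    have adj: "f u = v" if "u \<in> gverts G" "v \<in> Y" "{u, v} \<in> gedges G" "f u \<in> Y" for u v
      using Y that fY[of v] by (auto simp: independent_labels_def)
    have "Y - X \<subseteq> residual_vertices G f X"
    proof
      fix v assume v: "v \<in> Y - X"
      have "\<not> (u \<noteq> v \<and> f u = f v)" if "u \<in> gverts G" for u
        using T(1)[of u v] that v fY[of v] X(3) by auto
      moreover have "\<not> ({u, v} \<in> gedges G \<and> f u \<in> X)" if "u \<in> gverts G" for u
        using adj[of u v] that v X(1) by auto
      ultimately show "v \<in> residual_vertices G f X"
        using v fY[of v] by (auto simp: residual_vertices_def)
    qed
    moreover have "independent_set G (Y - X)"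
      using adj fY gedges_endpoints(3)[OF G] by (fastforce simp: independent_set_def)
    ultimately have "card (Y - X) \<le> independence_number_on G (residual_vertices G f X)"
      using independence_number_on_ge[OF fin] by blast
    moreover have "card Y = card X + card (Y - X)"
      using X(1) finY by (metis card_Diff_subset card_mono finite_subset le_add_diff_inverse)
    ultimately show ?thesis using le by simp
  qed simp
qed

section \<open>A bounded number of contractions suffices\<close>

text \<open>The fibres of \<open>g\<close> are cliques with at most two vertices. The initial fibre
  costs at most one edge, and each further fibre one connecting edge and at most one inside, which
  adds up to \<open>2 * j - 1\<close>.\<close>

lemma connected_piece_growth:
  fixes g :: "'a \<Rightarrow> 'b"
  assumes G: "simple_graph G" "connected_graph G"
    and clique: "\<And>u v. \<lbrakk> u \<in> gverts G; v \<in> gverts G; g u = g v \<rbrakk> \<Longrightarrow> u = v \<or> {u, v} \<in> gedges G"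
    and fibre: "\<And>x. card {v \<in> gverts G. g v = x} \<le> 2"
    and j: "1 \<le> j" "j \<le> card (g ` gverts G)"
  shows "\<exists>P S. P \<subseteq> g ` gverts G \<and> card P = j \<and> S \<subseteq> gedges G \<and> finite S \<and> card S \<le> 2 * j - 1 \<and>
    (\<forall>u\<in>gverts G. \<forall>v\<in>gverts G. g u \<in> P \<and> g v \<in> P \<longrightarrow> (u, v) \<in> (edge_rel S)\<^sup>*)"
proof -
  have fin: "finite (gverts G)" using G by (simp add: simple_graph_def)
  \<comment> \<open>The star at \<open>w\<close> inside its fibre; it has at most one edge and
    connects the fibre.\<close>
  define F where "F w = (\<lambda>v. {w, v}) ` ({v \<in> gverts G. g v = g w} - {w})" for w
  have F1: "F w \<subseteq> gedges G" if "w \<in> gverts G" for w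
  proof
    fix e assume "e \<in> F w"
    then obtain v where "v \<in> gverts G" "g v = g w" "v \<noteq> w" "e = {w, v}" unfolding F_def by blast
    then show "e \<in> gedges G" using clique[OF that, of v] by auto
  qed
  have F2: "finite (F w)" for w using fin by (simp add: F_def)
  have F3: "card (F w) \<le> 1" if "w \<in> gverts G" for w
  proof -
    have "card (F w) \<le> card ({v \<in> gverts G. g v = g w} - {w})"
      unfolding F_def using fin by (intro card_image_le) auto
    also have "\<dots> = card {v \<in> gverts G. g v = g w} - 1"
      using that fin by (subst card_Diff_singleton) auto
    finally show ?thesis using fibre[of "g w"] by simp
  qed
  have F4: "(w, v) \<in> (edge_rel (F w))\<^sup>*" if "v \<in> gverts G" "g v = g w" for v w
  proof (cases "v = w")
    case False
    then have "(w, v) \<in> edge_rel (F w)" using that by (auto simp: F_def edge_rel_def)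
    then show ?thesis by blast
  qed simp
  show ?thesis using j
  proof (induction j rule: nat_induct_at_least)
    case base
    obtain w where w: "w \<in> gverts G" using G by (auto simp: connected_graph_def)
    have "(u, v) \<in> (edge_rel (F w))\<^sup>*" if "u \<in> gverts G" "v \<in> gverts G" "g u = g w" "g v = g w" for u v
      using rtrancl_trans[OF edge_rel_rtrancl_sym[OF F4[OF that(1,3)]] F4[OF that(2,4)]] .
    then show ?case using w F1 F2 F3
      by (intro exI[of _ "{g w}"] exI[of _ "F w"]) auto
  next
    case (Suc j)
    then obtain P S where P: "P \<subseteq> g ` gverts G" "card P = j" and S: "S \<subseteq> gedges G" "finite S" "card S \<le> 2 * j - 1"
      and conn: "\<And>u v. \<lbrakk> u \<in> gverts G; v \<in> gverts G; g u \<in> P; g v \<in> P \<rbrakk> \<Longrightarrow> (u, v) \<in> (edge_rel S)\<^sup>*"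
      by auto
    have "P \<noteq> {}" using P Suc by auto
    then obtain a where a: "a \<in> gverts G" "g a \<in> P" using P by blast
    have "P \<noteq> g ` gverts G" using P Suc by auto
    then obtain b where b: "b \<in> gverts G" "g b \<notin> P" using P by blast
    have "(a, b) \<in> (edge_rel (gedges G))\<^sup>*"
      using G a b greachable_restriction_iff[OF G(1) order_refl a(1), of b]
      by (auto simp: connected_graph_def greachable_def gwalk_def edge_restriction_def)
    \<comment> \<open>A path from \<open>a\<close>, inside the fibres in \<open>P\<close>, to
      \<open>b\<close>, outside of them, leaves them along some edge.\<close>
    then have "b \<in> gverts G \<and> g b \<notin> P \<longrightarrow>
        (\<exists>u w. u \<in> gverts G \<and> w \<in> gverts G \<and> {u, w} \<in> gedges G \<and> g u \<in> P \<and> g w \<notin> P)"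
    proof (induction rule: rtrancl_induct)
      case base
      then show ?case using a by blast
    next
      case (step y z)
      have "{y, z} \<in> gedges G" using step(2) by (simp add: edge_rel_def)
      then show ?case using step(3) gedges_endpoints[OF G(1), of y z] by blast
    qed
    then obtain u w where uw: "u \<in> gverts G" "w \<in> gverts G" "{u, w} \<in> gedges G" "g u \<in> P" "g w \<notin> P"
      using b by blast
    define S' where "S' = insert {u, w} (S \<union> F w)"
    have mono: "(edge_rel S)\<^sup>* \<subseteq> (edge_rel S')\<^sup>*" "(edge_rel (F w))\<^sup>* \<subseteq> (edge_rel S')\<^sup>*"
      by (intro rtrancl_mono; auto simp: S'_def edge_rel_def)+
    have uw': "(u, w) \<in> (edge_rel S')\<^sup>*"
      by (intro r_into_rtrancl) (auto simp: S'_def edge_rel_def)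
    have from_u: "(u, v) \<in> (edge_rel S')\<^sup>*" if "v \<in> gverts G" "g v \<in> insert (g w) P" for v
    proof (cases "g v = g w")
      case True
      then show ?thesis using rtrancl_trans[OF uw'] F4[OF that(1) True] mono by blast
    next
      case False
      then show ?thesis using conn[OF uw(1) that(1)] uw that mono by blast
    qed
    have "(v, v') \<in> (edge_rel S')\<^sup>*"
      if "v \<in> gverts G" "v' \<in> gverts G" "g v \<in> insert (g w) P" "g v' \<in> insert (g w) P" for v v'
      using rtrancl_trans[OF edge_rel_rtrancl_sym[OF from_u[OF that(1,3)]] from_u[OF that(2,4)]] .
    moreover have "card S' \<le> Suc (card (S \<union> F w))"
      unfolding S'_def using S F2 by (simp add: card_insert_if)
    then have "card S' \<le> 2 * Suc j - 1"
      using card_Un_le[of S "F w"] S(3) F3[OF uw(2)] Suc.hyps by arith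
    moreover have "card (insert (g w) P) = Suc j"
      using P uw fin by (simp add: finite_subset card_insert_if)
    ultimately show ?case
      using P S uw F1 F2
      by (intro exI[of _ "insert (g w) P"] exI[of _ S']) (auto simp: S'_def)
  qed
qed

text \<open>Some \<open>d + 1\<close> fibres are merged into one component. The other labels of an
  independent set have representatives in pairwise different remaining fibres, since two vertices of
  one fibre are adjacent. This gives at most \<open>1 + (\<alpha>(G) - (d + 1))\<close>
  labels.\<close>

lemma small_blocker_from_clique_cover:
  fixes g :: "'a \<Rightarrow> 'b"
  assumes G: "simple_graph G" "connected_graph G"
    and clique: "\<And>u v. \<lbrakk> u \<in> gverts G; v \<in> gverts G; g u = g v \<rbrakk> \<Longrightarrow> u = v \<or> {u, v} \<in> gedges G"
    and fibre: "\<And>x. card {v \<in> gverts G. g v = x} \<le> 2"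
    and cover: "card (g ` gverts G) \<le> independence_number G"
    and d: "d + 1 \<le> independence_number G"
  shows "\<exists>S\<subseteq>gedges G. card S \<le> 2 * d + 1 \<and>
    independence_number (contraction G S) + d \<le> independence_number G"
proof -
  have fin: "finite (gverts G)" using G by (simp add: simple_graph_def)
  obtain I where I: "I \<subseteq> gverts G" "independent_set G I" "card I = independence_number G"
    using independence_number_on_attained[OF fin, of "gverts G"] independence_number_on_gverts[of G] by auto
  \<comment> \<open>An independent set meets a clique at most once, so the number of fibres is
    exactly \<open>\<alpha>(G)\<close>.\<close>
  have "inj_on g I"
    unfolding inj_on_def using clique I unfolding independent_set_def by blast
  then have "card I = card (g ` I)" by (simp add: card_image)
  also have "\<dots> \<le> card (g ` gverts G)"
    using I(1) fin by (intro card_mono image_mono) auto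
  finally have card_g: "card (g ` gverts G) = independence_number G" using cover I(3) by simp
  have "\<exists>P S. P \<subseteq> g ` gverts G \<and> card P = d + 1 \<and> S \<subseteq> gedges G \<and> finite S \<and>
      card S \<le> 2 * (d + 1) - 1 \<and>
      (\<forall>u\<in>gverts G. \<forall>v\<in>gverts G. g u \<in> P \<and> g v \<in> P \<longrightarrow> (u, v) \<in> (edge_rel S)\<^sup>*)"
    by (rule connected_piece_growth[OF G clique fibre]) (use d card_g in simp_all)
  then obtain P S where P: "P \<subseteq> g ` gverts G" "card P = d + 1"
    and S: "S \<subseteq> gedges G" "finite S" "card S \<le> 2 * (d + 1) - 1"
    and conn: "\<And>u v. \<lbrakk> u \<in> gverts G; v \<in> gverts G; g u \<in> P; g v \<in> P \<rbrakk> \<Longrightarrow> (u, v) \<in> (edge_rel S)\<^sup>*"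
    by blast
  define f where "f v = {w. (v, w) \<in> (edge_rel S)\<^sup>*}" for v
  have f_eq: "f u = f v \<longleftrightarrow> (u, v) \<in> (edge_rel S)\<^sup>*" for u v
    by (simp add: f_def edge_rel_component_eq_iff)
  have lab: "component_labelling G S f" by (simp add: component_labelling_def f_eq)
  obtain a where a: "a \<in> gverts G" "g a \<in> P"
  proof -
    have "P \<noteq> {}" using P(2) by auto
    then show ?thesis using P(1) that by blast
  qed
  have "card X \<le> independence_number G - d" if X: "independent_labels G f X" for X
  proof -
    have finX: "finite X" using X fin by (auto simp: independent_labels_def intro: finite_subset)
    have "\<exists>v\<in>gverts G. f v = x" if "x \<in> X" for x
      using X that by (auto simp: independent_labels_def)
    then obtain s where s: "\<And>x. x \<in> X \<Longrightarrow> s x \<in> gverts G \<and> f (s x) = x" by metis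
    have "g (s x) \<notin> P" if "x \<in> X" "x \<noteq> f a" for x
      using conn[of a "s x"] a s[OF that(1)] that f_eq by metis
    then have "(g \<circ> s) ` (X - {f a}) \<subseteq> g ` gverts G - P" using s by auto
    moreover have "inj_on (g \<circ> s) (X - {f a})"
    proof (rule inj_onI)
      fix x y assume x: "x \<in> X - {f a}" and y: "y \<in> X - {f a}" and e: "(g \<circ> s) x = (g \<circ> s) y"
      then have "s x = s y \<or> {s x, s y} \<in> gedges G" using clique s by auto
      moreover have "f (s x) = f (s y)" if "{s x, s y} \<in> gedges G"
        using that X s x y unfolding independent_labels_def by (metis DiffD1)
      ultimately show "x = y" using s x y by (metis DiffD1)
    qed
    ultimately have "card (X - {f a}) \<le> card (g ` gverts G - P)"
      using fin by (metis card_inj_on_le finite_Diff finite_imageI)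
    also have "\<dots> = independence_number G - (d + 1)"
      using P fin card_g by (subst card_Diff_subset) (auto intro: finite_subset)
    finally have "card (X - {f a}) \<le> independence_number G - (d + 1)" .
    moreover have "card X \<le> Suc (card (X - {f a}))"
      using finX by (simp add: card_Diff_singleton_if) arith
    ultimately show ?thesis using d by linarith
  qed
  then have "independence_number (contraction G S) \<le> independence_number G - d"
    by (simp add: independence_number_contraction_le_iff[OF G(1) S(1) lab])
  then show ?thesis using S d by (intro exI[of _ S]) auto
qed

text \<open>Konig's theorem as a clique cover: a matched right vertex is sent to its mate and every
  other vertex to itself. This leaves at most \<open>n - card M\<close> classes, and the independent
  set obtained from the final auction is at least that large.\<close>

lemma bipartite_clique_cover:
  fixes G :: "nat ugraph"
  assumes G: "simple_graph G" "bipartite_graph G" and V: "gverts G = {..<n}"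
  obtains g :: "nat \<Rightarrow> nat"
    where "\<And>u v. \<lbrakk> u \<in> gverts G; v \<in> gverts G; g u = g v \<rbrakk> \<Longrightarrow> u = v \<or> {u, v} \<in> gedges G"
      and "\<And>x. card {v \<in> gverts G. g v = x} \<le> 2"
      and "card (g ` gverts G) \<le> independence_number G"
proof -
  obtain A B where AB: "A \<union> B = {..<n}" "A \<inter> B = {}"
    and cross: "\<And>e. e \<in> gedges G \<Longrightarrow> e \<inter> A \<noteq> {} \<and> e \<inter> B \<noteq> {}"
    using G V unfolding bipartite_graph_def by metis
  define E where "E l r \<longleftrightarrow> l \<in> A \<and> r \<in> B \<and> {l, r} \<in> gedges G" for l r
  obtain p mt where inv: "auction_inv n E p mt n 0" using auction_final_exists by blast
  note D = auction_invD[OF inv]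
  define M where "M = {r. r < n \<and> 0 < mt r}"
  obtain I J where IJ: "I \<subseteq> {..<n}" "J \<subseteq> {..<n}" "\<And>l r. l \<in> I \<Longrightarrow> r \<in> J \<Longrightarrow> \<not> E l r"
      "2 * n \<le> card I + card J + card M"
    using auction_final_independent[OF inv] unfolding M_def by blast
  have ME: "mt r - 1 \<in> A" "r \<in> B" "{mt r - 1, r} \<in> gedges G" if "r \<in> M" for r
    using D(7)[of r] that by (auto simp: M_def E_def)
  have finM: "finite M" by (simp add: M_def)
  define K where "K = (I \<inter> A) \<union> (J \<inter> B)"
  have fin: "finite A" "finite B" "finite I" "finite J"
    using AB(1) IJ(1,2) by (metis finite_Un finite_lessThan finite_subset)+
  have cA: "card A + card B = n"
    using card_Un_disjoint[OF fin(1,2) AB(2)] AB(1) by simp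
  have "independent_set G K"
    unfolding independent_set_def
  proof (intro conjI ballI)
    show "K \<subseteq> gverts G" using IJ V by (auto simp: K_def)
    fix u v assume u: "u \<in> K" and v: "v \<in> K"
    show "{u, v} \<notin> gedges G"
    proof
      assume e: "{u, v} \<in> gedges G"
      then have e': "{v, u} \<in> gedges G" by (simp add: insert_commute)
      have "u \<in> A \<and> v \<in> B \<or> v \<in> A \<and> u \<in> B" using cross[OF e] AB(2) by auto
      then show False
        using u v e e' IJ(3)[of u v] IJ(3)[of v u] AB(2) unfolding K_def E_def by blast
    qed
  qed
  then have "card K \<le> independence_number_on G (gverts G)"
    by (intro independence_number_on_ge) (use V in \<open>auto simp: independent_set_def\<close>)
  then have "card K \<le> independence_number G" by (simp only: independence_number_on_gverts)
  moreover have "card K = card (I \<inter> A) + card (J \<inter> B)"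
    unfolding K_def using fin AB(2) by (intro card_Un_disjoint) auto
  \<comment> \<open>No \<open>E\<close>-edge starts in \<open>B\<close> or ends in \<open>A\<close>,
    so \<open>I\<close> may contain vertices of \<open>B\<close>, and \<open>J\<close> vertices of
    \<open>A\<close>, without any meaning for \<open>G\<close>. Discarding them costs at most
    \<open>card B + card A = n\<close>.\<close>
  moreover have "card I \<le> card (I \<inter> A) + card B"
    using card_Un_le[of "I \<inter> A" B] card_mono[of "(I \<inter> A) \<union> B" I] fin IJ(1) AB(1) by fastforce
  moreover have "card J \<le> card (J \<inter> B) + card A"
    using card_Un_le[of "J \<inter> B" A] card_mono[of "(J \<inter> B) \<union> A" J] fin IJ(2) AB(1) by fastforce
  ultimately have alpha: "n \<le> independence_number G + card M" using IJ(4) cA by linarith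
  define g where "g v = (if v \<in> M then mt v - 1 else v)" for v
  have gA: "g v = v" if "v \<in> A" for v using ME(2)[of v] AB(2) that by (auto simp: g_def)
  have inj: "u = v" if "u \<in> M" "v \<in> M" "mt u - 1 = mt v - 1" for u v
    using inj_onD[OF D(9), of u v] that by (auto simp: M_def)
  have "g ` {..<n} \<subseteq> {..<n} - M"
  proof
    fix x assume "x \<in> g ` {..<n}"
    then obtain v where v: "v < n" "x = g v" by blast
    show "x \<in> {..<n} - M"
    proof (cases "v \<in> M")
      case True
      then have "x \<in> A" using ME(1) v by (simp add: g_def)
      then show ?thesis using AB ME(2)[of x] by blast
    qed (use v in \<open>auto simp: g_def\<close>)
  qed
  then have "card (g ` {..<n}) \<le> card ({..<n} - M)" by (intro card_mono) auto
  also have "\<dots> = n - card M" using finM by (subst card_Diff_subset) (auto simp: M_def)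
  finally have "card (g ` gverts G) \<le> independence_number G" using alpha V by simp
  moreover have "u = v \<or> {u, v} \<in> gedges G" if uv: "g u = g v" for u v
  proof -
    consider "u \<in> M" "v \<in> M" | "u \<in> M" "v \<notin> M" | "u \<notin> M" "v \<in> M" | "u \<notin> M" "v \<notin> M" by blast
    then show ?thesis
    proof cases
      case 1
      then show ?thesis using inj uv by (simp add: g_def)
    next
      case 2
      then show ?thesis using ME(3)[of u] uv by (simp add: g_def insert_commute)
    next
      case 3
      then show ?thesis using ME(3)[of v] uv by (simp add: g_def)
    qed (use uv in \<open>simp add: g_def\<close>)
  qed
  moreover have "card {v \<in> gverts G. g v = x} \<le> 2" for x
  proof -
    have "{v \<in> gverts G. g v = x} \<subseteq> {x} \<union> {v \<in> M. mt v - 1 = x}" by (auto simp: g_def)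
    then have "card {v \<in> gverts G. g v = x} \<le> card ({x} \<union> {v \<in> M. mt v - 1 = x})"
      using finM by (intro card_mono) auto
    also have "\<dots> \<le> Suc (card {v \<in> M. mt v - 1 = x})" using card_Un_le[of "{x}"] by simp
    also have "card {v \<in> M. mt v - 1 = x} \<le> 1"
      using inj finM by (subst card_le_Suc0_iff_eq[unfolded One_nat_def[symmetric]]) auto
    finally show ?thesis by simp
  qed
  ultimately show ?thesis by (intro that[of g])
qed

text \<open>A larger solution can be exchanged for a small one: \<open>k\<close> then exceeds
  \<open>2 * d + 1\<close>, and as the contraction has a vertex, its independence number is positive
  and \<open>\<alpha>(G) > d\<close>, so the clique cover supplies a blocker.\<close>

lemma contraction_blocker_alpha_iff_small:
  fixes G :: "nat ugraph"
  assumes G: "simple_graph G" "bipartite_graph G" "connected_graph G" and V: "gverts G = {..<n}"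
  shows "contraction_blocker_alpha d (G, k) \<longleftrightarrow>
    (\<exists>S\<subseteq>gedges G. card S \<le> 2 * d + 1 \<and> int (card S) \<le> k \<and>
       independence_number (contraction G S) + d \<le> independence_number G)"
proof
  assume "contraction_blocker_alpha d (G, k)"
  then obtain S where S: "S \<subseteq> gedges G" "int (card S) \<le> k"
    "independence_number (contraction G S) + d \<le> independence_number G"
    unfolding contraction_blocker_alpha_def by auto
  show "\<exists>S\<subseteq>gedges G. card S \<le> 2 * d + 1 \<and> int (card S) \<le> k \<and>
       independence_number (contraction G S) + d \<le> independence_number G"
  proof (cases "card S \<le> 2 * d + 1")
    case False
    obtain w where w: "w \<in> gverts G" using G by (auto simp: connected_graph_def)
    define f where "f v = {w. (v, w) \<in> (edge_rel S)\<^sup>*}" for v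
    have f_eq: "f u = f v \<longleftrightarrow> (u, v) \<in> (edge_rel S)\<^sup>*" for u v
      by (simp add: f_def edge_rel_component_eq_iff)
    have lab: "component_labelling G S f" by (simp add: component_labelling_def f_eq)
    have "independent_labels G f {f w}" using w by (auto simp: independent_labels_def)
    then have "\<not> independence_number (contraction G S) \<le> 0"
      by (subst independence_number_contraction_le_iff[OF G(1) S(1) lab]) fastforce
    then have d: "d + 1 \<le> independence_number G" using S(3) by simp
    obtain g :: "nat \<Rightarrow> nat" where
        g: "\<And>u v. u \<in> gverts G \<Longrightarrow> v \<in> gverts G \<Longrightarrow> g u = g v \<Longrightarrow> u = v \<or> {u, v} \<in> gedges G"
      "\<And>x. card {v \<in> gverts G. g v = x} \<le> 2" "card (g ` gverts G) \<le> independence_number G"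
      by (rule bipartite_clique_cover[OF G(1,2) V], rule that)
    obtain S' where "S' \<subseteq> gedges G" "card S' \<le> 2 * d + 1"
      "independence_number (contraction G S') + d \<le> independence_number G"
      using small_blocker_from_clique_cover[OF G(1,3) g d] by blast
    then show ?thesis using False S(2) by (intro exI[of _ S']) auto
  qed (use S in blast)
next
  assume "\<exists>S\<subseteq>gedges G. card S \<le> 2 * d + 1 \<and> int (card S) \<le> k \<and>
       independence_number (contraction G S) + d \<le> independence_number G"
  then obtain S where "S \<subseteq> gedges G" "int (card S) \<le> k"
       "independence_number (contraction G S) + d \<le> independence_number G" by blast
  then show "contraction_blocker_alpha d (G, k)"
    unfolding contraction_blocker_alpha_def prod.case by (intro exI[of _ S]) simp
qed

text \<open>The auction runs on the bipartite double cover, which spares us the computation of a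
  bipartition: for bipartite \<open>G\<close> it consists of two copies of \<open>G\<close>.\<close>

lemma auction_double_cover:
  fixes G :: "nat ugraph"
  assumes G: "simple_graph G" "bipartite_graph G" and V: "gverts G = {..<n}" and U: "U \<subseteq> {..<n}"
    and inv: "auction_inv n (\<lambda>u v. {u, v} \<in> gedges G \<and> u \<in> U \<and> v \<in> U) p mt n 0"
  shows "card {r. r < n \<and> 0 < mt r} + 2 * independence_number_on G U = 2 * card U"
proof (rule antisym)
  have fin: "finite (gverts G)" "finite U" using V U by (auto intro: finite_subset)
  have cU: "card ({..<n} - U) = n - card U" "card U \<le> n"
    using U fin card_mono[OF _ U] by (auto simp: card_Diff_subset)
  obtain I where I: "I \<subseteq> U" "independent_set G I" "card I = independence_number_on G U"
    using independence_number_on_attained[OF fin(1)] by blast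
  have finI: "finite I" using I(1) fin(2) by (rule finite_subset)
  \<comment> \<open>Vertices outside \<open>U\<close> are isolated in the double cover and may be
    added on both sides.\<close>
  define I' where "I' = I \<union> ({..<n} - U)"
  have "card I' = card I + (n - card U)"
    unfolding I'_def cU(1)[symmetric] using I(1) finI by (intro card_Un_disjoint) auto
  moreover have "card I' + card I' + card {r. r < n \<and> 0 < mt r} \<le> 2 * n"
    using I U by (intro auction_independent_bound[OF inv]) (auto simp: I'_def independent_set_def)
  ultimately show "card {r. r < n \<and> 0 < mt r} + 2 * independence_number_on G U \<le> 2 * card U"
    using cU(2) I(3) by simp
next
  have fin: "finite (gverts G)" "finite U" using V U by (auto intro: finite_subset)
  have cU: "card ({..<n} - U) = n - card U" "card U \<le> n"
    using U fin card_mono[OF _ U] by (auto simp: card_Diff_subset)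
  obtain A B where AB: "A \<union> B = {..<n}" "A \<inter> B = {}"
    and cross: "\<And>e. e \<in> gedges G \<Longrightarrow> e \<inter> A \<noteq> {} \<and> e \<inter> B \<noteq> {}"
    using G V unfolding bipartite_graph_def by metis
  obtain I J where IJ: "I \<subseteq> {..<n}" "J \<subseteq> {..<n}"
      "\<And>l r. l \<in> I \<Longrightarrow> r \<in> J \<Longrightarrow> \<not> ({l, r} \<in> gedges G \<and> l \<in> U \<and> r \<in> U)"
      "2 * n \<le> card I + card J + card {r. r < n \<and> 0 < mt r}"
    using auction_final_independent[OF inv] by blast
  \<comment> \<open>One copy of \<open>G\<close> joins left vertices in \<open>A\<close> to right
    vertices in \<open>B\<close>, the other left vertices in \<open>B\<close> to right vertices in
    \<open>A\<close>. On either copy, the pair \<open>I\<close>, \<open>J\<close> induces an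
    independent set of \<open>G\<close> inside \<open>U\<close>.\<close>
  have bound: "card ((X \<inter> U \<inter> A) \<union> (Y \<inter> U \<inter> B)) \<le> independence_number_on G U"
    if X: "X \<subseteq> {..<n}" "Y \<subseteq> {..<n}"
      and XY: "\<And>u v. u \<in> X \<inter> U \<Longrightarrow> v \<in> Y \<inter> U \<Longrightarrow> {u, v} \<notin> gedges G" for X Y
  proof (rule independence_number_on_ge[OF fin(1)])
    show "independent_set G ((X \<inter> U \<inter> A) \<union> (Y \<inter> U \<inter> B))"
      unfolding independent_set_def
    proof (intro conjI ballI notI)
      show "(X \<inter> U \<inter> A) \<union> (Y \<inter> U \<inter> B) \<subseteq> gverts G" using X V by auto
      fix u v assume u: "u \<in> (X \<inter> U \<inter> A) \<union> (Y \<inter> U \<inter> B)"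
        and v: "v \<in> (X \<inter> U \<inter> A) \<union> (Y \<inter> U \<inter> B)" and e: "{u, v} \<in> gedges G"
      then have e': "{v, u} \<in> gedges G" by (simp add: insert_commute)
      have "u \<in> A \<and> v \<in> B \<or> v \<in> A \<and> u \<in> B" using cross[OF e] AB(2) by auto
      then show False using u v e e' XY[of u v] XY[of v u] AB(2) by blast
    qed
  qed auto
  have fIJ: "finite I" "finite J" using IJ by (auto intro: finite_subset)
  have parts: "card (X \<inter> U) = card (X \<inter> U \<inter> A) + card (X \<inter> U \<inter> B)"
    if "X \<subseteq> {..<n}" for X
  proof -
    have "X \<inter> U = (X \<inter> U \<inter> A) \<union> (X \<inter> U \<inter> B)" using that AB(1) by blast
    moreover have "finite (X \<inter> U)" using fin(2) by blast
    ultimately show ?thesis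
      using AB(2) card_Un_disjoint[of "X \<inter> U \<inter> A" "X \<inter> U \<inter> B"] by (metis (no_types, lifting) Int_assoc Int_commute Int_empty_right finite_Int)
  qed
  have un: "card ((X \<inter> U \<inter> A) \<union> (Y \<inter> U \<inter> B)) = card (X \<inter> U \<inter> A) + card (Y \<inter> U \<inter> B)" for X Y
    using fin(2) AB(2) by (intro card_Un_disjoint) auto
  have big: "card X \<le> card (X \<inter> U) + (n - card U)" if "X \<subseteq> {..<n}" for X
  proof -
    have "card X \<le> card ((X \<inter> U) \<union> ({..<n} - U))" using that fin by (intro card_mono) auto
    then show ?thesis using card_Un_le[of "X \<inter> U" "{..<n} - U"] cU(1) by linarith
  qed
  have "card (I \<inter> U \<inter> A) + card (J \<inter> U \<inter> B) \<le> independence_number_on G U"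
    using bound[of I J] IJ un by auto
  moreover have "card (J \<inter> U \<inter> A) + card (I \<inter> U \<inter> B) \<le> independence_number_on G U"
  proof -
    have "{u, v} \<notin> gedges G" if "u \<in> J \<inter> U" "v \<in> I \<inter> U" for u v
      using IJ(3)[of v u] that by (auto simp: insert_commute)
    then show ?thesis using bound[of J I] IJ(1,2) un by auto
  qed
  ultimately show "2 * card U \<le> card {r. r < n \<and> 0 < mt r} + 2 * independence_number_on G U"
    using parts[OF IJ(1)] parts[OF IJ(2)] big[OF IJ(1)] big[OF IJ(2)] IJ(4) cU(2) by linarith
qed

section \<open>The search space\<close>

text \<open>A set of at most \<open>q\<close> edges is guessed as the pairs \<open>(c j, c (q + j))\<close>, \<open>j < q\<close>,
  where pairs that are no edges are ignored.\<close>

primrec merged_labels :: "'a ugraph \<Rightarrow> nat \<Rightarrow> (nat \<Rightarrow> 'a) \<Rightarrow> nat \<Rightarrow> 'a \<Rightarrow> 'a" where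
  "merged_labels G q c 0 = (\<lambda>v. v)"
| "merged_labels G q c (Suc j) =
     (let f = merged_labels G q c j
      in if {c j, c (q + j)} \<in> gedges G
         then (\<lambda>v. if f v = f (c (q + j)) then f (c j) else f v) else f)"

definition chosen_edges :: "'a ugraph \<Rightarrow> nat \<Rightarrow> (nat \<Rightarrow> 'a) \<Rightarrow> nat \<Rightarrow> 'a set set" where
  "chosen_edges G q c j = {{c i, c (q + i)} | i. i < j \<and> {c i, c (q + i)} \<in> gedges G}"

text \<open>Counts indices, so a repeated edge is counted repeatedly. This errs on the safe side,
  and \<open>chosen_edges_exists\<close> supplies a guess without repetitions.\<close>

definition chosen_count :: "'a ugraph \<Rightarrow> nat \<Rightarrow> (nat \<Rightarrow> 'a) \<Rightarrow> nat \<Rightarrow> nat" where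
  "chosen_count G q c j = card {i. i < j \<and> {c i, c (q + i)} \<in> gedges G}"

section \<open>Guessed edge sets and their component labels\<close>

lemma edge_rel_insert_rtrancl:
  "(u, v) \<in> (edge_rel (insert {a, b} S))\<^sup>* \<longleftrightarrow>
     (u, v) \<in> (edge_rel S)\<^sup>* \<or>
     (u, a) \<in> (edge_rel S)\<^sup>* \<and> (b, v) \<in> (edge_rel S)\<^sup>* \<or>
     (u, b) \<in> (edge_rel S)\<^sup>* \<and> (a, v) \<in> (edge_rel S)\<^sup>*"
proof -
  have eq: "edge_rel (insert {a, b} S) = insert (a, b) (insert (b, a) (edge_rel S))"
    by (auto simp: edge_rel_def doubleton_eq_iff)
  show ?thesis
    unfolding eq rtrancl_insert by (auto dest: rtrancl_trans)
qed

text \<open>A merge gives the class of \<open>c (q + j)\<close> the label of \<open>c j\<close>,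
  which is its own label; so the labels remain vertices fixed by the labelling, as
  \<open>independent_labels_bound_iff\<close> demands.\<close>

lemma merged_labels_props:
  assumes G: "simple_graph G" and c: "\<And>i. i < 2 * q \<Longrightarrow> c i \<in> gverts G" and "j \<le> q"
  shows "(\<forall>v\<in>gverts G. merged_labels G q c j v \<in> gverts G \<and>
            merged_labels G q c j (merged_labels G q c j v) = merged_labels G q c j v)"
    and "component_labelling G (chosen_edges G q c j) (merged_labels G q c j)"
  using \<open>j \<le> q\<close>
proof (induction j)
  case 0
  {
    case 1
    then show ?case by simp
  next
    case 2
    have "edge_rel (chosen_edges G q c 0) = {}" by (auto simp: edge_rel_def chosen_edges_def)
    then show ?case by (simp add: component_labelling_def)
  }
next
  case (Suc j)
  define f where "f = merged_labels G q c j"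
  define a where "a = c j"
  define b where "b = c (q + j)"
  have le: "j \<le> q" if "Suc j \<le> q" using that by simp
  {
    case 1
    then have "a \<in> gverts G" "b \<in> gverts G" using c by (auto simp: a_def b_def)
    then show ?case using Suc.IH(1)[OF le[OF 1]]
      by (auto simp: Let_def f_def[symmetric] a_def[symmetric] b_def[symmetric])
  next
    case 2
    have ab: "a \<in> gverts G" "b \<in> gverts G" using 2 c by (auto simp: a_def b_def)
    have lab: "component_labelling G (chosen_edges G q c j) f"
      using Suc.IH(2)[OF le[OF 2]] by (simp add: f_def)
    show ?case
    proof (cases "{a, b} \<in> gedges G")
      case False
      then have "chosen_edges G q c (Suc j) = chosen_edges G q c j"
        by (auto simp: chosen_edges_def less_Suc_eq a_def b_def)
      then show ?thesis using lab False by (simp add: Let_def f_def a_def b_def)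
    next
      case True
      then have "chosen_edges G q c (Suc j) = insert {a, b} (chosen_edges G q c j)"
        by (auto simp: chosen_edges_def less_Suc_eq a_def b_def)
      moreover have "merged_labels G q c (Suc j) = (\<lambda>v. if f v = f b then f a else f v)"
        unfolding merged_labels.simps Let_def f_def[symmetric] a_def[symmetric] b_def[symmetric]
        using True by simp
      moreover have "(u, v) \<in> (edge_rel (chosen_edges G q c j))\<^sup>* \<longleftrightarrow> f u = f v"
        if "u \<in> gverts G" "v \<in> gverts G" for u v
        using lab that by (simp add: component_labelling_def)
      ultimately show ?thesis
        unfolding component_labelling_def by (simp add: edge_rel_insert_rtrancl ab)
    qed
  }
qed

lemma chosen_edges_subset: "chosen_edges G q c j \<subseteq> gedges G"
  by (auto simp: chosen_edges_def)

lemma card_chosen_edges_le: "card (chosen_edges G q c j) \<le> chosen_count G q c j"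
proof -
  have "chosen_edges G q c j = (\<lambda>i. {c i, c (q + i)}) ` {i. i < j \<and> {c i, c (q + i)} \<in> gedges G}"
    by (auto simp: chosen_edges_def)
  then show ?thesis by (simp add: chosen_count_def card_image_le)
qed

lemma chosen_count_le: "chosen_count G q c j \<le> j"
  unfolding chosen_count_def by (rule order_trans[OF card_mono[of "{..<j}"]]) auto

lemma chosen_edges_exists:
  assumes G: "simple_graph G" and S: "S \<subseteq> gedges G" "card S \<le> q" and w: "w \<in> gverts G"
  shows "\<exists>c. (\<forall>i<2*q. c i \<in> gverts G) \<and> chosen_edges G q c q = S \<and> chosen_count G q c q = card S"
proof -
  have "gedges G \<subseteq> Pow (gverts G)" using G by (auto simp: simple_graph_def)
  then have "finite (gedges G)" using G by (auto simp: simple_graph_def intro: finite_subset)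
  then have "finite S" using S(1) by (rule finite_subset[rotated])
  then obtain h where h: "bij_betw h {0..<card S} S" using ex_bij_betw_nat_finite by blast
  have "\<exists>a b. h i = {a, b}" if "i < card S" for i
  proof -
    have "h i \<in> gedges G" using h that S(1) by (auto simp: bij_betw_def)
    then have "card (h i) = 2" using G by (simp add: simple_graph_def)
    then show ?thesis by (meson card_2_iff)
  qed
  then obtain a b where ab: "\<And>i. i < card S \<Longrightarrow> h i = {a i, b i}" by metis
  define c where "c i = (if i < card S then a i else if q \<le> i \<and> i < q + card S then b (i - q) else w)" for i
  have hS: "h i \<in> S" if "i < card S" for i using h that by (auto simp: bij_betw_def)
  have ci: "{c i, c (q + i)} = (if i < card S then h i else {w})" if "i < q" for i
    using that S(2) ab by (auto simp: c_def)
  have w1: "{w} \<notin> gedges G" using gedges_endpoints(3)[OF G, of w w] by auto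
  have "c i \<in> gverts G" if "i < 2 * q" for i
  proof -
    have "a i \<in> gverts G \<and> b i \<in> gverts G" if "i < card S" for i
      using hS[OF that] ab[OF that] S(1) gedges_endpoints[OF G, of "a i" "b i"] by auto
    then show ?thesis using w by (auto simp: c_def)
  qed
  moreover have idx: "{i. i < q \<and> {c i, c (q + i)} \<in> gedges G} = {0..<card S}"
    using ci w1 hS S by (auto split: if_splits)
  moreover have "chosen_edges G q c q = h ` {0..<card S}"
  proof -
    have "chosen_edges G q c q = (\<lambda>i. {c i, c (q + i)}) ` {i. i < q \<and> {c i, c (q + i)} \<in> gedges G}"
      by (auto simp: chosen_edges_def)
    also have "\<dots> = h ` {0..<card S}"
      unfolding idx using ci S(2) by (intro image_cong) auto
    finally show ?thesis .
  qed
  ultimately show ?thesis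
    using h by (intro exI[of _ c]) (auto simp: chosen_count_def bij_betw_def)
qed

text \<open>Only quantifiers over tuples of numbers below \<open>n\<close> remain, which nested
  loops can enumerate: \<open>c\<close> lists the endpoints of the edges, and \<open>x\<close> lists
  vertices whose labels form \<open>X\<close>.\<close>

lemma contraction_blocker_alpha_iff_search:
  fixes G :: "nat ugraph"
  assumes G: "simple_graph G" "bipartite_graph G" "connected_graph G" and V: "gverts G = {..<n}"
    and q: "q = 2 * d + 1"
  shows "contraction_blocker_alpha d (G, k) \<longleftrightarrow>
    (\<exists>c. (\<forall>i<2*q. c i < n) \<and> int (chosen_count G q c q) \<le> k \<and>
       (\<forall>x. (\<forall>i<q. x i < n) \<longrightarrow>
          (let f = merged_labels G q c q; X = f ` x ` {..<q}
           in independent_labels G f X \<longrightarrow>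
              card X + independence_number_on G (residual_vertices G f X) + d \<le> independence_number G)))"
    (is "_ \<longleftrightarrow> (\<exists>c. ?R c)")
proof -
  have key: "independence_number (contraction G (chosen_edges G q c q)) + d \<le> independence_number G \<longleftrightarrow>
       (\<forall>x. (\<forall>i<q. x i < n) \<longrightarrow>
          (let f = merged_labels G q c q; X = f ` x ` {..<q}
           in independent_labels G f X \<longrightarrow>
              card X + independence_number_on G (residual_vertices G f X) + d \<le> independence_number G))"
    (is "?L \<longleftrightarrow> ?Q") if c: "\<forall>i<2*q. c i < n" for c
  proof -
    define f where "f = merged_labels G q c q"
    define S where "S = chosen_edges G q c q"
    have cV: "\<And>i. i < 2 * q \<Longrightarrow> c i \<in> gverts G" using c V by auto
    note props = merged_labels_props[where c = c and q = q and j = q, OF G(1) cV order_refl, folded f_def S_def]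
    have SE: "S \<subseteq> gedges G" by (simp add: S_def chosen_edges_subset)
    have fim: "f ` gverts G \<subseteq> gverts G" using props(1) by auto
    \<comment> \<open>A component with two vertices contains an edge
      \<open>{c i, c (q + i)}\<close>, whose ends have the same label. So one end per index lists
      all labels of contracted components.\<close>
    define T where "T = f ` c ` {..<q}"
    have T: "f u \<in> T" if uv: "u \<in> gverts G" "v \<in> gverts G" "u \<noteq> v" "f u = f v" for u v
    proof -
      have "(u, v) \<in> (edge_rel S)\<^sup>*" using props(2) uv by (simp add: component_labelling_def)
      then obtain w where w: "(u, w) \<in> edge_rel S" using uv(3) by (meson converse_rtranclE)
      then obtain i where i: "i < q" "{u, w} = {c i, c (q + i)}"
        by (auto simp: edge_rel_def S_def chosen_edges_def)
      have "w \<in> gverts G" using w SE gedges_endpoints[OF G(1), of u w] by (auto simp: edge_rel_def)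
      then have "f u = f w" using w props(2) uv(1) by (auto simp: component_labelling_def)
      then have "f u = f (c i)" using i(2) by (auto simp: doubleton_eq_iff)
      then show ?thesis using i(1) by (auto simp: T_def)
    qed
    have cT: "finite T" "card T \<le> q"
      using card_image_le[of "{..<q}" "f \<circ> c"] by (auto simp: T_def image_comp)
    have bound: "(\<forall>X. independent_labels G f X \<longrightarrow> card X \<le> a) \<longleftrightarrow>
      (\<forall>X. independent_labels G f X \<and> X \<noteq> {} \<and> card X \<le> q \<longrightarrow>
       card X + independence_number_on G (residual_vertices G f X) \<le> a)" for a
    proof (rule independent_labels_bound_iff[OF G(1) fim _ T cT])
      show "f (f v) = f v" if "v \<in> gverts G" for v using props(1) that by blast
    qed (use q in simp_all)
    have enum: "(\<forall>X. independent_labels G f X \<and> X \<noteq> {} \<and> card X \<le> q \<longrightarrow> P X) \<longleftrightarrow>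
      (\<forall>x. (\<forall>i<q. x i < n) \<longrightarrow> independent_labels G f (f ` x ` {..<q}) \<longrightarrow> P (f ` x ` {..<q}))" for P
    proof (intro iffI allI impI)
      fix x :: "nat \<Rightarrow> nat" assume "\<forall>X. independent_labels G f X \<and> X \<noteq> {} \<and> card X \<le> q \<longrightarrow> P X"
        and "independent_labels G f (f ` x ` {..<q})"
      moreover have "card (f ` x ` {..<q}) \<le> q"
        using card_image_le[of "{..<q}" "f \<circ> x"] by (auto simp: image_comp)
      moreover have "f ` x ` {..<q} \<noteq> {}" using q by auto
      ultimately show "P (f ` x ` {..<q})" by blast
    next
      fix X assume all: "\<forall>x. (\<forall>i<q. x i < n) \<longrightarrow> independent_labels G f (f ` x ` {..<q}) \<longrightarrow> P (f ` x ` {..<q})"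
        and X: "independent_labels G f X \<and> X \<noteq> {} \<and> card X \<le> q"
      have XV: "X \<subseteq> f ` gverts G" using X by (simp add: independent_labels_def)
      have fX: "f v = v" "v < n" if "v \<in> X" for v using that XV props(1) fim V by auto
      have finX: "finite X" using XV V by (auto intro: finite_subset)
      obtain h where h: "bij_betw h {0..<card X} X" using ex_bij_betw_nat_finite[OF finX] by blast
      \<comment> \<open>A set with fewer than \<open>q\<close> elements is listed by repeating the
        element \<open>h 0\<close>.\<close>
      define x where "x i = h (if i < card X then i else 0)" for i
      have pos: "0 < card X" using X finX by (simp add: card_gt_0_iff)
      have "x ` {..<q} = X"
      proof
        show "x ` {..<q} \<subseteq> X" using h pos by (auto simp: x_def bij_betw_def)
        show "X \<subseteq> x ` {..<q}"
        proof
          fix v assume "v \<in> X"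
          then have "v \<in> h ` {0..<card X}" using h by (simp add: bij_betw_def)
          then obtain i where "i < card X" "h i = v" by auto
          then have "v = x i" "i < q" using X by (auto simp: x_def)
          then show "v \<in> x ` {..<q}" by blast
        qed
      qed
      moreover have "f ` X = X" using fX(1) by force
      moreover have "\<forall>i<q. x i < n" using \<open>x ` {..<q} = X\<close> fX(2) by blast
      ultimately show "P X" using all X by metis
    qed
    have "?L \<longleftrightarrow> d \<le> independence_number G \<and>
        independence_number (contraction G S) \<le> independence_number G - d"
      by (auto simp: S_def)
    also have "\<dots> \<longleftrightarrow> d \<le> independence_number G \<and> (\<forall>X. independent_labels G f X \<and> X \<noteq> {} \<and> card X \<le> q \<longrightarrow>
       card X + independence_number_on G (residual_vertices G f X) \<le> independence_number G - d)"
      using trans[OF independence_number_contraction_le_iff[OF G(1) SE props(2)] bound] by (rule arg_cong)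
    also have "\<dots> \<longleftrightarrow> (\<forall>X. independent_labels G f X \<and> X \<noteq> {} \<and> card X \<le> q \<longrightarrow>
       card X + independence_number_on G (residual_vertices G f X) + d \<le> independence_number G)"
    proof -
      obtain w where w: "w \<in> gverts G" using G by (auto simp: connected_graph_def)
      \<comment> \<open>A single label is always independent. Hence the universal statement is not
        vacuous and implies \<open>d \<le> independence_number G\<close>, which makes the truncated
        subtraction harmless.\<close>
      have "independent_labels G f {f w} \<and> {f w} \<noteq> {} \<and> card {f w} \<le> q"
        using w q by (auto simp: independent_labels_def)
      then show ?thesis by fastforce
    qed
    also have "\<dots> \<longleftrightarrow> ?Q" unfolding enum by (simp add: Let_def f_def)
    finally show ?thesis .
  qed
  obtain w where w: "w \<in> gverts G" using G by (auto simp: connected_graph_def)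
  have "(\<exists>S\<subseteq>gedges G. card S \<le> 2 * d + 1 \<and> int (card S) \<le> k \<and>
       independence_number (contraction G S) + d \<le> independence_number G) \<longleftrightarrow> (\<exists>c. ?R c)"
  proof
    assume "\<exists>S\<subseteq>gedges G. card S \<le> 2 * d + 1 \<and> int (card S) \<le> k \<and>
       independence_number (contraction G S) + d \<le> independence_number G"
    then obtain S where S: "S \<subseteq> gedges G" "card S \<le> q" "int (card S) \<le> k"
       "independence_number (contraction G S) + d \<le> independence_number G" using q by blast
    obtain c where c: "\<forall>i<2*q. c i \<in> gverts G" "chosen_edges G q c q = S" "chosen_count G q c q = card S"
      using chosen_edges_exists[OF G(1) S(1,2) w] by blast
    have c': "\<forall>i<2*q. c i < n" using c(1) V by auto
    have "?R c"
    proof (intro conjI c')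
      show "int (chosen_count G q c q) \<le> k" using c(3) S(3) by simp
      show "\<forall>x. (\<forall>i<q. x i < n) \<longrightarrow>
          (let f = merged_labels G q c q; X = f ` x ` {..<q}
           in independent_labels G f X \<longrightarrow>
              card X + independence_number_on G (residual_vertices G f X) + d \<le> independence_number G)"
        by (rule key[OF c', THEN iffD1]) (use c(2) S(4) in simp)
    qed
    then show "\<exists>c. ?R c" by (rule exI[where x = c])
  next
    assume "\<exists>c. ?R c"
    then obtain c where c: "?R c" by (rule exE)
    have c': "\<forall>i<2*q. c i < n" by (rule conjunct1[OF c])
    have "card (chosen_edges G q c q) \<le> chosen_count G q c q" by (rule card_chosen_edges_le)
    moreover have "chosen_count G q c q \<le> q" by (rule chosen_count_le)
    ultimately have "card (chosen_edges G q c q) \<le> 2 * d + 1" "int (card (chosen_edges G q c q)) \<le> k"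
      using c[THEN conjunct2, THEN conjunct1] unfolding q by linarith+
    moreover have "independence_number (contraction G (chosen_edges G q c q)) + d \<le> independence_number G"
      by (rule key[OF c', THEN iffD2]) (rule c[THEN conjunct2, THEN conjunct2])
    ultimately show "\<exists>S\<subseteq>gedges G. card S \<le> 2 * d + 1 \<and> int (card S) \<le> k \<and>
       independence_number (contraction G S) + d \<le> independence_number G"
      by (intro exI[where x = "chosen_edges G q c q"] conjI chosen_edges_subset)
  qed
  with contraction_blocker_alpha_iff_small[OF G V] show ?thesis by (rule trans)
qed

section \<open>The program\<close>

text \<open>
  Registers 2, 3, 4 contain \<open>n\<close>, \<open>n + 2\<close> and \<open>q = 2 * d + 1\<close>, registers 8 and 9 the
  sign and the absolute value of \<open>k\<close>, and the registers from 100 on are the counters of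
  nested loops. In the auction, registers 18, 19, 20 are the size of the matching, \<open>nx\<close> and
  \<open>cu\<close>; register 10 keeps the size of the matching for the whole graph. Register 16
  records a violation of independence, and 15 and 11 accumulate the answers for one edge set
  and for all edge sets, respectively.

  The arrays are: 0 input, 9 offsets of the rows of the adjacency matrix, 2 component
  labels, 3 selected labels, 4 vertices remaining, 5 prices, 6 mates, 7 guessed
  edges, 8 guessed vertices.
\<close>

definition neq_exp :: "ram_exp \<Rightarrow> ram_exp \<Rightarrow> ram_exp" where
  "neq_exp e f = Add (Monus e f) (Monus f e)"

text \<open>The machine cannot multiply, so the start of a matrix row is looked up in array
  \<open>9\<close> instead of being computed from the row number.\<close>

definition adj_exp :: "ram_exp \<Rightarrow> ram_exp \<Rightarrow> ram_exp" where
  "adj_exp e f = Cell 0 (Add (Cell 9 e) f)"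

lemma ram_val_neq_exp [simp]: "ram_val (neq_exp e f) s = 0 \<longleftrightarrow> ram_val e s = ram_val f s"
  by (auto simp: neq_exp_def)

definition graph_state :: "nat ugraph \<Rightarrow> nat \<Rightarrow> nat \<Rightarrow> ram_state \<Rightarrow> bool" where
  "graph_state G n q s \<longleftrightarrow> fst s 2 = n \<and> fst s 3 = n + 2 \<and> fst s 4 = q \<and>
     (\<forall>i<n. \<forall>j<n. snd s 0 (snd s 9 i + j) \<noteq> 0 \<longleftrightarrow> {i, j} \<in> gedges G)"

lemma graph_stateD:
  assumes "graph_state G n q s"
  shows "fst s 2 = n" "fst s 3 = n + 2" "fst s 4 = q"
    "\<And>e f. ram_val e s < n \<Longrightarrow> ram_val f s < n \<Longrightarrow>
       ram_val (adj_exp e f) s = 0 \<longleftrightarrow> {ram_val e s, ram_val f s} \<notin> gedges G"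
  using assms by (simp_all add: graph_state_def adj_exp_def) (metis not_gr0)

lemma graph_state_cong:
  assumes "\<And>x. x \<in> {2, 3, 4} \<Longrightarrow> fst t x = fst s x" "\<And>a. a \<in> {0, 9} \<Longrightarrow> snd t a = snd s a"
  shows "graph_state G n q t \<longleftrightarrow> graph_state G n q s"
  using assms by (simp add: graph_state_def)

lemma graph_state_lrun:
  assumes "{2, 3, 4} \<inter> rwrites c = {}" "{0, 9} \<inter> awrites c = {}"
  shows "graph_state G n q (lrun c s) \<longleftrightarrow> graph_state G n q s"
  using assms by (intro graph_state_cong) (auto intro!: lrun_frame_reg lrun_frame_array)

text \<open>Register \<open>21\<close> holds the least price so far and starts at \<open>n\<close>,
  so neighbours of price \<open>n\<close> never qualify. Register \<open>22\<close> holds the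
  neighbour plus one, with \<open>0\<close> for none. Array \<open>4\<close> restricts the graph to
  the remaining vertices.\<close>

definition scan_prog :: lprog where
  "scan_prog =
     LReg 21 (Reg 2) ;;; LReg 22 (Const 0) ;;;
     LFor 23 2
       (LIf (adj_exp (Monus (Reg 20) (Const 1)) (Reg 23))
         (LIf (Cell 4 (Monus (Reg 20) (Const 1)))
           (LIf (Cell 4 (Reg 23))
             (LIf (Monus (Reg 21) (Cell 5 (Reg 23)))
               (LReg 21 (Cell 5 (Reg 23)) ;;; LReg 22 (Add (Reg 23) (Const 1)))
               LSkip)
             LSkip)
           LSkip)
         LSkip)"

text \<open>One move of the auction. In the finished state it changes nothing, so surplus rounds are
  harmless.\<close>

definition step_prog :: lprog where
  "step_prog =
     LIf (Reg 20)
       (scan_prog ;;;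
        LIf (Reg 22)
          (LReg 26 (Cell 6 (Monus (Reg 22) (Const 1))) ;;;
           LCell 6 (Monus (Reg 22) (Const 1)) (Reg 20) ;;;
           LCell 5 (Monus (Reg 22) (Const 1)) (Add (Reg 21) (Const 1)) ;;;
           LReg 20 (Reg 26))
          (LReg 20 (Const 0)))
       (LIf (Monus (Reg 2) (Reg 19))
          (LReg 19 (Add (Reg 19) (Const 1)) ;;; LReg 20 (Reg 19))
          LSkip)"

text \<open>The two nested loops make \<open>(n + 2) * (n + 2)\<close> moves, which the potential
  bounds from above.\<close>

definition matching_prog :: lprog where
  "matching_prog =
     LFor 23 2 (LCell 5 (Reg 23) (Const 0) ;;; LCell 6 (Reg 23) (Const 0)) ;;;
     LReg 19 (Const 0) ;;; LReg 20 (Const 0) ;;;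
     LFor 24 3 (LFor 25 3 step_prog) ;;;
     LReg 18 (Const 0) ;;;
     LFor 23 2 (LIf (Cell 6 (Reg 23)) (LReg 18 (Add (Reg 18) (Const 1))) LSkip)"

section \<open>Correctness of the matching program\<close>

lemma scan_prog_frame [simp]:
  "rwrites scan_prog = {21, 22, 23}" "awrites scan_prog = {}" "lbounds scan_prog = {2}"
  "counters_safe scan_prog"
  by (auto simp: scan_prog_def)

lemma step_prog_frame [simp]:
  "rwrites step_prog = {19, 20, 21, 22, 23, 26}" "awrites step_prog = {5, 6}"
  "lbounds step_prog = {2}" "counters_safe step_prog"
  by (auto simp: step_prog_def)

lemma matching_prog_frame [simp]:
  "rwrites matching_prog = {18, 19, 20, 21, 22, 23, 24, 25, 26}" "awrites matching_prog = {5, 6}"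
  "lbounds matching_prog = {2, 3}" "counters_safe matching_prog"
  by (auto simp: matching_prog_def)

definition alive_edge :: "nat ugraph \<Rightarrow> ram_state \<Rightarrow> nat \<Rightarrow> nat \<Rightarrow> bool" where
  "alive_edge G s u v \<longleftrightarrow> {u, v} \<in> gedges G \<and> snd s 4 u \<noteq> 0 \<and> snd s 4 v \<noteq> 0"

lemma scan_prog_correct:
  assumes gs: "graph_state G n q s" and cu: "0 < fst s 20" "fst s 20 \<le> n"
  defines "t \<equiv> lrun scan_prog s" and "E \<equiv> alive_edge G s (fst s 20 - 1)"
  shows "fst t 22 = 0 \<and> (\<forall>r<n. E r \<longrightarrow> n \<le> snd s 5 r) \<or>
    0 < fst t 22 \<and> fst t 22 - 1 < n \<and> E (fst t 22 - 1) \<and>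
      snd s 5 (fst t 22 - 1) = fst t 21 \<and> fst t 21 < n \<and> (\<forall>r<n. E r \<longrightarrow> fst t 21 \<le> snd s 5 r)"
proof -
  define s1 where "s1 = rset 22 0 (rset 21 (fst s 2) s)"
  define c where "c = LIf (adj_exp (Monus (Reg 20) (Const 1)) (Reg 23))
         (LIf (Cell 4 (Monus (Reg 20) (Const 1)))
           (LIf (Cell 4 (Reg 23))
             (LIf (Monus (Reg 21) (Cell 5 (Reg 23)))
               (LReg 21 (Cell 5 (Reg 23)) ;;; LReg 22 (Add (Reg 23) (Const 1)))
               LSkip)
             LSkip)
           LSkip)
         LSkip"
  define I where "I i t \<longleftrightarrow> fst t 22 = 0 \<and> fst t 21 = n \<and> (\<forall>r<i. E r \<longrightarrow> n \<le> snd s 5 r) \<or>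
    0 < fst t 22 \<and> fst t 22 - 1 < i \<and> E (fst t 22 - 1) \<and>
      snd s 5 (fst t 22 - 1) = fst t 21 \<and> fst t 21 < n \<and> (\<forall>r<i. E r \<longrightarrow> fst t 21 \<le> snd s 5 r)"
    for i and t :: ram_state
  have fr: "rwrites c = {21, 22}" "awrites c = {}" "counters_safe (LFor 23 2 c)"
    by (auto simp: c_def)
  have n: "fst s 2 = n" using gs by (rule graph_stateD)
  have "I (fst s1 2) (lrun (LFor 23 2 c) s1)"
  proof (rule lrun_for[OF fr(3)])
    show "I 0 (rset 23 0 s1)" by (simp add: I_def s1_def n)
  next
    fix i t assume i: "i < fst s1 2" "fst t 23 = i"
      and t: "\<And>x. x \<notin> insert 23 (rwrites c) \<Longrightarrow> fst t x = fst s1 x"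
        "\<And>a. a \<notin> awrites c \<Longrightarrow> snd t a = snd s1 a" and I: "I i t"
    have "graph_state G n q t \<longleftrightarrow> graph_state G n q s"
      by (rule graph_state_cong) (auto simp: t fr s1_def)
    then have gt: "graph_state G n q t" using gs by simp
    have i': "i < n" using i by (simp add: s1_def n)
    have r20: "fst t 20 = fst s 20" and arr: "snd t = snd s"
      by (auto simp: t fr s1_def fun_eq_iff)
    have adj: "ram_val (adj_exp (Monus (Reg 20) (Const 1)) (Reg 23)) t = 0 \<longleftrightarrow>
        {fst s 20 - 1, i} \<notin> gedges G"
      using graph_stateD(4)[OF gt, of "Monus (Reg 20) (Const 1)" "Reg 23"] i i' cu
      by (simp add: r20)
    have run: "lrun c t = (if E i \<and> snd s 5 i < fst t 21
        then rset 22 (Suc i) (rset 21 (snd s 5 i) t) else t)"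
      unfolding c_def lrun.simps adj by (simp add: arr r20 i E_def alive_edge_def)
    show "I (Suc i) (rset 23 (Suc i) (lrun c t))"
      using I i' unfolding run by (auto simp: I_def less_Suc_eq)
  qed
  moreover have "t = lrun (LFor 23 2 c) s1"
    unfolding t_def scan_prog_def c_def s1_def lrun.simps by simp
  ultimately show ?thesis unfolding I_def by (auto simp: s1_def n)
qed

lemma step_prog_correct:
  assumes gs: "graph_state G n q s"
    and inv: "auction_inv n (alive_edge G s) (snd s 5) (snd s 6) (fst s 19) (fst s 20)"
  defines "t \<equiv> lrun step_prog s"
  shows "auction_inv n (alive_edge G s) (snd t 5) (snd t 6) (fst t 19) (fst t 20) \<and>
    (fst t 19 = n \<and> fst t 20 = 0 \<or>
     auction_pot n (snd s 5) (fst s 19) (fst s 20) < auction_pot n (snd t 5) (fst t 19) (fst t 20))"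
proof (cases "fst s 20 = 0")
  case True
  have n: "fst s 2 = n" using gs by (rule graph_stateD)
  show ?thesis
  proof (cases "fst s 19 < n")
    case l: True
    have t: "t = rset 20 (Suc (fst s 19)) (rset 19 (Suc (fst s 19)) s)"
      using True l by (simp add: t_def step_prog_def n)
    show ?thesis
      using auction_inv_advance[of n "alive_edge G s" "snd s 5" "snd s 6" "fst s 19"] inv True l
      by (simp add: t auction_pot_def)
  next
    case False
    have "t = s" using True False by (simp add: t_def step_prog_def n)
    then show ?thesis using True False inv auction_invD(1)[OF inv] by simp
  qed
next
  case False
  have n: "fst s 2 = n" using gs by (rule graph_stateD)
  define u where "u = lrun scan_prog s"
  have u: "fst u 19 = fst s 19" "fst u 20 = fst s 20" "snd u = snd s"
    unfolding u_def by (auto simp: lrun_frame_reg lrun_frame_array fun_eq_iff)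
  have cu: "fst s 20 \<le> n" using auction_invD(1,2)[OF inv] by simp
  have t: "t = (if fst u 22 = 0 then rset 20 0 u
     else rset 20 (snd s 6 (fst u 22 - 1)) (cset 5 (fst u 22 - 1) (Suc (fst u 21))
        (cset 6 (fst u 22 - 1) (fst s 20) (rset 26 (snd s 6 (fst u 22 - 1)) u))))"
    using False by (simp add: t_def step_prog_def u_def[symmetric] u)
  have sc: "fst u 22 = 0 \<and> (\<forall>r<n. alive_edge G s (fst s 20 - 1) r \<longrightarrow> n \<le> snd s 5 r) \<or>
    0 < fst u 22 \<and> fst u 22 - 1 < n \<and> alive_edge G s (fst s 20 - 1) (fst u 22 - 1) \<and>
      snd s 5 (fst u 22 - 1) = fst u 21 \<and> fst u 21 < n \<and>
      (\<forall>r<n. alive_edge G s (fst s 20 - 1) r \<longrightarrow> fst u 21 \<le> snd s 5 r)"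
    unfolding u_def using False cu by (intro scan_prog_correct[OF gs]) auto
  show ?thesis
  proof (cases "fst u 22 = 0")
    case True
    then have "auction_inv n (alive_edge G s) (snd s 5) (snd s 6) (fst s 19) 0"
      using sc by (intro auction_inv_drop[OF inv]) auto
    then show ?thesis using True False by (simp add: t u auction_pot_def)
  next
    case nz: False
    define r where "r = fst u 22 - 1"
    have r: "r < n" "alive_edge G s (fst s 20 - 1) r" "snd s 5 r = fst u 21" "snd s 5 r < n"
      "\<And>r'. r' < n \<Longrightarrow> alive_edge G s (fst s 20 - 1) r' \<Longrightarrow> snd s 5 r \<le> snd s 5 r'"
      using sc nz unfolding r_def by auto
    have t': "t = rset 20 (snd s 6 r) (cset 5 r (Suc (snd s 5 r)) (cset 6 r (fst s 20) (rset 26 (snd s 6 r) u)))"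
      using nz r(3) by (simp add: t r_def)
    have "auction_inv n (alive_edge G s) ((snd s 5)(r := Suc (snd s 5 r))) ((snd s 6)(r := fst s 20))
        (fst s 19) (snd s 6 r)"
      using False r by (intro auction_inv_bid[OF inv]) auto
    moreover have "auction_pot n (snd s 5) (fst s 19) (fst s 20)
        < auction_pot n ((snd s 5)(r := Suc (snd s 5 r))) (fst s 19) (snd s 6 r)"
      using auction_pot_bid[of r n "fst s 20" "snd s 5" "fst s 19" "snd s 6 r"] False r by simp
    ultimately show ?thesis by (simp add: t' u)
  qed
qed

text \<open>The matching lives in the double cover, so its size is twice that of a maximum matching
  of the graph induced on \<open>U\<close>; hence everything appears doubled.\<close>

lemma matching_prog_correct:
  assumes gs: "graph_state G n q s"
    and G: "simple_graph G" "bipartite_graph G" "gverts G = {..<n}"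
  defines "U \<equiv> {v. v < n \<and> snd s 4 v \<noteq> 0}"
  shows "fst (lrun matching_prog s) 18 + 2 * independence_number_on G U = 2 * card U"
proof -
  define c1 where "c1 = LCell 5 (Reg 23) (Const 0) ;;; LCell 6 (Reg 23) (Const 0)"
  define s1 where "s1 = lrun (LFor 23 2 c1) s"
  define s2 where "s2 = rset 20 0 (rset 19 0 s1)"
  define s3 where "s3 = lrun (LFor 24 3 (LFor 25 3 step_prog)) s2"
  define c4 where "c4 = LIf (Cell 6 (Reg 23)) (LReg 18 (Add (Reg 18) (Const 1))) LSkip"
  define s4 where "s4 = rset 18 0 s3"
  have run: "lrun matching_prog s = lrun (LFor 23 2 c4) s4"
    by (simp add: matching_prog_def s4_def s3_def s2_def s1_def c1_def c4_def del: lrun.simps(6))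
  note nn = graph_stateD(1,2)[OF gs]
  let ?E = "alive_edge G s"
  have fr1: "rwrites c1 = {}" "awrites c1 = {5, 6}" "counters_safe (LFor 23 2 c1)"
    by (auto simp: c1_def)
  have z: "\<forall>r<fst s 2. snd s1 5 r = 0 \<and> snd s1 6 r = 0"
    unfolding s1_def
    by (rule lrun_for[OF fr1(3), where I = "\<lambda>i t. \<forall>r<i. snd t 5 r = 0 \<and> snd t 6 r = 0"])
      (auto simp: c1_def less_Suc_eq)
  have f1: "fst s1 x = fst s x" if "x \<noteq> 23" for x
    unfolding s1_def using that by (intro lrun_frame_reg) (simp add: fr1)
  have a1: "snd s1 a = snd s a" if "a \<noteq> 5" "a \<noteq> 6" for a
    unfolding s1_def using that by (intro lrun_frame_array) (simp add: fr1)
  have "graph_state G n q s2 \<longleftrightarrow> graph_state G n q s"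
    by (rule graph_state_cong) (auto simp: s2_def f1 a1)
  then have g2: "graph_state G n q s2" using gs by simp
  have "auction_inv n ?E (snd s2 5) (snd s2 6) 0 0 \<longleftrightarrow> auction_inv n ?E (\<lambda>_. 0) (\<lambda>_. 0) 0 0"
    using z by (intro auction_inv_cong) (auto simp: s2_def nn)
  then have inv2: "auction_inv n ?E (snd s2 5) (snd s2 6) (fst s2 19) (fst s2 20)"
    by (simp add: auction_inv_init s2_def)
  \<comment> \<open>After \<open>k\<close> moves the auction is finished or has potential at least
    \<open>k\<close>; at \<open>(n + 2) * (n + 2)\<close> the bound on the potential excludes the
    second case.\<close>
  define J where "J k t \<longleftrightarrow> auction_inv n ?E (snd t 5) (snd t 6) (fst t 19) (fst t 20) \<and>
    (fst t 19 = n \<and> fst t 20 = 0 \<or> k \<le> auction_pot n (snd t 5) (fst t 19) (fst t 20))" for k and t :: ram_state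
  have Jstep: "J (Suc k) (lrun step_prog t)"
    if J: "J k t" and t: "graph_state G n q t" "snd t 4 = snd s 4" for k t
  proof -
    have E: "alive_edge G t = ?E" using t(2) by (auto simp: alive_edge_def fun_eq_iff)
    have inv: "auction_inv n (alive_edge G t) (snd t 5) (snd t 6) (fst t 19) (fst t 20)"
      using J by (simp add: J_def E)
    show ?thesis
    proof (cases "fst t 19 = n \<and> fst t 20 = 0")
      case True
      then have "lrun step_prog t = t" by (simp add: step_prog_def graph_stateD[OF t(1)])
      then show ?thesis using J True by (simp add: J_def)
    next
      case False
      then show ?thesis using step_prog_correct[OF t(1) inv] J unfolding J_def E by auto
    qed
  qed
  have "J (fst s2 3 * fst s2 3) s3"
    unfolding s3_def
  proof (rule lrun_for[where I = "\<lambda>i t. J (i * fst s2 3) t"])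
    show "counters_safe (LFor 24 3 (LFor 25 3 step_prog))" by simp
    show "J (0 * fst s2 3) (rset 24 0 s2)" using inv2 by (simp add: J_def)
    fix i t assume t: "\<And>x. x \<notin> insert 24 (rwrites (LFor 25 3 step_prog)) \<Longrightarrow> fst t x = fst s2 x"
      "\<And>a. a \<notin> awrites (LFor 25 3 step_prog) \<Longrightarrow> snd t a = snd s2 a" and J: "J (i * fst s2 3) t"
    have "J (i * fst s2 3 + fst t 3) (lrun (LFor 25 3 step_prog) t)"
    proof (rule lrun_for[where I = "\<lambda>j u. J (i * fst s2 3 + j) u"])
      show "counters_safe (LFor 25 3 step_prog)" by simp
      show "J (i * fst s2 3 + 0) (rset 25 0 t)" using J by (simp add: J_def)
      fix j u assume u: "\<And>x. x \<notin> insert 25 (rwrites step_prog) \<Longrightarrow> fst u x = fst t x"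
        "\<And>a. a \<notin> awrites step_prog \<Longrightarrow> snd u a = snd t a" and Ju: "J (i * fst s2 3 + j) u"
      have "graph_state G n q u \<longleftrightarrow> graph_state G n q s2"
        by (rule graph_state_cong) (auto simp: u t)
      then have "graph_state G n q u" using g2 by simp
      moreover have "snd u 4 = snd s 4" by (simp add: u t s2_def a1)
      ultimately have "J (Suc (i * fst s2 3 + j)) (lrun step_prog u)" by (rule Jstep[OF Ju])
      then show "J (i * fst s2 3 + Suc j) (rset 25 (Suc j) (lrun step_prog u))" by (simp add: J_def)
    qed
    moreover have "fst t 3 = fst s2 3" by (simp add: t)
    ultimately show "J (Suc i * fst s2 3) (rset 24 (Suc i) (lrun (LFor 25 3 step_prog) t))"
      by (simp add: J_def add.commute del: lrun.simps)
  qed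
  then have J3: "J ((n + 2) * (n + 2)) s3" by (simp add: graph_stateD[OF g2])
  then have "auction_inv n ?E (snd s3 5) (snd s3 6) n 0"
    using auction_pot_bound[of n ?E "snd s3 5" "snd s3 6" "fst s3 19" "fst s3 20"]
    unfolding J_def by (metis not_le)
  moreover have "?E = (\<lambda>u v. {u, v} \<in> gedges G \<and> u \<in> U \<and> v \<in> U)"
    using gedges_endpoints(1,2)[OF G(1)] G(3) by (auto simp: alive_edge_def U_def fun_eq_iff)
  ultimately have "card {r. r < n \<and> 0 < snd s3 6 r} + 2 * independence_number_on G U = 2 * card U"
    by (intro auction_double_cover[OF G]) (auto simp: U_def[symmetric], auto simp: U_def)
  moreover have "fst (lrun (LFor 23 2 c4) s4) 18 = card {r. r < n \<and> 0 < snd s3 6 r}"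
  proof -
    have c: "counters_safe (LFor 23 2 c4)" by (simp add: c4_def)
    have "fst s4 2 = n"
    proof -
      have "fst s3 2 = fst s2 2" unfolding s3_def by (rule lrun_frame_reg) simp
      then show ?thesis by (simp add: s4_def graph_stateD[OF g2])
    qed
    moreover have "fst (lrun (LFor 23 2 c4) s4) 18 = card {r. r < fst s4 2 \<and> 0 < snd s3 6 r}"
    proof (rule lrun_for[OF c, where I = "\<lambda>i t. fst t 18 = card {r. r < i \<and> 0 < snd s3 6 r}"])
      fix i and t :: ram_state assume i: "fst t 23 = i" and t: "\<And>a. a \<notin> awrites c4 \<Longrightarrow> snd t a = snd s4 a"
        and I: "fst t 18 = card {r. r < i \<and> 0 < snd s3 6 r}"
      have "snd t 6 = snd s3 6" using t[of 6] by (simp add: c4_def s4_def)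
      moreover have "{r. r < Suc i \<and> 0 < snd s3 6 r} =
          (if 0 < snd s3 6 i then insert i {r. r < i \<and> 0 < snd s3 6 r} else {r. r < i \<and> 0 < snd s3 6 r})"
        by (auto simp: less_Suc_eq)
      ultimately show "fst (rset 23 (Suc i) (lrun c4 t)) 18 = card {r. r < Suc i \<and> 0 < snd s3 6 r}"
        using I i by (simp add: c4_def)
    qed (simp add: s4_def)
    ultimately show ?thesis by simp
  qed
  ultimately show ?thesis by (simp add: run del: lrun.simps)
qed

text \<open>Runs \<open>c\<close> on every \<open>j\<close>-tuple, stored in array \<open>a\<close>.
  The depth is part of the program and not of the input, which is where it matters that
  \<open>d\<close> is fixed.\<close>

primrec nested :: "nat \<Rightarrow> nat \<Rightarrow> nat \<Rightarrow> lprog \<Rightarrow> lprog" where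
  "nested base a 0 c = c"
| "nested base a (Suc j) c =
     LFor (base + j) 2 (LCell a (Const j) (Reg (base + j)) ;;; nested base a j c)"

section \<open>Enumerating tuples by nested loops\<close>

lemma nested_frame:
  "rwrites (nested base a j c) = rwrites c \<union> {base..<base + j}"
  "awrites (nested base a j c) \<subseteq> insert a (awrites c)"
  "lbounds (nested base a j c) \<subseteq> insert 2 (lbounds c)"
  by (induction j) auto

lemma counters_safe_nested:
  assumes "counters_safe c" "\<And>i. i < j \<Longrightarrow> base + i \<notin> rwrites c"
  shows "counters_safe (nested base a j c)"
  using assms by (induction j) (auto simp: nested_frame)

text \<open>\<open>C\<close> is the context that loops and body preserve, \<open>P\<close> the
  property of a tuple that the body detects, and \<open>A\<close> says how register
  \<open>out\<close> records a detection: by a nonzero value for a successful edge set, by zero for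
  a counterexample to one edge set. The second use yields a universal quantifier.\<close>

lemma nested_correct:
  assumes safe: "counters_safe c" "\<And>i. i < k \<Longrightarrow> base + i \<notin> rwrites c" "a \<notin> awrites c"
    and out: "out < base" "2 < base"
    and Cn: "\<And>s. C s \<Longrightarrow> fst s 2 = n"
    and Cr: "\<And>s r x. base \<le> r \<Longrightarrow> C s \<Longrightarrow> C (rset r x s)"
    and Ca: "\<And>s i x. C s \<Longrightarrow> C (cset a i x s)"
    and body: "\<And>s. C s \<Longrightarrow> (\<And>i. i < k \<Longrightarrow> snd s a i < n) \<Longrightarrow>
       C (lrun c s) \<and> (A (fst (lrun c s) out) \<longleftrightarrow> A (fst s out) \<or> P (snd s a))"
    and P: "\<And>f g. (\<And>i. i < k \<Longrightarrow> f i = g i) \<Longrightarrow> P f = P g"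
    and s: "C s"
  shows "C (lrun (nested base a k c) s) \<and>
    (A (fst (lrun (nested base a k c) s) out) \<longleftrightarrow> A (fst s out) \<or> (\<exists>y. (\<forall>i<k. y i < n) \<and> P y))"
proof -
  \<comment> \<open>At depth \<open>j\<close> the cells from \<open>j\<close> on belong to the
    enclosing loops and act as parameters of \<open>P\<close>.\<close>
  have "C (lrun (nested base a j c) s) \<and>
      (\<forall>i\<ge>j. snd (lrun (nested base a j c) s) a i = snd s a i) \<and>
      (A (fst (lrun (nested base a j c) s) out) \<longleftrightarrow>
        A (fst s out) \<or> (\<exists>y. (\<forall>i<j. y i < n) \<and> P (\<lambda>i. if i < j then y i else snd s a i)))"
    if "j \<le> k" "C s" "\<And>i. j \<le> i \<Longrightarrow> i < k \<Longrightarrow> snd s a i < n" for j s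
    using that
  proof (induction j arbitrary: s)
    case 0
    then show ?case using body[of s] safe(3) by (simp add: lrun_frame_array)
  next
    case (Suc j)
    let ?b = "LCell a (Const j) (Reg (base + j)) ;;; nested base a j c"
    have cs: "counters_safe (LFor (base + j) 2 ?b)"
      using counters_safe_nested[OF safe(1), of "Suc j" base a] safe(2) Suc.prems(1) by simp
    \<comment> \<open>After \<open>m\<close> rounds exactly the tuples with \<open>y j < m\<close>
      have been tried.\<close>
    define I where "I m t \<longleftrightarrow> C t \<and> (\<forall>i\<ge>Suc j. snd t a i = snd s a i) \<and>
      (A (fst t out) \<longleftrightarrow> A (fst s out) \<or>
        (\<exists>y. (\<forall>i<j. y i < n) \<and> y j < m \<and> P (\<lambda>i. if i < Suc j then y i else snd s a i)))"
      for m and t :: ram_state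
    have "I (fst s 2) (lrun (LFor (base + j) 2 ?b) s)"
    proof (rule lrun_for[OF cs])
      show "I 0 (rset (base + j) 0 s)"
        using Suc.prems(2) out by (auto simp: I_def intro: Cr)
    next
      fix m t assume m: "m < fst s 2" "fst t (base + j) = m" and I: "I m t"
      have mn: "m < n" using m Cn[OF Suc.prems(2)] by simp
      define u where "u = cset a j m t"
      have Cu: "C u" using I by (auto simp: u_def I_def intro: Ca)
      have ua: "snd u a i = (if i = j then m else snd s a i)" if "j \<le> i" for i
        using that I by (auto simp: u_def I_def)
      have ih: "C (lrun (nested base a j c) u) \<and>
        (\<forall>i\<ge>j. snd (lrun (nested base a j c) u) a i = snd u a i) \<and>
        (A (fst (lrun (nested base a j c) u) out) \<longleftrightarrow>
          A (fst u out) \<or> (\<exists>y. (\<forall>i<j. y i < n) \<and> P (\<lambda>i. if i < j then y i else snd u a i)))"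
        using Suc.prems mn by (intro Suc.IH Cu) (auto simp: ua)
      have e: "(\<exists>y. (\<forall>i<j. y i < n) \<and> y j < Suc m \<and> P (\<lambda>i. if i < Suc j then y i else snd s a i)) \<longleftrightarrow>
         (\<exists>y. (\<forall>i<j. y i < n) \<and> y j < m \<and> P (\<lambda>i. if i < Suc j then y i else snd s a i)) \<or>
         (\<exists>y. (\<forall>i<j. y i < n) \<and> P (\<lambda>i. if i < j then y i else snd u a i))" (is "?l \<longleftrightarrow> ?r1 \<or> ?r2")
      proof
        assume ?l
        then obtain y where y: "\<forall>i<j. y i < n" "y j < Suc m" "P (\<lambda>i. if i < Suc j then y i else snd s a i)"
          by blast
        show "?r1 \<or> ?r2"
        proof (cases "y j = m")
          case True
          then have "(\<lambda>i. if i < Suc j then y i else snd s a i) = (\<lambda>i. if i < j then y i else snd u a i)"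
            by (auto simp: fun_eq_iff ua less_Suc_eq)
          then show ?thesis using y by auto
        next
          case False
          then show ?thesis using y by (metis less_SucE)
        qed
      next
        assume "?r1 \<or> ?r2"
        then show ?l
        proof
          assume ?r2
          then obtain y where y: "\<forall>i<j. y i < n" "P (\<lambda>i. if i < j then y i else snd u a i)" by blast
          have "(\<lambda>i. if i < Suc j then (y(j := m)) i else snd s a i) = (\<lambda>i. if i < j then y i else snd u a i)"
            by (auto simp: fun_eq_iff ua less_Suc_eq)
          then show ?l using y by (intro exI[of _ "y(j := m)"]) auto
        qed (metis less_SucI)
      qed
      have run: "lrun ?b t = lrun (nested base a j c) u" using m by (simp add: u_def)
      show "I (Suc m) (rset (base + j) (Suc m) (lrun ?b t))"
        unfolding run I_def e
      proof (intro conjI)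
        show "C (rset (base + j) (Suc m) (lrun (nested base a j c) u))" using ih by (auto intro: Cr)
        show "\<forall>i\<ge>Suc j. snd (rset (base + j) (Suc m) (lrun (nested base a j c) u)) a i = snd s a i"
          using ih ua by simp
        have "fst (rset (base + j) (Suc m) (lrun (nested base a j c) u)) out
            = fst (lrun (nested base a j c) u) out" using out by simp
        moreover have "fst u out = fst t out" by (simp add: u_def)
        ultimately show "A (fst (rset (base + j) (Suc m) (lrun (nested base a j c) u)) out) \<longleftrightarrow>
          A (fst s out) \<or> ?r1 \<or> ?r2"
          using ih I unfolding I_def by auto
      qed
    qed
    moreover have "(\<forall>i<Suc j. y i < n) \<longleftrightarrow> (\<forall>i<j. y i < n) \<and> y j < n" for y :: "nat \<Rightarrow> nat"
      by (auto simp: less_Suc_eq)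
    ultimately show ?case
      using Cn[OF Suc.prems(2)] unfolding I_def nested.simps by simp
  qed
  from this[OF order_refl s] have "C (lrun (nested base a k c) s) \<and>
      (A (fst (lrun (nested base a k c) s) out) \<longleftrightarrow>
        A (fst s out) \<or> (\<exists>y. (\<forall>i<k. y i < n) \<and> P (\<lambda>i. if i < k then y i else snd s a i)))"
    by simp
  moreover have "P (\<lambda>i. if i < k then y i else snd s a i) = P y" for y by (rule P) simp
  ultimately show ?thesis by simp
qed

text \<open>Labels are vertices, so array \<open>3\<close> marks \<open>X\<close> as a vertex set,
  and the pass that fills array \<open>4\<close> also accumulates the number of labels plus the
  number of residual vertices in register \<open>17\<close>.\<close>

definition residual_prog :: lprog where
  "residual_prog =
     LFor 5 2 (LCell 3 (Reg 5) (Const 0)) ;;;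
     LFor 5 4 (LCell 3 (Cell 2 (Cell 8 (Reg 5))) (Const 1)) ;;;
     LReg 16 (Const 0) ;;; LReg 17 (Const 0) ;;;
     LFor 5 2
       (LCell 4 (Reg 5) (Monus (Const 1) (Cell 3 (Cell 2 (Reg 5)))) ;;;
        LFor 6 2
          (LIf (neq_exp (Cell 2 (Reg 6)) (Cell 2 (Reg 5)))
            (LIf (adj_exp (Reg 6) (Reg 5))
              (LIf (Cell 3 (Cell 2 (Reg 6)))
                (LCell 4 (Reg 5) (Const 0) ;;;
                 LIf (Cell 3 (Cell 2 (Reg 5))) (LReg 16 (Const 1)) LSkip)
                LSkip)
              LSkip)
            (LIf (neq_exp (Reg 6) (Reg 5)) (LCell 4 (Reg 5) (Const 0)) LSkip)) ;;;
        LReg 17 (Add (Reg 17) (Add (Cell 3 (Reg 5)) (Cell 4 (Reg 5)))))"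

text \<open>Register \<open>10\<close> contains \<open>2 * n - 2 * \<alpha>(G)\<close>. Let
  \<open>R\<close> be the set of residual vertices; register \<open>17\<close> contains
  \<open>|X| + |R|\<close> and register \<open>18\<close> contains
  \<open>2 * |R| - 2 * \<alpha>(R)\<close>. The compared sums thus differ by
  \<open>2 * (|X| + \<alpha>(R) + d - \<alpha>(G))\<close>.\<close>

definition check_prog :: "nat \<Rightarrow> lprog" where
  "check_prog d =
     residual_prog ;;; matching_prog ;;;
     LIf (Reg 16) LSkip
       (LIf (Monus (Add (Add (Add (Reg 17) (Reg 17)) (Const (2 * d))) (Reg 10))
                   (Add (Add (Reg 2) (Reg 2)) (Reg 18)))
         (LReg 15 (Const 0)) LSkip)"

section \<open>Correctness of the test of one guess\<close>

lemma residual_prog_frame [simp]: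
  "rwrites residual_prog = {5, 6, 16, 17}" "awrites residual_prog = {3, 4}"
  "lbounds residual_prog = {2, 4}" "counters_safe residual_prog"
  by (auto simp: residual_prog_def)

lemma check_prog_frame [simp]:
  "rwrites (check_prog d) = {5, 6, 15, 16, 17, 18, 19, 20, 21, 22, 23, 24, 25, 26}"
  "awrites (check_prog d) = {3, 4, 5, 6}"
  "lbounds (check_prog d) = {2, 3, 4}" "counters_safe (check_prog d)"
  by (auto simp: check_prog_def)

lemma residual_prog_correct:
  assumes gs: "graph_state G n q s"
    and V: "gverts G = {..<n}"
    and f: "\<And>v. v < n \<Longrightarrow> snd s 2 v = f v" "\<And>v. v < n \<Longrightarrow> f v < n"
    and x: "\<And>i. i < q \<Longrightarrow> snd s 8 i < n"
  defines "X \<equiv> f ` snd s 8 ` {..<q}" and "t \<equiv> lrun residual_prog s"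
  shows "{v. v < n \<and> snd t 4 v \<noteq> 0} = residual_vertices G f X"
    and "fst t 16 = 0 \<longleftrightarrow> independent_labels G f X"
    and "fst t 17 = card X + card (residual_vertices G f X)"
proof -
  note nn = graph_stateD(1-3)[OF gs]
  have XV: "X \<subseteq> {..<n}" "X \<subseteq> f ` {..<n}" using x f by (auto simp: X_def)
  define c1 where "c1 = LCell 3 (Reg 5) (Const 0)"
  define s1 where "s1 = lrun (LFor 5 2 c1) s"
  define c2 where "c2 = LCell 3 (Cell 2 (Cell 8 (Reg 5))) (Const 1)"
  define s2 where "s2 = lrun (LFor 5 4 c2) s1"
  define s3 where "s3 = rset 17 0 (rset 16 0 s2)"
  define b4 where "b4 = LIf (neq_exp (Cell 2 (Reg 6)) (Cell 2 (Reg 5)))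
            (LIf (adj_exp (Reg 6) (Reg 5))
              (LIf (Cell 3 (Cell 2 (Reg 6)))
                (LCell 4 (Reg 5) (Const 0) ;;;
                 LIf (Cell 3 (Cell 2 (Reg 5))) (LReg 16 (Const 1)) LSkip)
                LSkip)
              LSkip)
            (LIf (neq_exp (Reg 6) (Reg 5)) (LCell 4 (Reg 5) (Const 0)) LSkip)"
  define c4 where "c4 = LCell 4 (Reg 5) (Monus (Const 1) (Cell 3 (Cell 2 (Reg 5)))) ;;;
        LFor 6 2 b4 ;;;
        LReg 17 (Add (Reg 17) (Add (Cell 3 (Reg 5)) (Cell 4 (Reg 5))))"
  have run: "t = lrun (LFor 5 2 c4) s3"
    by (simp add: t_def residual_prog_def s3_def s2_def s1_def c1_def c2_def c4_def b4_def del: lrun.simps(6))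
  have fr1: "rwrites c1 = {}" "awrites c1 = {3}" "counters_safe (LFor 5 2 c1)"
    by (auto simp: c1_def)
  have fr2: "rwrites c2 = {}" "awrites c2 = {3}" "counters_safe (LFor 5 4 c2)"
    by (auto simp: c2_def)
  have fr4: "rwrites b4 = {16}" "awrites b4 = {4}" "counters_safe (LFor 6 2 b4)"
    by (auto simp: b4_def)
  have fr5: "rwrites c4 = {6, 16, 17}" "awrites c4 = {4}" "counters_safe (LFor 5 2 c4)"
    using fr4 by (auto simp: c4_def)
  have z1: "\<forall>r<fst s 2. snd s1 3 r = 0"
    unfolding s1_def
    by (rule lrun_for[OF fr1(3), where I = "\<lambda>i t. \<forall>r<i. snd t 3 r = 0"])
      (auto simp: c1_def less_Suc_eq)
  have f1: "fst s1 r = fst s r" if "r \<noteq> 5" for r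
    unfolding s1_def using that by (intro lrun_frame_reg) (simp add: fr1)
  have a1: "snd s1 a = snd s a" if "a \<noteq> 3" for a
    unfolding s1_def using that by (intro lrun_frame_array) (simp add: fr1)
  have f2: "fst s2 r = fst s r" if "r \<noteq> 5" for r
    unfolding s2_def using that f1 by (subst lrun_frame_reg) (simp_all add: fr2)
  have a2: "snd s2 a = snd s a" if "a \<noteq> 3" for a
    unfolding s2_def using that a1 by (subst lrun_frame_array) (simp_all add: fr2)
  have "\<forall>v<n. snd s2 3 v = of_bool (v \<in> f ` snd s 8 ` {..<fst s1 4})"
    unfolding s2_def
  proof (rule lrun_for[OF fr2(3), where I = "\<lambda>i t. \<forall>v<n. snd t 3 v = of_bool (v \<in> f ` snd s 8 ` {..<i})"])
    fix i and t :: ram_state assume i: "i < fst s1 4" "fst t 5 = i"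
      and t: "\<And>a. a \<notin> awrites c2 \<Longrightarrow> snd t a = snd s1 a"
      and I: "\<forall>v<n. snd t 3 v = of_bool (v \<in> f ` snd s 8 ` {..<i})"
    have "ram_val (Cell 2 (Cell 8 (Reg 5))) t = f (snd s 8 i)"
      using i t[of 2] t[of 8] x f by (simp add: fr2 a1 f1 nn)
    then have "lrun c2 t = cset 3 (f (snd s 8 i)) 1 t" by (simp add: c2_def)
    then show "\<forall>v<n. snd (rset 5 (Suc i) (lrun c2 t)) 3 v = of_bool (v \<in> f ` snd s 8 ` {..<Suc i})"
      using I by (auto simp: lessThan_Suc)
  qed (use z1 nn in \<open>simp add: f1\<close>)
  then have mark: "\<And>v. v < n \<Longrightarrow> snd s2 3 v = of_bool (v \<in> X)"
    by (simp add: f1 nn X_def)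
  define dead where "dead u v \<longleftrightarrow> u \<noteq> v \<and> f u = f v \<or> {u, v} \<in> gedges G \<and> f u \<in> X" for u v
  define clash where "clash u v \<longleftrightarrow> {u, v} \<in> gedges G \<and> f u \<in> X \<and> f v \<in> X \<and> f u \<noteq> f v" for u v
  define alive where "alive v \<longleftrightarrow> f v \<notin> X \<and> (\<forall>u<n. \<not> dead u v)" for v
  have res: "residual_vertices G f X = {v. v < n \<and> alive v}"
    by (auto simp: residual_vertices_def V alive_def dead_def)
  define I where "I i t \<longleftrightarrow> (\<forall>v<i. snd t 4 v = of_bool (alive v)) \<and>
      (fst t 16 = 0 \<longleftrightarrow> (\<forall>v<i. \<forall>u<n. \<not> clash u v)) \<and>
      fst t 17 = card {v. v < i \<and> v \<in> X} + card {v. v < i \<and> alive v}" for i and t :: ram_state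
  have "I (fst s3 2) (lrun (LFor 5 2 c4) s3)"
  proof (rule lrun_for[OF fr5(3)])
    show "I 0 (rset 5 0 s3)" by (simp add: I_def s3_def)
  next
    fix i t assume i: "i < fst s3 2" "fst t 5 = i"
      and t: "\<And>r. r \<notin> insert 5 (rwrites c4) \<Longrightarrow> fst t r = fst s3 r"
        "\<And>a. a \<notin> awrites c4 \<Longrightarrow> snd t a = snd s3 a" and It: "I i t"
    have ni: "i < n" using i by (simp add: s3_def f2 nn)
    have ta: "snd t 2 = snd s 2" "snd t 3 = snd s2 3" using t(2)[of 2] t(2)[of 3] by (auto simp: fr5 s3_def a2)
    have gt: "graph_state G n q t"
      using gs by (subst graph_state_cong[of t s]) (auto simp: t fr5 s3_def f2 a2)
    define u0 where "u0 = cset 4 i (1 - of_bool (f i \<in> X)) t"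
    define K where "K j u \<longleftrightarrow> snd u 4 i = of_bool (f i \<notin> X \<and> (\<forall>u<j. \<not> dead u i)) \<and>
      (\<forall>v. v \<noteq> i \<longrightarrow> snd u 4 v = snd t 4 v) \<and>
      (fst u 16 = 0 \<longleftrightarrow> fst t 16 = 0 \<and> (\<forall>u<j. \<not> clash u i))" for j and u :: ram_state
    have "K (fst u0 2) (lrun (LFor 6 2 b4) u0)"
    proof (rule lrun_for[OF fr4(3)])
      show "K 0 (rset 6 0 u0)" by (simp add: K_def u0_def)
    next
      fix j u assume j: "j < fst u0 2" "fst u 6 = j"
        and u: "\<And>r. r \<notin> insert 6 (rwrites b4) \<Longrightarrow> fst u r = fst u0 r"
          "\<And>a. a \<notin> awrites b4 \<Longrightarrow> snd u a = snd u0 a" and Ku: "K j u"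
      have nj: "j < n" using j by (simp add: u0_def graph_stateD(1)[OF gt])
      have ua: "snd u 2 = snd s 2" "snd u 3 = snd s2 3" "fst u 5 = i"
        using u(2)[of 2] u(2)[of 3] u(1)[of 5] by (auto simp: fr4 u0_def ta i)
      have gu: "graph_state G n q u"
        using gt by (subst graph_state_cong[of u t]) (auto simp: u fr4 u0_def)
      have adj: "ram_val (adj_exp (Reg 6) (Reg 5)) u = 0 \<longleftrightarrow> {j, i} \<notin> gedges G"
        using graph_stateD(4)[OF gu, of "Reg 6" "Reg 5"] by (simp add: j ua nj ni)
      have val: "ram_val (Cell 2 (Reg 6)) u = f j" "ram_val (Cell 2 (Reg 5)) u = f i"
        "ram_val (Cell 3 (Cell 2 (Reg 6))) u = of_bool (f j \<in> X)"
        "ram_val (Cell 3 (Cell 2 (Reg 5))) u = of_bool (f i \<in> X)"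
        "ram_val (Reg 6) u = j" "ram_val (Reg 5) u = i"
        by (simp_all add: j ua f nj ni mark)
      have b4: "lrun b4 u = (if f j \<noteq> f i then
           if {j, i} \<in> gedges G \<and> f j \<in> X then
             if f i \<in> X then rset 16 1 (cset 4 i 0 u) else cset 4 i 0 u
           else u
         else if j \<noteq> i then cset 4 i 0 u else u)"
      proof -
        have cong: "ram_val (Cell 3 (Cell 2 (Reg 5))) (cset 4 i 0 u) = of_bool (f i \<in> X)"
          using val(4) by simp
        show ?thesis
          unfolding b4_def lrun.simps ram_val_neq_exp adj val cong
          by (simp del: ram_val.simps(2-3) add: val cong)
      qed
      \<comment> \<open>For equal labels the program tests only \<open>j \<noteq> i\<close>. The
        other disjunct needs \<open>f i \<in> X\<close>, and then \<open>i\<close> was excluded from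
        the outset.\<close>
      have d: "dead j i \<longleftrightarrow> (if f j \<noteq> f i then {j, i} \<in> gedges G \<and> f j \<in> X else j \<noteq> i \<or> {j, i} \<in> gedges G \<and> f i \<in> X)"
        by (auto simp: dead_def)
      have c: "clash j i \<longleftrightarrow> f j \<noteq> f i \<and> {j, i} \<in> gedges G \<and> f j \<in> X \<and> f i \<in> X"
        by (auto simp: clash_def)
      have all: "(\<forall>u<Suc j. Q u) \<longleftrightarrow> (\<forall>u<j. Q u) \<and> Q j" for Q by (auto simp: less_Suc_eq)
      show "K (Suc j) (rset 6 (Suc j) (lrun b4 u))"
        using Ku unfolding b4 K_def all d c by auto
    qed
    then have Kn: "K n (lrun (LFor 6 2 b4) u0)" by (simp add: u0_def graph_stateD(1)[OF gt])
    define w where "w = lrun (LFor 6 2 b4) u0"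
    have w: "fst w 5 = i" "fst w 17 = fst t 17" "snd w 3 = snd s2 3"
      unfolding w_def by (subst lrun_frame_reg lrun_frame_array; simp add: fr4 u0_def i ta)+
    have "lrun c4 t = rset 17 (fst t 17 + (of_bool (i \<in> X) + snd w 4 i)) w"
    proof -
      have "ram_val (Monus (Const 1) (Cell 3 (Cell 2 (Reg 5)))) t = 1 - of_bool (f i \<in> X)"
        by (simp add: i ta f ni mark)
      then have "lrun c4 t = lrun (LReg 17 (Add (Reg 17) (Add (Cell 3 (Reg 5)) (Cell 4 (Reg 5))))) w"
        unfolding c4_def lrun.simps(3,4) w_def u0_def using i by (simp del: lrun.simps(6))
      then show ?thesis by (simp add: w mark ni)
    qed
    moreover have ex: "(\<forall>v<Suc i. Q v) \<longleftrightarrow> (\<forall>v<i. Q v) \<and> Q i" for Q by (auto simp: less_Suc_eq)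
    moreover have cs: "card {v. v < Suc i \<and> Q v} = card {v. v < i \<and> Q v} + of_bool (Q i)" for Q
    proof -
      have "{v. v < Suc i \<and> Q v} = (if Q i then insert i {v. v < i \<and> Q v} else {v. v < i \<and> Q v})"
        by (auto simp: less_Suc_eq)
      then show ?thesis by simp
    qed
    moreover have "K n w" using Kn by (simp add: w_def)
    ultimately show "I (Suc i) (rset 5 (Suc i) (lrun c4 t))"
      using It unfolding I_def K_def ex cs by (auto simp: alive_def)
  qed
  then have In: "I n t" by (simp add: run s3_def f2 nn del: lrun.simps)
  show "{v. v < n \<and> snd t 4 v \<noteq> 0} = residual_vertices G f X"
    using In unfolding res I_def by (auto split: if_splits)
  show "fst t 16 = 0 \<longleftrightarrow> independent_labels G f X"
    using In XV unfolding I_def by (auto simp: independent_labels_def clash_def V)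
  have "{v. v < n \<and> v \<in> X} = X" using XV by auto
  then show "fst t 17 = card X + card (residual_vertices G f X)"
    using In unfolding res I_def by simp
qed

lemma check_prog_correct:
  assumes gs: "graph_state G n q s"
    and G: "simple_graph G" "bipartite_graph G" "gverts G = {..<n}"
    and f: "\<And>v. v < n \<Longrightarrow> snd s 2 v = f v" "\<And>v. v < n \<Longrightarrow> f v < n"
    and x: "\<And>i. i < q \<Longrightarrow> snd s 8 i < n"
    and m0: "fst s 10 + 2 * independence_number G = 2 * n"
  defines "X \<equiv> f ` snd s 8 ` {..<q}"
  shows "fst (lrun (check_prog d) s) 15 = 0 \<longleftrightarrow> fst s 15 = 0 \<or>
    \<not> (independent_labels G f X \<longrightarrow>
         card X + independence_number_on G (residual_vertices G f X) + d \<le> independence_number G)"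
proof -
  define s1 where "s1 = lrun residual_prog s"
  define s2 where "s2 = lrun matching_prog s1"
  note r = residual_prog_correct[OF gs G(3) f x, folded X_def s1_def]
  have gs1: "graph_state G n q s1" using gs by (simp add: s1_def graph_state_lrun)
  have m: "fst s2 18 + 2 * independence_number_on G (residual_vertices G f X) =
      2 * card (residual_vertices G f X)"
    using matching_prog_correct[OF gs1 G] by (simp add: r(1)[symmetric] s2_def)
  have fs: "fst s2 16 = fst s1 16" "fst s2 17 = fst s1 17" "fst s2 10 = fst s 10"
    "fst s2 2 = n" "fst s2 15 = fst s 15"
    using graph_stateD(1)[OF gs] by (simp_all add: s2_def s1_def lrun_frame_reg)
  have "lrun (check_prog d) s = (if fst s2 16 \<noteq> 0 then s2
     else if 2 * fst s2 17 + 2 * d + fst s2 10 - (2 * fst s2 2 + fst s2 18) \<noteq> 0 then rset 15 0 s2 else s2)"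
    by (simp add: check_prog_def s1_def[symmetric] s2_def[symmetric] mult_2)
  then show ?thesis using m m0 r(2,3) fs by (auto split: if_splits)
qed

text \<open>Registers \<open>13\<close> and \<open>14\<close> save both labels, since the
  relabelling pass overwrites array \<open>2\<close>, including the entry of the second
  endpoint.\<close>

definition merge_prog :: lprog where
  "merge_prog =
     LFor 5 2 (LCell 2 (Reg 5) (Reg 5)) ;;;
     LReg 12 (Const 0) ;;;
     LFor 6 4
       (LIf (adj_exp (Cell 7 (Reg 6)) (Cell 7 (Add (Reg 4) (Reg 6))))
         (LReg 12 (Add (Reg 12) (Const 1)) ;;;
          LReg 13 (Cell 2 (Cell 7 (Reg 6))) ;;;
          LReg 14 (Cell 2 (Cell 7 (Add (Reg 4) (Reg 6)))) ;;;
          LFor 5 2 (LIf (neq_exp (Cell 2 (Reg 5)) (Reg 14)) LSkip (LCell 2 (Reg 5) (Reg 13))))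
         LSkip)"

text \<open>Register \<open>15\<close> starts at \<open>1\<close> and is cleared by every guess that
  violates the bound. A negative \<open>k\<close> is rejected by its sign in register
  \<open>8\<close>, so that comparing with the absolute value is correct.\<close>

definition try_prog :: "nat \<Rightarrow> lprog" where
  "try_prog d =
     merge_prog ;;; LReg 15 (Const 1) ;;;
     nested 100 8 (2 * d + 1) (check_prog d) ;;;
     LIf (Reg 15)
       (LIf (Reg 8) LSkip (LIf (Monus (Reg 12) (Reg 9)) LSkip (LReg 11 (Const 1))))
       LSkip"

text \<open>The inner loops use the counters from \<open>100\<close> to \<open>100 + 2 * d\<close>,
  hence the outer ones start at \<open>101 + 2 * d\<close>. The matching of the whole graph is
  computed once, with all vertices remaining.\<close>

definition search_prog :: "nat \<Rightarrow> lprog" where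
  "search_prog d =
     LFor 5 2 (LCell 4 (Reg 5) (Const 1)) ;;; matching_prog ;;;
     LReg 10 (Reg 18) ;;; LReg 11 (Const 0) ;;;
     nested (101 + 2 * d) 7 (2 * (2 * d + 1)) (try_prog d)"

section \<open>Correctness of the search over edge sets\<close>

lemma merge_prog_frame [simp]:
  "rwrites merge_prog = {5, 6, 12, 13, 14}" "awrites merge_prog = {2}"
  "lbounds merge_prog = {2, 4}" "counters_safe merge_prog"
  by (auto simp: merge_prog_def)

lemma try_prog_frame:
  "rwrites (try_prog d) = {5, 6, 11, 12, 13, 14, 15, 16, 17, 18, 19, 20, 21, 22, 23, 24, 25, 26}
     \<union> {100..<101 + 2 * d}"
  "awrites (try_prog d) \<subseteq> {2, 3, 4, 5, 6, 8}"
  "lbounds (try_prog d) \<subseteq> {2, 3, 4}" "counters_safe (try_prog d)"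
proof -
  have "counters_safe (nested 100 8 (2 * d + 1) (check_prog d))"
    by (rule counters_safe_nested) simp_all
  then show "counters_safe (try_prog d)" by (simp add: try_prog_def)
  show "rwrites (try_prog d) = {5, 6, 11, 12, 13, 14, 15, 16, 17, 18, 19, 20, 21, 22, 23, 24, 25, 26}
     \<union> {100..<101 + 2 * d}"
    by (auto simp: try_prog_def nested_frame(1))
  show "awrites (try_prog d) \<subseteq> {2, 3, 4, 5, 6, 8}"
    using nested_frame(2)[of 100 8 "2 * d + 1" "check_prog d"] by (auto simp: try_prog_def)
  show "lbounds (try_prog d) \<subseteq> {2, 3, 4}"
    using nested_frame(3)[of 100 8 "2 * d + 1" "check_prog d"] by (auto simp: try_prog_def)
qed

lemma search_prog_frame:
  "rwrites (search_prog d) = {5, 6, 10, 11, 12, 13, 14, 15, 16, 17, 18, 19, 20, 21, 22, 23, 24, 25, 26}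
     \<union> {100..<103 + 6 * d}"
  "lbounds (search_prog d) \<subseteq> {2, 3, 4}" "counters_safe (search_prog d)"
proof -
  show "rwrites (search_prog d) = {5, 6, 10, 11, 12, 13, 14, 15, 16, 17, 18, 19, 20, 21, 22, 23, 24, 25, 26}
     \<union> {100..<103 + 6 * d}"
    by (auto simp: search_prog_def nested_frame(1) try_prog_frame(1))
  show "lbounds (search_prog d) \<subseteq> {2, 3, 4}"
    using nested_frame(3)[of "101 + 2 * d" 7 "2 * (2 * d + 1)" "try_prog d"] try_prog_frame(3)[of d]
    by (auto simp: search_prog_def)
  have "counters_safe (nested (101 + 2 * d) 7 (2 * (2 * d + 1)) (try_prog d))"
    by (rule counters_safe_nested[OF try_prog_frame(4)]) (auto simp: try_prog_frame(1))
  then show "counters_safe (search_prog d)" by (simp add: search_prog_def)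
qed

lemma merge_prog_correct:
  assumes gs: "graph_state G n q s" and G: "simple_graph G" "gverts G = {..<n}"
    and c: "\<And>i. i < 2 * q \<Longrightarrow> snd s 7 i < n"
  defines "t \<equiv> lrun merge_prog s"
  shows "\<forall>v<n. snd t 2 v = merged_labels G q (snd s 7) q v"
    and "fst t 12 = chosen_count G q (snd s 7) q"
proof -
  note nn = graph_stateD(1-3)[OF gs]
  let ?c = "snd s 7"
  define c1 where "c1 = LCell 2 (Reg 5) (Reg 5)"
  define s1 where "s1 = lrun (LFor 5 2 c1) s"
  define s2 where "s2 = rset 12 0 s1"
  define b where "b = LIf (neq_exp (Cell 2 (Reg 5)) (Reg 14)) LSkip (LCell 2 (Reg 5) (Reg 13))"
  define c3 where "c3 = LIf (adj_exp (Cell 7 (Reg 6)) (Cell 7 (Add (Reg 4) (Reg 6))))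
         (LReg 12 (Add (Reg 12) (Const 1)) ;;;
          LReg 13 (Cell 2 (Cell 7 (Reg 6))) ;;;
          LReg 14 (Cell 2 (Cell 7 (Add (Reg 4) (Reg 6)))) ;;;
          LFor 5 2 b)
         LSkip"
  have run: "t = lrun (LFor 6 4 c3) s2"
    by (simp add: t_def merge_prog_def s2_def s1_def c1_def c3_def b_def del: lrun.simps(6))
  have fr1: "rwrites c1 = {}" "awrites c1 = {2}" "counters_safe (LFor 5 2 c1)"
    by (auto simp: c1_def)
  have frb: "rwrites b = {}" "awrites b = {2}" "counters_safe (LFor 5 2 b)"
    by (auto simp: b_def)
  have fr3: "rwrites c3 = {5, 12, 13, 14}" "awrites c3 = {2}" "counters_safe (LFor 6 4 c3)"
    using frb by (auto simp: c3_def)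
  have z1: "\<forall>r<fst s 2. snd s1 2 r = r"
    unfolding s1_def
    by (rule lrun_for[OF fr1(3), where I = "\<lambda>i t. \<forall>r<i. snd t 2 r = r"])
      (auto simp: c1_def less_Suc_eq)
  have f1: "fst s1 r = fst s r" if "r \<noteq> 5" for r
    unfolding s1_def using that by (intro lrun_frame_reg) (simp add: fr1)
  have a1: "snd s1 a = snd s a" if "a \<noteq> 2" for a
    unfolding s1_def using that by (intro lrun_frame_array) (simp add: fr1)
  define I where "I j t \<longleftrightarrow> (\<forall>v<n. snd t 2 v = merged_labels G q ?c j v) \<and>
    fst t 12 = chosen_count G q ?c j" for j and t :: ram_state
  have "I (fst s2 4) (lrun (LFor 6 4 c3) s2)"
  proof (rule lrun_for[OF fr3(3)])
    show "I 0 (rset 6 0 s2)" using z1 by (simp add: I_def s2_def nn chosen_count_def)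
  next
    fix j t assume j: "j < fst s2 4" "fst t 6 = j"
      and t: "\<And>r. r \<notin> insert 6 (rwrites c3) \<Longrightarrow> fst t r = fst s2 r"
        "\<And>a. a \<notin> awrites c3 \<Longrightarrow> snd t a = snd s2 a" and I: "I j t"
    have jq: "j < q" using j by (simp add: s2_def f1 nn)
    have gt: "graph_state G n q t"
      using gs by (subst graph_state_cong[of t s]) (auto simp: t fr3 s2_def f1 a1)
    have t7: "snd t 7 = ?c" "fst t 4 = q" by (simp_all add: t fr3 s2_def f1 a1 nn)
    have cn: "?c j < n" "?c (q + j) < n" using c jq by auto
    have adj: "ram_val (adj_exp (Cell 7 (Reg 6)) (Cell 7 (Add (Reg 4) (Reg 6)))) t = 0 \<longleftrightarrow>
        {?c j, ?c (q + j)} \<notin> gedges G"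
      using graph_stateD(4)[OF gt, of "Cell 7 (Reg 6)" "Cell 7 (Add (Reg 4) (Reg 6))"] cn
      by (simp add: j t7)
    have cc: "chosen_count G q ?c (Suc j) =
        chosen_count G q ?c j + of_bool ({?c j, ?c (q + j)} \<in> gedges G)"
    proof -
      have "{i. i < Suc j \<and> {?c i, ?c (q + i)} \<in> gedges G} =
          (if {?c j, ?c (q + j)} \<in> gedges G then insert j {i. i < j \<and> {?c i, ?c (q + i)} \<in> gedges G}
           else {i. i < j \<and> {?c i, ?c (q + i)} \<in> gedges G})"
        by (auto simp: less_Suc_eq)
      then show ?thesis by (simp add: chosen_count_def)
    qed
    show "I (Suc j) (rset 6 (Suc j) (lrun c3 t))"
    proof (cases "{?c j, ?c (q + j)} \<in> gedges G")
      case False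
      then have "lrun c3 t = t" using adj by (simp add: c3_def)
      then show ?thesis using I False by (simp add: I_def cc)
    next
      case True
      define f where "f = merged_labels G q ?c j"
      define a where "a = f (?c j)"
      define e where "e = f (?c (q + j))"
      have vals: "snd t 2 v = f v" if "v < n" for v using I that by (simp add: I_def f_def)
      define u where "u = rset 14 e (rset 13 a (rset 12 (Suc (fst t 12)) t))"
      have run: "lrun c3 t = lrun (LFor 5 2 b) u"
        using True adj cn unfolding c3_def
        by (simp add: u_def a_def e_def vals t7 j del: lrun.simps(6))
      have u2: "fst u 2 = n" by (simp add: u_def graph_stateD(1)[OF gt])
      have "\<forall>v<n. snd (lrun (LFor 5 2 b) u) 2 v = (if v < fst u 2 \<and> f v = e then a else f v)"
      proof (rule lrun_for[OF frb(3), where I = "\<lambda>i w. \<forall>v<n. snd w 2 v = (if v < i \<and> f v = e then a else f v)"])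
        show "\<forall>v<n. snd (rset 5 0 u) 2 v = (if v < 0 \<and> f v = e then a else f v)"
          by (simp add: u_def vals)
      next
        fix i and w :: ram_state assume i: "i < fst u 2" "fst w 5 = i"
          and w: "\<And>r. r \<notin> insert 5 (rwrites b) \<Longrightarrow> fst w r = fst u r"
          and K: "\<forall>v<n. snd w 2 v = (if v < i \<and> f v = e then a else f v)"
        have "fst w 14 = e" "fst w 13 = a" by (simp_all add: w frb u_def)
        moreover have "snd w 2 i = f i" using K i u2 by simp
        ultimately have "lrun b w = (if f i = e then cset 2 i a w else w)"
          by (simp add: b_def i)
        then show "\<forall>v<n. snd (rset 5 (Suc i) (lrun b w)) 2 v = (if v < Suc i \<and> f v = e then a else f v)"
          using K by (auto simp: less_Suc_eq)
      qed
      moreover have "merged_labels G q ?c (Suc j) = (\<lambda>v. if f v = e then a else f v)"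
        unfolding merged_labels.simps Let_def f_def[symmetric] e_def a_def using True by simp
      moreover have "fst (lrun (LFor 5 2 b) u) 12 = Suc (fst t 12)"
        by (subst lrun_frame_reg) (simp_all add: frb u_def)
      ultimately show ?thesis using I True u2 unfolding I_def run cc
        by (simp del: lrun.simps merged_labels.simps)
    qed
  qed
  then have "I q t" by (simp add: run s2_def f1 nn del: lrun.simps)
  then show "\<forall>v<n. snd t 2 v = merged_labels G q ?c q v" "fst t 12 = chosen_count G q ?c q"
    by (auto simp: I_def)
qed

definition blocks :: "nat ugraph \<Rightarrow> nat \<Rightarrow> nat \<Rightarrow> nat \<Rightarrow> (nat \<Rightarrow> nat) \<Rightarrow> bool" where
  "blocks G n q d f \<longleftrightarrow> (\<forall>x. (\<forall>i<q. x i < n) \<longrightarrow>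
     (let X = f ` x ` {..<q}
      in independent_labels G f X \<longrightarrow>
         card X + independence_number_on G (residual_vertices G f X) + d \<le> independence_number G))"

lemma merged_labels_cong:
  "(\<And>i. i < 2 * q \<Longrightarrow> c i = c' i) \<Longrightarrow> j \<le> q \<Longrightarrow> merged_labels G q c j = merged_labels G q c' j"
  by (induction j) (simp_all add: Let_def cong del: if_weak_cong)

lemma chosen_count_cong:
  assumes "\<And>i. i < 2 * q \<Longrightarrow> c i = c' i"
  shows "chosen_count G q c q = chosen_count G q c' q"
  unfolding chosen_count_def using assms by (intro arg_cong[where f = card] Collect_cong) auto

lemma try_prog_correct:
  assumes gs: "graph_state G n (2 * d + 1) s"
    and G: "simple_graph G" "bipartite_graph G" "gverts G = {..<n}"
    and c: "\<And>i. i < 2 * (2 * d + 1) \<Longrightarrow> snd s 7 i < n"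
    and m0: "fst s 10 + 2 * independence_number G = 2 * n"
  shows "0 < fst (lrun (try_prog d) s) 11 \<longleftrightarrow> 0 < fst s 11 \<or>
    fst s 8 = 0 \<and> chosen_count G (2 * d + 1) (snd s 7) (2 * d + 1) \<le> fst s 9 \<and>
    blocks G n (2 * d + 1) d (merged_labels G (2 * d + 1) (snd s 7) (2 * d + 1))"
proof -
  define q where "q = 2 * d + 1"
  define f where "f = merged_labels G q (snd s 7) q"
  define s1 where "s1 = rset 15 1 (lrun merge_prog s)"
  note m = merge_prog_correct[OF gs[folded q_def] G(1,3) c[folded q_def], folded f_def]
  have f: "f v < n" if "v < n" for v
    using merged_labels_props(1)[OF G(1), where c = "snd s 7" and q = q and j = q] c[folded q_def] that
    by (simp add: G(3) f_def)
  define C where "C t \<longleftrightarrow> graph_state G n q t \<and> fst t 10 + 2 * independence_number G = 2 * n \<and>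
    (\<forall>v<n. snd t 2 v = f v)" for t :: ram_state
  define P where "P x \<longleftrightarrow> \<not> (independent_labels G f (f ` x ` {..<q}) \<longrightarrow>
    card (f ` x ` {..<q}) + independence_number_on G (residual_vertices G f (f ` x ` {..<q})) + d
      \<le> independence_number G)" for x :: "nat \<Rightarrow> nat"
  define s2 where "s2 = lrun (nested 100 8 q (check_prog d)) s1"
  have "C s2 \<and> (fst s2 15 = 0 \<longleftrightarrow> fst s1 15 = 0 \<or> (\<exists>y. (\<forall>i<q. y i < n) \<and> P y))"
    unfolding s2_def
  \<comment> \<open>With the test for zero as \<open>A\<close>, register \<open>15\<close> ends up
    cleared iff some tuple is a counterexample.\<close>
  proof (rule nested_correct[where A = "\<lambda>x. x = 0"])
    show "100 + i \<notin> rwrites (check_prog d)" if "i < q" for i by simp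
    show "C (rset r x t)" if "100 \<le> r" "C t" for t r x
      using that unfolding C_def by (subst graph_state_cong[of "rset r x t" t]) auto
    show "C (cset 8 i x t)" if "C t" for t i x
      using that unfolding C_def by (subst graph_state_cong[of "cset 8 i x t" t]) auto
    show "C (lrun (check_prog d) t) \<and>
        (fst (lrun (check_prog d) t) 15 = 0 \<longleftrightarrow> fst t 15 = 0 \<or> P (snd t 8))"
      if t: "C t" "\<And>i. i < q \<Longrightarrow> snd t 8 i < n" for t
    proof
      show "C (lrun (check_prog d) t)"
        using t(1) by (simp add: C_def graph_state_lrun lrun_frame_reg lrun_frame_array)
      have tC: "graph_state G n q t" "\<And>v. v < n \<Longrightarrow> snd t 2 v = f v"
        "fst t 10 + 2 * independence_number G = 2 * n" using t(1) by (simp_all add: C_def)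
      show "fst (lrun (check_prog d) t) 15 = 0 \<longleftrightarrow> fst t 15 = 0 \<or> P (snd t 8)"
        unfolding P_def by (rule check_prog_correct[OF tC(1) G tC(2) f t(2) tC(3)])
    qed
    show "P g = P h" if "\<And>i. i < q \<Longrightarrow> g i = h i" for g h
    proof -
      have "g ` {..<q} = h ` {..<q}" using that by (intro image_cong) auto
      then show ?thesis by (simp add: P_def)
    qed
    have "graph_state G n q s1 \<longleftrightarrow> graph_state G n q s"
      by (rule graph_state_cong) (auto simp: s1_def lrun_frame_reg lrun_frame_array)
    then show "C s1"
      using gs[folded q_def] m m0 by (simp add: C_def s1_def lrun_frame_reg)
  qed (auto simp: C_def dest: graph_stateD(1))
  then have 15: "fst s2 15 \<noteq> 0 \<longleftrightarrow> blocks G n q d f"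
    by (auto simp: s1_def blocks_def P_def Let_def)
  have fs: "fst s2 r = fst s1 r" if "r \<in> {8, 9, 11, 12}" for r
    unfolding s2_def using that by (intro lrun_frame_reg) (auto simp: nested_frame(1))
  have "lrun (try_prog d) s = (if fst s2 15 \<noteq> 0 \<and> fst s2 8 = 0 \<and> fst s2 12 \<le> fst s2 9
     then rset 11 1 s2 else s2)"
    unfolding try_prog_def lrun.simps q_def[symmetric] by (simp add: s1_def s2_def)
  then show ?thesis
    unfolding q_def[symmetric] f_def[symmetric]
    using 15 m(2) by (simp add: fs s1_def lrun_frame_reg) auto
qed

lemma search_prog_correct:
  assumes gs: "graph_state G n (2 * d + 1) s"
    and G: "simple_graph G" "bipartite_graph G" "connected_graph G" "gverts G = {..<n}"
    and k: "fst s 8 = 0 \<longleftrightarrow> 0 \<le> k" "fst s 9 = nat \<bar>k\<bar>"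
  shows "fst (lrun (search_prog d) s) 11 \<noteq> 0 \<longleftrightarrow> contraction_blocker_alpha d (G, k)"
proof -
  define q where "q = 2 * d + 1"
  note gs = gs[folded q_def]
  define c1 where "c1 = LCell 4 (Reg 5) (Const 1)"
  define s1 where "s1 = lrun (LFor 5 2 c1) s"
  define s2 where "s2 = lrun matching_prog s1"
  define s3 where "s3 = rset 11 0 (rset 10 (fst s2 18) s2)"
  define s4 where "s4 = lrun (nested (101 + 2 * d) 7 (2 * q) (try_prog d)) s3"
  have run: "lrun (search_prog d) s = s4"
    by (simp add: search_prog_def s4_def s3_def s2_def s1_def c1_def q_def del: lrun.simps(6) nested.simps)
  have fr1: "rwrites c1 = {}" "awrites c1 = {4}" "counters_safe (LFor 5 2 c1)"
    by (auto simp: c1_def)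
  have z1: "\<forall>r<fst s 2. snd s1 4 r = 1"
    unfolding s1_def
    by (rule lrun_for[OF fr1(3), where I = "\<lambda>i t. \<forall>r<i. snd t 4 r = 1"])
      (auto simp: c1_def less_Suc_eq)
  have f1: "fst s1 r = fst s r" if "r \<noteq> 5" for r
    unfolding s1_def using that by (intro lrun_frame_reg) (simp add: fr1)
  have a1: "snd s1 a = snd s a" if "a \<noteq> 4" for a
    unfolding s1_def using that by (intro lrun_frame_array) (simp add: fr1)
  have gs1: "graph_state G n q s1"
    using gs by (subst graph_state_cong[of s1 s]) (auto simp: f1 a1)
  have "{v. v < n \<and> snd s1 4 v \<noteq> 0} = gverts G"
    using z1 graph_stateD(1)[OF gs] G(4) by auto
  then have m0: "fst s2 18 + 2 * independence_number G = 2 * n"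
    using matching_prog_correct[OF gs1 G(1,2,4)] G(4)
    by (simp add: s2_def independence_number_on_gverts[symmetric])
  have gs3: "graph_state G n q s3"
    using gs1 by (subst graph_state_cong[of s3 s1]) (auto simp: s3_def s2_def lrun_frame_reg lrun_frame_array)
  have k3: "fst s3 8 = fst s 8" "fst s3 9 = fst s 9"
    by (simp_all add: s3_def s2_def lrun_frame_reg f1)
  define C where "C t \<longleftrightarrow> graph_state G n q t \<and> fst t 10 + 2 * independence_number G = 2 * n \<and>
    fst t 8 = fst s 8 \<and> fst t 9 = fst s 9" for t :: ram_state
  define P where "P c \<longleftrightarrow> fst s 8 = 0 \<and> chosen_count G q c q \<le> fst s 9 \<and>
    blocks G n q d (merged_labels G q c q)" for c
  have "C s4 \<and> (0 < fst s4 11 \<longleftrightarrow> 0 < fst s3 11 \<or> (\<exists>y. (\<forall>i<2*q. y i < n) \<and> P y))"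
    unfolding s4_def
  proof (rule nested_correct[where A = "\<lambda>x. 0 < x"])
    show "counters_safe (try_prog d)" by (rule try_prog_frame)
    show "7 \<notin> awrites (try_prog d)" using try_prog_frame(2)[of d] by auto
    show "101 + 2 * d + i \<notin> rwrites (try_prog d)" if "i < 2 * q" for i
      by (auto simp: try_prog_frame(1))
    show "C (rset r x t)" if "101 + 2 * d \<le> r" "C t" for t r x
      using that unfolding C_def by (subst graph_state_cong[of "rset r x t" t]) auto
    show "C (cset 7 i x t)" if "C t" for t i x
      using that unfolding C_def by (subst graph_state_cong[of "cset 7 i x t" t]) auto
    show "C (lrun (try_prog d) t) \<and>
        (0 < fst (lrun (try_prog d) t) 11 \<longleftrightarrow> 0 < fst t 11 \<or> P (snd t 7))"
      if t: "C t" "\<And>i. i < 2 * q \<Longrightarrow> snd t 7 i < n" for t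
    proof
      have "graph_state G n q (lrun (try_prog d) t) \<longleftrightarrow> graph_state G n q t"
        using try_prog_frame(2)[of d] by (intro graph_state_lrun) (auto simp: try_prog_frame(1))
      then show "C (lrun (try_prog d) t)"
        using t(1) by (simp add: C_def lrun_frame_reg try_prog_frame(1))
      have tC: "graph_state G n q t" "fst t 8 = fst s 8" "fst t 9 = fst s 9"
        "fst t 10 + 2 * independence_number G = 2 * n" using t(1) by (simp_all add: C_def)
      show "0 < fst (lrun (try_prog d) t) 11 \<longleftrightarrow> 0 < fst t 11 \<or> P (snd t 7)"
        using try_prog_correct[OF tC(1)[unfolded q_def] G(1,2,4) t(2)[unfolded q_def] tC(4)]
        by (simp add: P_def q_def tC)
    qed
    show "P g = P h" if "\<And>i. i < 2 * q \<Longrightarrow> g i = h i" for g h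
      using merged_labels_cong[of q g h q G] chosen_count_cong[of q g h G] that by (simp add: P_def)
    show "C s3" using gs3 m0 k3 by (simp add: C_def) (simp add: s3_def)
  qed (auto simp: C_def dest: graph_stateD(1))
  then have "fst s4 11 \<noteq> 0 \<longleftrightarrow> (\<exists>c. (\<forall>i<2*q. c i < n) \<and> P c)"
    by (simp add: s3_def)
  moreover have "P c \<longleftrightarrow> int (chosen_count G q c q) \<le> k \<and> blocks G n q d (merged_labels G q c q)" for c
    using k by (auto simp: P_def)
  ultimately show ?thesis
    unfolding run contraction_blocker_alpha_iff_search[OF G(1-4) q_def]
    by (simp add: blocks_def Let_def)
qed

section \<open>Reading the input\<close>

text \<open>Register \<open>27\<close> is raised at the first zero bit, so that only the unary
  prefix is counted.\<close>

definition size_prog :: "nat \<Rightarrow> lprog" where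
  "size_prog q =
     LFor 5 0
       (LIf (Cell 0 (Reg 5))
         (LIf (Reg 27) LSkip (LReg 2 (Add (Reg 2) (Const 1))))
         (LReg 27 (Const 1))) ;;;
     LReg 3 (Add (Reg 2) (Const 2)) ;;; LReg 4 (Const q)"

text \<open>The matrix begins behind the \<open>n\<close> ones and the separator, hence the offset
  \<open>n + 1\<close>. After the last row, register \<open>7\<close> points to the sign.\<close>

definition rows_prog :: lprog where
  "rows_prog =
     LReg 7 (Add (Reg 2) (Const 1)) ;;;
     LFor 5 2 (LCell 9 (Reg 5) (Reg 7) ;;; LReg 7 (Add (Reg 7) (Reg 2)))"

text \<open>Horner's scheme starting from the last bit, the most significant one, with doubling by
  addition. Positions up to the sign are skipped, so the length of the whole word can serve as loop
  bound.\<close>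

definition number_prog :: lprog where
  "number_prog =
     LReg 8 (Cell 0 (Reg 7)) ;;;
     LFor 5 0
       (LReg 13 (Monus (Reg 0) (Add (Reg 5) (Const 1))) ;;;
        LIf (Monus (Reg 13) (Reg 7))
          (LReg 9 (Add (Add (Reg 9) (Reg 9)) (Cell 0 (Reg 13))))
          LSkip)"

section \<open>Decoding the input word\<close>

lemma size_prog_frame [simp]:
  "rwrites (size_prog q) = {2, 3, 4, 5, 27}" "awrites (size_prog q) = {}" "lbounds (size_prog q) = {0}"
  "counters_safe (size_prog q)"
  by (auto simp: size_prog_def)

lemma rows_prog_frame [simp]:
  "rwrites rows_prog = {5, 7}" "awrites rows_prog = {9}" "lbounds rows_prog = {2}"
  "counters_safe rows_prog"
  by (auto simp: rows_prog_def)

lemma number_prog_frame [simp]: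
  "rwrites number_prog = {5, 8, 9, 13}" "awrites number_prog = {}" "lbounds number_prog = {0}"
  "counters_safe number_prog"
  by (auto simp: number_prog_def)

lemma size_prog_correct:
  assumes w: "w = replicate n True @ False # w'"
  shows "fst (lrun (size_prog q) (ram_init w)) 2 = n"
proof -
  define c where "c = LIf (Cell 0 (Reg 5))
         (LIf (Reg 27) LSkip (LReg 2 (Add (Reg 2) (Const 1))))
         (LReg 27 (Const 1))"
  have fr: "rwrites c = {2, 27}" "awrites c = {}" "counters_safe (LFor 5 0 c)" by (auto simp: c_def)
  define I where "I i t \<longleftrightarrow> fst t 2 = min i n \<and> (fst t 27 = 0 \<longleftrightarrow> i \<le> n)" for i and t :: ram_state
  have "I (fst (ram_init w) 0) (lrun (LFor 5 0 c) (ram_init w))"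
  proof (rule lrun_for[OF fr(3)])
    show "I 0 (rset 5 0 (ram_init w))" by (simp add: I_def ram_init_def)
  next
    fix i t assume i: "i < fst (ram_init w) 0" "fst t 5 = i"
      and t: "\<And>a. a \<notin> awrites c \<Longrightarrow> snd t a = snd (ram_init w) a" and I: "I i t"
    have "snd t 0 i = of_bool (w ! i)" using i t[of 0] by (simp add: fr ram_init_def)
    then have run: "lrun c t = (if w ! i then if fst t 27 \<noteq> 0 then t else rset 2 (Suc (fst t 2)) t
        else rset 27 1 t)"
      by (simp add: c_def i)
    have "i < n \<Longrightarrow> w ! i" "i = n \<Longrightarrow> \<not> w ! i" by (auto simp: w nth_append)
    then show "I (Suc i) (rset 5 (Suc i) (lrun c t))"
      using I unfolding run I_def by (cases "i < n"; cases "i = n") (auto simp: min_def)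
  qed
  then have "fst (lrun (LFor 5 0 c) (ram_init w)) 2 = min (length w) n"
    by (simp add: I_def ram_init_def del: lrun.simps)
  then show ?thesis by (simp add: size_prog_def c_def w del: lrun.simps(6))
qed

lemma rows_prog_correct:
  assumes "fst s 2 = n"
  shows "fst (lrun rows_prog s) 7 = n + 1 + n * n"
    and "\<And>i. i < n \<Longrightarrow> snd (lrun rows_prog s) 9 i = n + 1 + i * n"
proof -
  define c where "c = LCell 9 (Reg 5) (Reg 7) ;;; LReg 7 (Add (Reg 7) (Reg 2))"
  define s1 where "s1 = rset 7 (n + 1) s"
  have fr: "rwrites c = {7}" "awrites c = {9}" "counters_safe (LFor 5 2 c)" by (auto simp: c_def)
  define I where "I i t \<longleftrightarrow> fst t 7 = n + 1 + i * n \<and> (\<forall>j<i. snd t 9 j = n + 1 + j * n)"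
    for i and t :: ram_state
  have "I (fst s1 2) (lrun (LFor 5 2 c) s1)"
  proof (rule lrun_for[OF fr(3)])
    show "I 0 (rset 5 0 s1)" by (simp add: I_def s1_def)
  next
    fix i t assume i: "fst t 5 = i"
      and t: "\<And>r. r \<notin> insert 5 (rwrites c) \<Longrightarrow> fst t r = fst s1 r" and I: "I i t"
    have "fst t 2 = n" using t[of 2] assms by (simp add: fr s1_def)
    then show "I (Suc i) (rset 5 (Suc i) (lrun c t))"
      using I i by (auto simp: I_def c_def less_Suc_eq)
  qed
  moreover have "lrun rows_prog s = lrun (LFor 5 2 c) s1"
    by (simp add: rows_prog_def c_def s1_def assms del: lrun.simps(6))
  ultimately have I: "I n (lrun rows_prog s)" by (simp add: s1_def assms)
  show "fst (lrun rows_prog s) 7 = n + 1 + n * n" using I by (simp add: I_def)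
  show "\<And>i. i < n \<Longrightarrow> snd (lrun rows_prog s) 9 i = n + 1 + i * n" using I by (simp add: I_def)
qed

fun binary_value :: "bool list \<Rightarrow> nat" where
  "binary_value [] = 0"
| "binary_value (b # bs) = of_bool b + 2 * binary_value bs"

lemma binary_value_binary: "binary_value (binary n) = n"
proof (induction n rule: binary.induct)
  case (1 n)
  show ?case
  proof (cases "n = 0")
    case False
    then show ?thesis using 1 by (subst binary.simps) (auto simp: odd_iff_mod_2_eq_one)
  qed (simp add: binary.simps)
qed

lemma number_prog_correct:
  assumes s: "fst s 0 = length w" "\<And>i. i < length w \<Longrightarrow> snd s 0 i = of_bool (w ! i)"
    and w: "w = u @ b # v" "length u = fst s 7" and z: "fst s 9 = 0"
  shows "fst (lrun number_prog s) 8 = of_bool b" "fst (lrun number_prog s) 9 = binary_value v"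
proof -
  define l where "l = length w"
  define p where "p = fst s 7"
  have pl: "p < l" using w by (simp add: l_def p_def)
  define c where "c = LReg 13 (Monus (Reg 0) (Add (Reg 5) (Const 1))) ;;;
        LIf (Monus (Reg 13) (Reg 7))
          (LReg 9 (Add (Add (Reg 9) (Reg 9)) (Cell 0 (Reg 13))))
          LSkip"
  define s1 where "s1 = rset 8 (of_bool b) s"
  have fr: "rwrites c = {9, 13}" "awrites c = {}" "counters_safe (LFor 5 0 c)" by (auto simp: c_def)
  have "snd s 0 (fst s 7) = of_bool b"
    using s(2)[of p] pl w by (simp add: p_def l_def nth_append)
  then have run: "lrun number_prog s = lrun (LFor 5 0 c) s1"
    by (simp add: number_prog_def c_def s1_def del: lrun.simps(6))
  show "fst (lrun number_prog s) 8 = of_bool b"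
    unfolding run by (subst lrun_frame_reg) (simp_all add: fr s1_def)
  \<comment> \<open>After \<open>i\<close> rounds the last \<open>i\<close> bits have been read, of
    which only those behind the sign at position \<open>p\<close> count.\<close>
  define I where "I i t \<longleftrightarrow> fst t 9 = binary_value (drop (max (Suc p) (l - i)) w)" for i and t :: ram_state
  have "I (fst s1 0) (lrun (LFor 5 0 c) s1)"
  proof (rule lrun_for[OF fr(3)])
    show "I 0 (rset 5 0 s1)" using pl z by (simp add: I_def s1_def l_def)
  next
    fix i t assume i: "i < fst s1 0" "fst t 5 = i"
      and t: "\<And>r. r \<notin> insert 5 (rwrites c) \<Longrightarrow> fst t r = fst s1 r"
        "\<And>a. a \<notin> awrites c \<Longrightarrow> snd t a = snd s1 a" and I: "I i t"
    have il: "i < l" using i by (simp add: s1_def s l_def)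
    have tv: "fst t 0 = l" "fst t 7 = p" "snd t 0 = snd s 0"
      by (simp_all add: t fr s1_def s l_def p_def)
    define j where "j = l - Suc i"
    have j: "j < l" "l - i = Suc j" using il by (auto simp: j_def)
    have val: "snd s 0 j = of_bool (w ! j)" using s(2)[of j] j by (simp add: l_def)
    have run: "lrun c t = (if p < j then rset 9 (2 * fst t 9 + of_bool (w ! j)) (rset 13 j t)
        else rset 13 j t)"
      using val by (simp add: c_def tv i j_def[symmetric] mult_2)
    show "I (Suc i) (rset 5 (Suc i) (lrun c t))"
    proof (cases "p < j")
      case True
      then have "max (Suc p) (l - i) = Suc j" "max (Suc p) (l - Suc i) = j"
        using j by (auto simp: j_def[symmetric])
      moreover have "drop j w = w ! j # drop (Suc j) w"
        using j by (simp add: Cons_nth_drop_Suc l_def)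
      ultimately show ?thesis using I True unfolding run I_def by simp
    next
      case False
      then have "max (Suc p) (l - i) = Suc p" "max (Suc p) (l - Suc i) = Suc p"
        using j by (auto simp: j_def[symmetric])
      then show ?thesis using I False unfolding run I_def by simp
    qed
  qed
  moreover have "fst s1 0 = l" by (simp add: s1_def s l_def)
  ultimately have "fst (lrun number_prog s) 9 = binary_value (drop (Suc p) w)"
    unfolding run I_def by simp
  then show "fst (lrun number_prog s) 9 = binary_value v" using w by (simp add: p_def)
qed

lemma nth_concat_rows:
  assumes "i < m" "j < n"
  shows "concat (map (\<lambda>i. map (f i) [0..<n]) [0..<m]) ! (i * n + j) = f i j"
  using assms
proof (induction m)
  case (Suc m)
  have len: "length (concat (map (\<lambda>i. map (f i) [0..<n]) [0..<m])) = m * n"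
    by (simp add: length_concat comp_def sum_list_triv)
  show ?case
  proof (cases "i < m")
    case True
    have "i * n + j < Suc i * n" using Suc.prems by simp
    also have "\<dots> \<le> m * n" using True by (intro mult_right_mono) auto
    finally show ?thesis using Suc True by (simp add: nth_append len)
  next
    case False
    then have "i = m" using Suc.prems by simp
    then show ?thesis using Suc.prems by (simp add: nth_append len)
  qed
qed simp

lemma encode_instance_layout:
  assumes "gverts G = {..<n}"
  obtains M where "encode_instance (G, k) = replicate n True @ False # M @ (k < 0) # binary (nat \<bar>k\<bar>)"
    "length M = n * n" "\<And>i j. i < n \<Longrightarrow> j < n \<Longrightarrow> M ! (i * n + j) \<longleftrightarrow> {i, j} \<in> gedges G"
proof
  let ?M = "concat (map (\<lambda>i. map (\<lambda>j. {i, j} \<in> gedges G) [0..<n]) [0..<n])"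
  show "encode_instance (G, k) = replicate n True @ False # ?M @ (k < 0) # binary (nat \<bar>k\<bar>)"
    using assms by (simp add: encode_instance_def)
  show "length ?M = n * n" by (simp add: length_concat comp_def sum_list_triv)
  show "?M ! (i * n + j) \<longleftrightarrow> {i, j} \<in> gedges G" if "i < n" "j < n" for i j
    using that by (rule nth_concat_rows)
qed

text \<open>Separated from \<open>size_prog\<close> because the time bound asks for loop bounds that
  a program never writes: registers \<open>2\<close>, \<open>3\<close> and \<open>4\<close> are
  computed there and only read here. For the same reason the answer stays in register
  \<open>11\<close>; register \<open>0\<close> is still a loop bound.\<close>

definition solve_prog :: "nat \<Rightarrow> lprog" where
  "solve_prog d = rows_prog ;;; number_prog ;;; search_prog d"

lemma solve_prog_frame:
  "0 \<notin> rwrites (solve_prog d)" "lbounds (solve_prog d) \<subseteq> {0, 2, 3, 4}" "counters_safe (solve_prog d)"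
  "lbounds (solve_prog d) \<inter> rwrites (solve_prog d) = {}"
proof -
  have disj: "{0, 2, 3, 4} \<inter> rwrites (solve_prog d) = {}"
    by (simp add: solve_prog_def search_prog_frame(1))
  then show "0 \<notin> rwrites (solve_prog d)" by blast
  show sub: "lbounds (solve_prog d) \<subseteq> {0, 2, 3, 4}"
    using search_prog_frame(2)[of d] by (simp add: solve_prog_def) blast
  show "counters_safe (solve_prog d)" by (simp add: solve_prog_def search_prog_frame(3))
  show "lbounds (solve_prog d) \<inter> rwrites (solve_prog d) = {}"
    using disj sub by blast
qed

lemma solve_prog_correct:
  fixes G :: "nat ugraph" and k :: int and n d :: nat
  assumes G: "simple_graph G" "bipartite_graph G" "connected_graph G" "gverts G = {..<n}"
  defines "w \<equiv> encode_instance (G, k)"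
  defines "s \<equiv> lrun (size_prog (2 * d + 1)) (ram_init w)"
  shows "fst s 0 = length w" "fst s 2 = n" "fst s 3 = n + 2" "fst s 4 = 2 * d + 1" "fst s 3 \<le> fst s 0"
    and "fst (lrun (solve_prog d) s) 11 \<noteq> 0 \<longleftrightarrow> contraction_blocker_alpha d (G, k)"
proof -
  obtain M where w: "w = replicate n True @ False # M @ (k < 0) # binary (nat \<bar>k\<bar>)"
    and M: "length M = n * n" "\<And>i j. i < n \<Longrightarrow> j < n \<Longrightarrow> M ! (i * n + j) \<longleftrightarrow> {i, j} \<in> gedges G"
    using encode_instance_layout[OF G(4), of k] unfolding w_def by metis
  show s2: "fst s 2 = n" unfolding s_def by (rule size_prog_correct[OF w])
  show s0: "fst s 0 = length w"
    unfolding s_def by (subst lrun_frame_reg) (simp_all add: ram_init_def)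
  show s34: "fst s 3 = n + 2" "fst s 4 = 2 * d + 1"
    using s2 by (simp_all add: s_def size_prog_def)
  \<comment> \<open>The word contains \<open>n\<close> ones, the separator and the sign, hence at
    least \<open>n + 2\<close> bits.\<close>
  show "fst s 3 \<le> fst s 0" by (simp add: w s0 s34)
  have s9: "fst s 9 = 0" unfolding s_def by (subst lrun_frame_reg) (simp_all add: ram_init_def)
  have bits: "snd s 0 i = of_bool (w ! i)" if "i < length w" for i
    unfolding s_def using that by (subst lrun_frame_array) (simp_all add: ram_init_def)
  define s1 where "s1 = lrun rows_prog s"
  note r = rows_prog_correct[OF s2, folded s1_def]
  have s1: "fst s1 0 = length w" "fst s1 9 = 0" "snd s1 0 = snd s 0" "fst s1 2 = n" "fst s1 3 = n + 2"
    "fst s1 4 = 2 * d + 1"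
    using s0 s9 s2 s34 by (simp_all add: s1_def lrun_frame_reg lrun_frame_array)
  define s2 where "s2 = lrun number_prog s1"
  have w': "w = (replicate n True @ False # M) @ (k < 0) # binary (nat \<bar>k\<bar>)" by (simp add: w)
  have num: "fst s2 8 = of_bool (k < 0)" "fst s2 9 = nat \<bar>k\<bar>"
    using number_prog_correct[of s1 w, OF s1(1) _ w' _ s1(2)] bits s1(3) r(1) M(1)
    by (simp_all add: s2_def binary_value_binary)
  have adj: "snd s 0 (n + 1 + i * n + j) \<noteq> 0 \<longleftrightarrow> {i, j} \<in> gedges G" if "i < n" "j < n" for i j
  proof -
    have "i * n + j < Suc i * n" using that by simp
    also have "\<dots> \<le> n * n" using that by (intro mult_right_mono) auto
    finally have ij: "i * n + j < n * n" .
    then have "w ! (n + 1 + i * n + j) = M ! (i * n + j)"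
      using M(1) by (simp add: w nth_append add.assoc)
    moreover have "n + 1 + i * n + j < length w" using ij M(1) by (simp add: w)
    ultimately show ?thesis using bits M(2)[OF that] by simp
  qed
  have "graph_state G n (2 * d + 1) s2"
    unfolding graph_state_def using s1 r(2) adj
    by (simp add: s2_def lrun_frame_reg lrun_frame_array add.assoc)
  then show "fst (lrun (solve_prog d) s) 11 \<noteq> 0 \<longleftrightarrow> contraction_blocker_alpha d (G, k)"
    using search_prog_correct[OF _ G, of d s2 k] num
    by (simp add: solve_prog_def s1_def[symmetric] s2_def[symmetric] not_less)
qed

theorem theorem6:
  fixes d :: nat
  assumes "d \<ge> 1"
  shows "poly_time_solvable encode_instance
           {(G, k). simple_graph G \<and> standard_vertices G \<and>
                    connected_graph G \<and> bipartite_graph G}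
           (contraction_blocker_alpha d)"
proof -
  define c where "c = Seq (compile (size_prog (2 * d + 1)))
    (Seq (compile (solve_prog d)) (SetReg 0 (Reg 11)))"
  \<comment> \<open>The loop bounds of \<open>solve_prog\<close> are at most
    \<open>2 * d + 1\<close> plus the input length, whence the composition; the summand
    \<open>2\<close> pays for copying the answer to register \<open>0\<close>.\<close>
  define p where "p = ltime (size_prog (2 * d + 1)) +
    pcompose (ltime (solve_prog d)) [:2 * d + 1, 1:] + [:2:]"
  have sol: "\<exists>t s. ram_exec c (ram_init (encode_instance (G, k))) t s \<and>
      t \<le> poly p (length (encode_instance (G, k))) \<and>
      (fst s 0 \<noteq> 0 \<longleftrightarrow> contraction_blocker_alpha d (G, k))"
    if "simple_graph G" "standard_vertices G" "connected_graph G" "bipartite_graph G" for G k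
  proof -
    define w where "w = encode_instance (G, k)"
    define n where "n = card (gverts G)"
    have V: "gverts G = {..<n}" using that(2) by (simp add: standard_vertices_def n_def)
    define s1 where "s1 = lrun (size_prog (2 * d + 1)) (ram_init w)"
    define s2 where "s2 = lrun (solve_prog d) s1"
    note sol = solve_prog_correct[OF that(1,4,3) V, where k = k and d = d, folded w_def, folded s1_def]
    obtain t1 where t1: "ram_exec (compile (size_prog (2 * d + 1))) (ram_init w) t1 s1"
        "t1 \<le> poly (ltime (size_prog (2 * d + 1))) (length w)"
      using lprog_terminates_in_ltime[of "size_prog (2 * d + 1)" "ram_init w" "length w"]
      by (auto simp: s1_def ram_init_def)
    have "fst s1 b \<le> 2 * d + 1 + length w" if "b \<in> lbounds (solve_prog d)" for b
      using that solve_prog_frame(2)[of d] sol(1-5) by auto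
    then obtain t2 where t2: "ram_exec (compile (solve_prog d)) s1 t2 s2"
        "t2 \<le> poly (ltime (solve_prog d)) (2 * d + 1 + length w)"
      using lprog_terminates_in_ltime[OF solve_prog_frame(3,4), of d s1] unfolding s2_def by blast
    have "ram_exec c (ram_init w) (t1 + (t2 + Suc (ram_cost (Reg 11)))) ((fst s2)(0 := ram_val (Reg 11) s2), snd s2)"
      unfolding c_def by (intro ram_exec.Seq[OF t1(1)] ram_exec.Seq[OF t2(1)] ram_exec.SetReg)
    moreover have "t1 + (t2 + Suc (ram_cost (Reg 11))) \<le> poly p (length w)"
      using t1(2) t2(2) by (simp add: p_def poly_pcompose)
    moreover have "fst ((fst s2)(0 := ram_val (Reg 11) s2), snd s2) 0 \<noteq> 0 \<longleftrightarrow> contraction_blocker_alpha d (G, k)"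
      using sol(6) by (simp add: s2_def)
    ultimately show ?thesis unfolding w_def by blast
  qed
  show ?thesis
    unfolding poly_time_solvable_def
  proof (rule exI[where x = c], rule exI[where x = p], rule ballI)
    fix x :: "nat ugraph \<times> int"
    assume x: "x \<in> {(G, k). simple_graph G \<and> standard_vertices G \<and>
                    connected_graph G \<and> bipartite_graph G}"
    obtain G k where "x = (G, k)" by (cases x)
    then show "\<exists>t s. ram_exec c (ram_init (encode_instance x)) t s \<and>
        t \<le> poly p (length (encode_instance x)) \<and> (fst s 0 \<noteq> 0 \<longleftrightarrow> contraction_blocker_alpha d x)"
      using sol[of G k] x by simp
  qed
qed

end
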